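(* Let $m\in C^2(\mathbb{R})$ and $c\in C(\mathbb{R})$ be $1$-periodic, where $m$ is not constant, $m'$ changes sign at most finitely many times on $[0,1]$, and $m'(0)>0$. For $s\in\mathbb{R}$ let $\lambda_1^{\mathcal{P}}(s)$ be the principal eigenvalue of $$-\varphi''(x)-2s\,m'(x)\varphi'(x)+c(x)\varphi(x)=\lambda\varphi(x),\quad \varphi(x)=\varphi(x+1),\qquad x\in\mathbb{R}.$$ Let $\mathcal{M}_1$ be the set of isolated points of local maximum of $m$, and $\mathcal{M}_2,\dots,\mathcal{M}_5$ the families of segments of local maximum of $m$, all understood as restricted to the one-period interval $[0,1]$ and defined as in the context. Then $$\lim_{s\to\infty}\lambda_1^{\mathcal{P}}(s)=\min\Big\{\mathfrak{L},\ \min\{c(x):x\in\mathcal{M}_1\}\Big\},$$ where $$\mathfrak{L}=\min\Big\{\min_{[a,b]\in\mathcal{M}_2}\lambda_1^{\mathcal{ND}}(a,b),\ \min_{[a,b]\in\mathcal{M}_3}\lambda_1^{\mathcal{NN}}(a,b),\ \min_{[a,b]\in\mathcal{M}_4}\lambda_1^{\mathcal{DD}}(a,b),\ \min_{[a,b]\in\mathcal{M}_5}\lambda_1^{\mathcal{DN}}(a,b)\Big\},$$ and a minimum over an empty family is omitted.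
   Context: Principal eigenvalue: the unique real eigenvalue admitting a positive ($1$-periodic) eigenfunction. "$m'$ changes sign at most finitely many times on $[0,1]$" means that $[0,1]$ is a finite union of closed intervals on each of which $m'\ge0$ or $m'\le 0$. For $1$-periodic $m$, isolated points and segments of local maximum are understood to be restricted to the one-period interval $[0,1]$, with the following definitions. Isolated point of local maximum of $m$: a point $x_0\in[0,1]$ such that for some $\epsilon_0>0$, $m(x_0)>m(x)$ for all $x\in\big((x_0-\epsilon_0,x_0+\epsilon_0)\cap[0,1]\big)\setminus\{x_0\}$. $\mathcal{M}_1$ is the set of all such points. Segment of local maximum of $m$ (it need not be a set of genuine local maxima): a closed interval $[a,b]\subset[0,1]$, $a<b$, such that $m$ is constant on $[a,b]$, for some $\epsilon_0>0$ $m$ is weakly monotone on $[a-\epsilon_0,a]\cap[0,1]$ and on $[b,b+\epsilon_0]\cap[0,1]$, and for every small $\epsilon>0$, $m'$ is not identically zero on $(a-\epsilon,a)$ if $a>0$, nor on $(b,b+\epsilon)$ if $b<1$. (As $m'(0)=m'(1)>0$, every segment satisfies $0<a<b<1$.) The left endpoint is of type $I$ (resp. $D$) if $m$ is non-decreasing (resp. non-increasing) on $[a-\epsilon_0,a]$ for some small $\epsilon_0>0$; the right endpoint is of type $I$ (resp. $D$) if $m$ is non-decreasing (resp. non-increasing) on $[b,b+\epsilon_0]$ for some small $\epsilon_0>0$. $\mathcal{M}_2,\mathcal{M}_3,\mathcal{M}_4,\mathcal{M}_5$ are the families of segments with (left type, right type) equal to $(I,I)$, $(I,D)$, $(D,I)$,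 $(D,D)$ respectively; $\mathcal{M}_2,\mathcal{M}_5$ are at most countable and $\mathcal{M}_3,\mathcal{M}_4$ finite; any may be empty. For $i,j\in\{\mathcal{N},\mathcal{D}\}$, $\lambda_1^{ij}(a,b)$ is the principal eigenvalue of $-\varphi''+c\varphi=\lambda\varphi$ on $(a,b)$ with Neumann ($\mathcal N$) or Dirichlet ($\mathcal D$) condition at $a$ according to $i$ and at $b$ according to $j$. The minima over the possibly infinite families $\mathcal{M}_2,\mathcal{M}_5$ are well defined, since the corresponding eigenvalues tend to $\infty$ as the interval length tends to $0$.
   Formalization: Isolated points of local maximum x0 in [0,1] are compared with all x near x0, not only x in [0,1]; otherwise x0=1 always lies in M_1 as m'(1)>0, and the claim fails, e.g. for m=sin(2πx), c=-cos(4πx). *)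

theory Defs
  imports "HOL-Analysis.Analysis"
begin

text \<open>Derivatives are taken within \<open>S\<close>, hence one-sided at the endpoints when \<open>S\<close> is a compact interval.\<close>

definition C2_with :: "real set \<Rightarrow> (real \<Rightarrow> real) \<Rightarrow> (real \<Rightarrow> real) \<Rightarrow> (real \<Rightarrow> real) \<Rightarrow> bool" where
  "C2_with S f f' f'' \<longleftrightarrow>
     (\<forall>x\<in>S. (f has_real_derivative f' x) (at x within S)) \<and>
     (\<forall>x\<in>S. (f' has_real_derivative f'' x) (at x within S)) \<and>
     continuous_on S f''"

definition finitely_many_sign_changes :: "(real \<Rightarrow> real) \<Rightarrow> bool" where
  "finitely_many_sign_changes g \<longleftrightarrow>
     (\<exists>\<I>. finite \<I> \<and> \<Union>\<I> = {0..1} \<and>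
        (\<forall>I\<in>\<I>. (\<exists>u v. u \<le> v \<and> I = {u..v}) \<and>
               ((\<forall>x\<in>I. g x \<ge> 0) \<or> (\<forall>x\<in>I. g x \<le> 0))))"

definition periodic_principal_eigenvalue ::
    "(real \<Rightarrow> real) \<Rightarrow> (real \<Rightarrow> real) \<Rightarrow> real \<Rightarrow> real" where
  "periodic_principal_eigenvalue m c s =
     (THE lam. \<exists>\<phi> \<phi>' \<phi>''. C2_with UNIV \<phi> \<phi>' \<phi>'' \<and>
        (\<forall>x. \<phi> x = \<phi> (x + 1)) \<and> (\<forall>x. \<phi> x > 0) \<and>
        (\<forall>x. - \<phi>'' x - 2 * s * deriv m x * \<phi>' x + c x * \<phi> x = lam * \<phi> x))"

datatype boundary_condition = Neumann | Dirichlet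

fun satisfies_bc :: "boundary_condition \<Rightarrow> real \<Rightarrow> (real \<Rightarrow> real) \<Rightarrow> (real \<Rightarrow> real) \<Rightarrow> bool" where
  "satisfies_bc Neumann x \<phi> \<phi>' \<longleftrightarrow> \<phi>' x = 0"
| "satisfies_bc Dirichlet x \<phi> \<phi>' \<longleftrightarrow> \<phi> x = 0"

definition principal_eigenvalue ::
    "(real \<Rightarrow> real) \<Rightarrow> boundary_condition \<Rightarrow> boundary_condition \<Rightarrow> real \<Rightarrow> real \<Rightarrow> real" where
  "principal_eigenvalue c i j a b =
     (THE lam. \<exists>\<phi> \<phi>' \<phi>''. C2_with {a..b} \<phi> \<phi>' \<phi>'' \<and>
        satisfies_bc i a \<phi> \<phi>' \<and> satisfies_bc j b \<phi> \<phi>' \<and>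
        (\<forall>x\<in>{a<..<b}. \<phi> x > 0) \<and>
        (\<forall>x\<in>{a<..<b}. - \<phi>'' x + c x * \<phi> x = lam * \<phi> x))"

text \<open>The function \<open>m\<close> lives on the circle: the points are restricted to \<open>[0,1]\<close>, but the
  competitors \<open>x\<close> are not. If they were restricted to \<open>[0,1]\<close> too, the point \<open>1\<close> would be counted
  whenever \<open>m'(1) > 0\<close>, although it is not a local maximum of the periodic function \<open>m\<close>. When
  \<open>m'(0) = m'(1) > 0\<close> this is the only point affected.\<close>

definition isolated_local_maxima :: "(real \<Rightarrow> real) \<Rightarrow> real set" where
  "isolated_local_maxima m =
     {x0 \<in> {0..1}. \<exists>\<epsilon>0>0. \<forall>x \<in> {x0 - \<epsilon>0<..<x0 + \<epsilon>0} - {x0}. m x0 > m x}"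

definition segment_of_local_maximum :: "(real \<Rightarrow> real) \<Rightarrow> real \<Rightarrow> real \<Rightarrow> bool" where
  "segment_of_local_maximum m a b \<longleftrightarrow>
     0 \<le> a \<and> a < b \<and> b \<le> 1 \<and> m constant_on {a..b} \<and>
     (\<exists>\<epsilon>0>0. (mono_on ({a - \<epsilon>0..a} \<inter> {0..1}) m \<or> antimono_on ({a - \<epsilon>0..a} \<inter> {0..1}) m) \<and>
             (mono_on ({b..b + \<epsilon>0} \<inter> {0..1}) m \<or> antimono_on ({b..b + \<epsilon>0} \<inter> {0..1}) m)) \<and>
     (\<exists>\<delta>>0. \<forall>\<epsilon>. 0 < \<epsilon> \<and> \<epsilon> < \<delta> \<longrightarrow>
        (a > 0 \<longrightarrow> (\<exists>x\<in>{a - \<epsilon><..<a}. deriv m x \<noteq> 0)) \<and>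
        (b < 1 \<longrightarrow> (\<exists>x\<in>{b<..<b + \<epsilon>}. deriv m x \<noteq> 0)))"

datatype endpoint_type = I | D

fun left_type :: "(real \<Rightarrow> real) \<Rightarrow> real \<Rightarrow> endpoint_type \<Rightarrow> bool" where
  "left_type m a I \<longleftrightarrow> (\<exists>\<epsilon>0>0. mono_on {a - \<epsilon>0..a} m)"
| "left_type m a D \<longleftrightarrow> (\<exists>\<epsilon>0>0. antimono_on {a - \<epsilon>0..a} m)"

fun right_type :: "(real \<Rightarrow> real) \<Rightarrow> real \<Rightarrow> endpoint_type \<Rightarrow> bool" where
  "right_type m b I \<longleftrightarrow> (\<exists>\<epsilon>0>0. mono_on {b..b + \<epsilon>0} m)"
| "right_type m b D \<longleftrightarrow> (\<exists>\<epsilon>0>0. antimono_on {b..b + \<epsilon>0} m)"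

text \<open>A segment \<open>[a,b]\<close> is represented by the pair \<open>(a, b)\<close>.\<close>

definition segments :: "(real \<Rightarrow> real) \<Rightarrow> endpoint_type \<Rightarrow> endpoint_type \<Rightarrow> (real \<times> real) set" where
  "segments m l r =
     {(a, b). segment_of_local_maximum m a b \<and> left_type m a l \<and> right_type m b r}"

definition segment_eigenvalues ::
    "(real \<Rightarrow> real) \<Rightarrow> boundary_condition \<Rightarrow> boundary_condition \<Rightarrow> (real \<times> real) set \<Rightarrow> real set" where
  "segment_eigenvalues c i j \<M> = (\<lambda>(a, b). principal_eigenvalue c i j a b) ` \<M>"

definition has_minimum :: "real set \<Rightarrow> bool" where
  "has_minimum S \<longleftrightarrow> (\<exists>v\<in>S. \<forall>w\<in>S. v \<le> w)"

text \<open>Unlike \<open>Min\<close>, this is also meaningful for infinite sets; it is the minimum of \<open>S\<close>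
  whenever \<open>has_minimum S\<close> holds, and unspecified otherwise.\<close>

definition minimum :: "real set \<Rightarrow> real" where
  "minimum S = (LEAST v. v \<in> S)"

text \<open>The minima of the members of a collection of sets; empty members are left out.\<close>

definition minima :: "real set set \<Rightarrow> real set" where
  "minima \<F> = {minimum F | F. F \<in> \<F> \<and> F \<noteq> {}}"

end

theory Submission
  imports Defs
begin

text \<open>Let \<open>\<phi>\<close> be the periodic principal eigenfunction, normalised by \<open>\<integral> e\<^sup>2\<^sup>s\<^sup>m \<phi>\<^sup>2 = 1\<close> over a period, so that
  \<open>\<lambda>(s) = \<integral> e\<^sup>2\<^sup>s\<^sup>m (\<phi>'\<^sup>2 + c \<phi>\<^sup>2)\<close>. Upper bounds come from Picone's inequality, which lets one test with
  any compactly supported function: a plateau near an isolated maximum, or the eigenfunction of a segment,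
  continued linearly to zero across a Neumann end point, where the weight makes the tail negligible.

  For the lower bound fix \<open>\<mu>\<close> below all candidates. It suffices that the integral of
  \<open>e\<^sup>2\<^sup>s\<^sup>m (\<phi>'\<^sup>2 + (c - \<mu>) \<phi>\<^sup>2)\<close> over \<open>[u, v]\<close> is eventually at least \<open>- \<epsilon> (v - u)\<close>, and by a
  chaining argument only short intervals around each point, or around each maximal interval of constancy
  of \<open>m\<close>, matter. Bounded mass and energy force \<open>e\<^sup>s\<^sup>m \<phi>\<close> to be small wherever \<open>m\<close> can be increased by
  moving monotonically a short way. At an isolated maximum \<open>c > \<mu>\<close>. On a segment one compares with a
  positive solution \<open>g\<close> of \<open>g'' = (c - \<mu>) g\<close>: the boundary terms \<open>(g'/g) e\<^sup>2\<^sup>s\<^sup>m \<phi>\<^sup>2\<close> have the right sign at Neumann ends and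
  vanish in the limit at Dirichlet ends.\<close>

subsection \<open>Linear second order equations\<close>

text \<open>The boundary conditions reflect the behaviour of \<open>m\<close> outside a segment.
  Where \<open>m\<close> rises on leaving it, mass escapes uphill, the weighted eigenfunction
  vanishes at the end in the limit, and the condition is Dirichlet. Where \<open>m\<close> falls,
  the outside carries exponentially little weight, and the condition is Neumann. The obstacle is
  that finitely many sign changes of \<open>m'\<close> still allow infinitely many segments and a
  Cantor-like zero set, so [0,1] need not split into finitely many simple pieces. Hence the chaining
  is a supremum argument, with an error proportional to length, which adds up whatever the number of
  links. Taking \<open>\<mu>\<close> strictly below the candidates gives strict signs of
  \<open>g'\<close> at Neumann ends, which survive slightly beyond the segment. Integrals appear as
  increments of antiderivatives, compared through their derivatives. Principal eigenfunctions are
  constructed by shooting. That a candidate exists at all follows from the lower bound: otherwise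
  the eigenvalue would exceed every constant, although any bound of |c| bounds it.\<close>

lemma deriv_le_imp_diff_le:
  fixes F G :: "real \<Rightarrow> real"
  assumes "a \<le> b" "\<And>x. x \<in> {a..b} \<Longrightarrow> (F has_real_derivative f x) (at x)"
    "\<And>x. x \<in> {a..b} \<Longrightarrow> (G has_real_derivative g x) (at x)" "\<And>x. x \<in> {a..b} \<Longrightarrow> f x \<le> g x"
  shows "F b - F a \<le> G b - G a"
proof -
  have "(\<lambda>x. G x - F x) a \<le> (\<lambda>x. G x - F x) b"
  proof (rule DERIV_nonneg_imp_nondecreasing[OF assms(1)])
    fix x assume "a \<le> x" "x \<le> b"
    then show "\<exists>y. ((\<lambda>x. G x - F x) has_real_derivative y) (at x) \<and> 0 \<le> y"
      using assms(2,3,4)[of x] by (intro exI[of _ "g x - f x"]) (auto intro!: DERIV_diff)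
  qed
  then show ?thesis by simp
qed

text \<open>The normalisation at 0 makes iterated antiderivatives vanish at 0, so that the Picard
  series below has the Cauchy data of its first term.\<close>

definition antideriv :: "(real \<Rightarrow> real) \<Rightarrow> real \<Rightarrow> real" where
  "antideriv f = (SOME F. F 0 = 0 \<and> (\<forall>x. (F has_real_derivative f x) (at x)))"

lemma
  assumes "continuous_on UNIV f"
  shows antideriv_0: "antideriv f 0 = 0"
    and DERIV_antideriv: "(antideriv f has_real_derivative f x) (at x)"
proof -
  have "\<exists>F. \<forall>x::real. -\<infinity> < ereal x \<longrightarrow> ereal x < \<infinity> \<longrightarrow> (F has_vector_derivative f x) (at x)"
    by (rule einterval_antiderivative) (use assms in \<open>auto simp: continuous_on_eq_continuous_at\<close>)
  then obtain F where F: "\<And>x. (F has_real_derivative f x) (at x)"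
    by (auto simp: has_real_derivative_iff_has_vector_derivative)
  have "\<exists>F. F 0 = 0 \<and> (\<forall>x. (F has_real_derivative f x) (at x))"
    by (rule exI[of _ "\<lambda>x. F x - F 0"]) (auto intro!: derivative_eq_intros F)
  from someI_ex[OF this] show "antideriv f 0 = 0" "(antideriv f has_real_derivative f x) (at x)"
    unfolding antideriv_def by blast+
qed

text \<open>The reason for the weight \<open>cosh (k * x)\<close>: one integration reproduces it up
  to the factor \<open>1 / k\<close>, on both half-lines at once, since |sinh| is at most
  cosh.\<close>

lemma antideriv_cosh_bound:
  assumes f: "continuous_on UNIV f" and k: "k > 0" and le: "\<And>x. \<bar>f x\<bar> \<le> C * cosh (k * x)"
  shows "\<bar>antideriv f x\<bar> \<le> C / k * cosh (k * x)"
proof -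
  have C: "C \<ge> 0" using le[of 0] by simp
  let ?G = "\<lambda>x. C / k * sinh (k * x)"
  have G: "(?G has_real_derivative C * cosh (k * x)) (at x)" for x
    using k by (auto intro!: derivative_eq_intros)
  have mG: "((\<lambda>x. - ?G x) has_real_derivative - (C * cosh (k * x))) (at x)" for x
    by (rule DERIV_minus[OF G])
  have "\<bar>antideriv f x\<bar> \<le> \<bar>?G x\<bar>"
  proof (cases "x \<ge> 0")
    case True
    have "antideriv f x - antideriv f 0 \<le> ?G x - ?G 0"
      by (rule deriv_le_imp_diff_le[OF True DERIV_antideriv[OF f] G]) (use le in \<open>auto simp: abs_le_iff\<close>)
    moreover have "- ?G x - - ?G 0 \<le> antideriv f x - antideriv f 0"
      by (rule deriv_le_imp_diff_le[OF True mG DERIV_antideriv[OF f]]) (use le in \<open>auto simp: abs_le_iff, smt\<close>)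
    moreover have "?G 0 = 0" by simp
    ultimately show ?thesis using antideriv_0[OF f] by linarith
  next
    case False
    then have x: "x \<le> 0" by simp
    have "antideriv f 0 - antideriv f x \<le> ?G 0 - ?G x"
      by (rule deriv_le_imp_diff_le[OF x DERIV_antideriv[OF f] G]) (use le in \<open>auto simp: abs_le_iff\<close>)
    moreover have "- ?G 0 - - ?G x \<le> antideriv f 0 - antideriv f x"
      by (rule deriv_le_imp_diff_le[OF x mG DERIV_antideriv[OF f]]) (use le in \<open>auto simp: abs_le_iff, smt\<close>)
    moreover have "?G 0 = 0" by simp
    ultimately show ?thesis using antideriv_0[OF f] by linarith
  qed
  also have "\<dots> = C / k * \<bar>sinh (k * x)\<bar>" using C k by (simp add: abs_mult)
  also have "\<dots> \<le> C / k * cosh (k * x)"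
  proof (rule mult_left_mono)
    show "\<bar>sinh (k * x)\<bar> \<le> cosh (k * x)"
      by (auto simp: abs_le_iff sinh_def cosh_def)
  qed (use C k in auto)
  finally show ?thesis .
qed

text \<open>Potentials live on the whole line, so solutions are taken to be global. This avoids
  one-sided derivatives at the ends of an interval and makes reflection and translation
  immediate.\<close>

definition solves_ode :: "(real \<Rightarrow> real) \<Rightarrow> (real \<Rightarrow> real) \<Rightarrow> (real \<Rightarrow> real) \<Rightarrow> bool" where
  "solves_ode Q u u' \<longleftrightarrow> (\<forall>x. (u has_real_derivative u' x) (at x) \<and> (u' has_real_derivative Q x * u x) (at x))"

lemma solves_odeD:
  assumes "solves_ode Q u u'"
  shows "(u has_real_derivative u' x) (at x)" "(u' has_real_derivative Q x * u x) (at x)"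
    "continuous_on A u" "continuous_on A u'" "isCont u x" "isCont u' x"
proof -
  show "(u has_real_derivative u' x) (at x)" "(u' has_real_derivative Q x * u x) (at x)" for x
    using assms by (auto simp: solves_ode_def)
  then show "isCont u x" "isCont u' x" for x using DERIV_isCont by blast+
  then show "continuous_on A u" "continuous_on A u'" by (auto intro: continuous_at_imp_continuous_on)
qed

lemma solves_ode_reflect:
  assumes "solves_ode Q u u'"
  shows "solves_ode (\<lambda>x. Q (r - x)) (\<lambda>x. u (r - x)) (\<lambda>x. - u' (r - x))"
proof -
  have g: "((\<lambda>x. r - x) has_real_derivative -1) (at x)" for x by (auto intro!: derivative_eq_intros)
  show ?thesis
    unfolding solves_ode_def
    using DERIV_chain2[OF solves_odeD(1)[OF assms] g] DERIV_minus[OF DERIV_chain2[OF solves_odeD(2)[OF assms] g]]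
    by simp
qed

lemma solves_ode_shift:
  assumes "solves_ode Q u u'"
  shows "solves_ode (\<lambda>x. Q (x + r)) (\<lambda>x. u (x + r)) (\<lambda>x. u' (x + r))"
proof -
  have g: "((\<lambda>x. x + r) has_real_derivative 1) (at x)" for x by (auto intro!: derivative_eq_intros)
  show ?thesis
    unfolding solves_ode_def
    using DERIV_chain2[OF solves_odeD(1)[OF assms] g] DERIV_chain2[OF solves_odeD(2)[OF assms] g] by simp
qed

lemma solves_ode_lincomb:
  assumes "solves_ode Q u u'" "solves_ode Q v v'"
  shows "solves_ode Q (\<lambda>x. u x + k * v x) (\<lambda>x. u' x + k * v' x)"
  unfolding solves_ode_def
  by (auto intro!: derivative_eq_intros solves_odeD[OF assms(1)] solves_odeD[OF assms(2)] simp: algebra_simps)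

text \<open>The terms of the Picard series decay geometrically once they are measured against
  \<open>cosh (k x)\<close> with \<open>k\<^sup>2 = 2 K\<close>.\<close>

lemma solves_ode_exists_0:
  assumes Q: "continuous_on UNIV Q" and K: "\<And>x. \<bar>Q x\<bar> \<le> K" "K > 0"
  shows "\<exists>u u'. solves_ode Q u u' \<and> u 0 = \<alpha> \<and> u' 0 = \<beta>"
proof -
  define k where "k = sqrt (2 * K)"
  have k: "k > 0" "k * k = 2 * K" using K by (auto simp: k_def)
  define v where "v = rec_nat (\<lambda>x. \<alpha> + \<beta> * x) (\<lambda>n vn. antideriv (antideriv (\<lambda>x. Q x * vn x)))"
  define w where "w n = (case n of 0 \<Rightarrow> \<lambda>x. \<beta> | Suc j \<Rightarrow> antideriv (\<lambda>x. Q x * v j x))" for n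
  define z where "z n = (case n of 0 \<Rightarrow> \<lambda>x. 0 | Suc j \<Rightarrow> (\<lambda>x. Q x * v j x))" for n
  \<comment> \<open>This makes \<open>A * cosh (k * x)\<close> dominate the linear first term,
    because \<open>k * \<bar>x\<bar> \<le> cosh (k * x)\<close>.\<close>
  define A where "A = \<bar>\<alpha>\<bar> + \<bar>\<beta>\<bar> / k"
  have v0: "v 0 = (\<lambda>x. \<alpha> + \<beta> * x)" and vS: "v (Suc n) = antideriv (w (Suc n))" for n
    by (auto simp: v_def w_def)
  have wS: "w (Suc n) = antideriv (z (Suc n))" for n by (simp add: w_def z_def)
  have all: "continuous_on UNIV (v n) \<and> (\<forall>x. (w n has_real_derivative z n x) (at x)) \<and>
     (\<forall>x. (v n has_real_derivative w n x) (at x)) \<and> (\<forall>x. \<bar>v n x\<bar> \<le> A / 2 ^ n * cosh (k * x))" for n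
  proof (induction n)
    case 0
    have "\<bar>\<alpha> + \<beta> * x\<bar> \<le> A * cosh (k * x)" for x
    proof -
      have c1: "cosh (k * x) \<ge> 1" by (rule cosh_real_ge_1)
      have "(k * x) * (k * x) \<le> cosh (k*x) * cosh (k*x)" if "x \<ge> 0" for x
      proof -
        have "k * x - k * 0 \<le> sinh (k * x) - sinh (k * 0)"
          by (rule deriv_le_imp_diff_le[where f="\<lambda>_. k" and g = "\<lambda>x. k * cosh (k * x)", OF that])
             (auto intro!: derivative_eq_intros simp: cosh_real_ge_1 k less_imp_le)
        then have "k * x \<le> cosh (k * x)" by (auto simp: sinh_def cosh_def intro: order_trans)
        then show ?thesis using k that by (intro mult_mono) auto
      qed
      from this[of "\<bar>x\<bar>"] have "(k * x)\<^sup>2 \<le> (cosh (k*x))\<^sup>2"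
        using k by (cases "x \<ge> 0") (auto simp: power2_eq_square)
      then have c2: "k * \<bar>x\<bar> \<le> cosh (k * x)"
        using k by (metis abs_le_square_iff abs_mult abs_of_pos abs_of_nonneg cosh_real_nonneg)
      have "\<bar>\<alpha> + \<beta> * x\<bar> \<le> \<bar>\<alpha>\<bar> * 1 + \<bar>\<beta>\<bar> / k * (k * \<bar>x\<bar>)" using k by (auto simp: abs_mult intro: order_trans[OF abs_triangle_ineq])
      also have "\<dots> \<le> \<bar>\<alpha>\<bar> * cosh (k * x) + \<bar>\<beta>\<bar> / k * cosh (k * x)"
        by (intro add_mono mult_left_mono c1 c2) (use k in auto)
      finally show ?thesis by (simp add: A_def algebra_simps)
    qed
    then show ?case by (auto simp: v0 w_def z_def intro!: derivative_eq_intros continuous_intros)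
  next
    case (Suc n)
    have zc: "continuous_on UNIV (z (Suc n))" using Suc Q by (auto simp: z_def intro!: continuous_intros)
    have zb: "\<bar>z (Suc n) x\<bar> \<le> K * (A / 2 ^ n) * cosh (k * x)" for x
    proof -
      have "\<bar>z (Suc n) x\<bar> \<le> K * (A / 2 ^ n * cosh (k * x))"
        using Suc K mult_mono[OF K(1)[of x], of "\<bar>v n x\<bar>" "A / 2 ^ n * cosh (k * x)"]
        by (simp add: z_def abs_mult less_imp_le)
      then show ?thesis by (simp add: mult.assoc)
    qed
    have wd: "(w (Suc n) has_real_derivative z (Suc n) x) (at x)" for x
      unfolding wS by (rule DERIV_antideriv[OF zc])
    then have wc: "continuous_on UNIV (w (Suc n))"
      by (meson DERIV_isCont continuous_at_imp_continuous_on)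
    have wb: "\<bar>w (Suc n) x\<bar> \<le> K * (A / 2 ^ n) / k * cosh (k * x)" for x
      unfolding wS by (rule antideriv_cosh_bound[OF zc k(1) zb])
    have vd: "(v (Suc n) has_real_derivative w (Suc n) x) (at x)" for x
      unfolding vS by (rule DERIV_antideriv[OF wc])
    then have vc: "continuous_on UNIV (v (Suc n))"
      by (meson DERIV_isCont continuous_at_imp_continuous_on)
    have vb: "\<bar>v (Suc n) x\<bar> \<le> K * (A / 2 ^ n) / k / k * cosh (k * x)" for x
      unfolding vS by (rule antideriv_cosh_bound[OF wc k(1) wb])
    \<comment> \<open>One multiplication by \<open>Q\<close> and two integrations cost the factor
      \<open>K / (k * k) = 1 / 2\<close>.\<close>
    have "K * (A / 2 ^ n) / k / k = A / 2 ^ Suc n"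
    proof -
      have "K * (A / 2 ^ n) / k / k = K * (A / 2 ^ n) / (k * k)" by simp
      also have "\<dots> = A / 2 ^ Suc n" unfolding k(2) using K(2) by simp
      finally show ?thesis .
    qed
    then show ?case using vc wd vd vb by simp
  qed
  have wb: "\<bar>w (Suc n) x\<bar> \<le> K * (A / 2 ^ n) / k * cosh (k * x)" for n x
  proof -
    have zc: "continuous_on UNIV (z (Suc n))" using all[of n] Q by (auto simp: z_def intro!: continuous_intros)
    have zb: "\<bar>z (Suc n) x\<bar> \<le> K * (A / 2 ^ n) * cosh (k * x)" for x
    proof -
      have "\<bar>z (Suc n) x\<bar> \<le> K * (A / 2 ^ n * cosh (k * x))"
        using all[of n] K mult_mono[OF K(1)[of x], of "\<bar>v n x\<bar>" "A / 2 ^ n * cosh (k * x)"]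
        by (simp add: z_def abs_mult less_imp_le)
      then show ?thesis by (simp add: mult.assoc)
    qed
    show ?thesis unfolding wS by (rule antideriv_cosh_bound[OF zc k(1) zb])
  qed
  have geo: "summable (\<lambda>n. C / 2 ^ n)" for C :: real
    using summable_mult[OF summable_geometric[of "1/2::real"], of C] by (simp add: power_one_over field_simps)
  have cosh_mono: "cosh (k * x) \<le> cosh (k * R)" if "\<bar>x\<bar> \<le> R" for x R
  proof -
    have "cosh (k * x) = cosh (k * \<bar>x\<bar>)" by (cases "x \<ge> 0") auto
    also have "\<dots> \<le> cosh (k * R)"
      using that k cosh_real_nonneg_le_iff[of "k * \<bar>x\<bar>" "k * R"] by (auto intro: order_trans[OF _ that])
    finally show ?thesis .
  qed
  \<comment> \<open>The factor 2 shifts the exponent from \<open>j\<close> to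
    \<open>n = Suc j\<close>, and the maximum covers \<open>w 0\<close>, which is the constant
    \<open>\<beta>\<close>. Termwise differentiation, done twice, asks for such bounds on compact
    intervals for both derivative series.\<close>
  define B1 where "B1 R = max \<bar>\<beta>\<bar> (2 * (K * A / k * cosh (k * R)))" for R
  define B2 where "B2 R = 2 * (K * A * cosh (k * R))" for R
  have bound: "\<bar>v n x\<bar> \<le> A * cosh (k * R) / 2 ^ n" "\<bar>w n x\<bar> \<le> B1 R / 2 ^ n" "\<bar>z n x\<bar> \<le> B2 R / 2 ^ n" if x: "\<bar>x\<bar> \<le> R" for n x R
  proof -
    have A: "A \<ge> 0" using k by (auto simp: A_def)
    have v: "\<bar>v n x\<bar> \<le> A * cosh (k * R) / 2 ^ n" for n
    proof -
      have "\<bar>v n x\<bar> \<le> A / 2 ^ n * cosh (k * x)" using all by blast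
      also have "\<dots> \<le> A / 2 ^ n * cosh (k * R)" using A by (intro mult_left_mono cosh_mono x) auto
      finally show ?thesis by simp
    qed
    then show "\<bar>v n x\<bar> \<le> A * cosh (k * R) / 2 ^ n" .
    show "\<bar>z n x\<bar> \<le> B2 R / 2 ^ n"
    proof (cases n)
      case 0
      then show ?thesis using K A by (auto simp: z_def B2_def)
    next
      case (Suc j)
      have "\<bar>z n x\<bar> \<le> K * (A * cosh (k * R) / 2 ^ j)"
        using K mult_mono[OF K(1)[of x] v[of j]] by (simp add: z_def Suc abs_mult less_imp_le)
      then show ?thesis by (simp add: Suc mult.assoc B2_def)
    qed
    show "\<bar>w n x\<bar> \<le> B1 R / 2 ^ n"
    proof (cases n)
      case 0
      then show ?thesis by (simp add: w_def B1_def)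
    next
      case (Suc j)
      have "\<bar>w n x\<bar> \<le> K * (A / 2 ^ j) / k * cosh (k * x)" using wb Suc by simp
      also have "\<dots> \<le> K * (A / 2 ^ j) / k * cosh (k * R)"
        using A K k by (intro mult_left_mono cosh_mono x) auto
      also have "\<dots> = (2 * (K * A / k * cosh (k * R))) / 2 ^ n" by (simp add: Suc mult.commute mult.left_commute)
      also have "\<dots> \<le> B1 R / 2 ^ n"
        unfolding B1_def by (intro divide_right_mono) auto
      finally show ?thesis .
    qed
  qed
  define u where "u x = (\<Sum>n. v n x)" for x
  define u' where "u' x = (\<Sum>n. w n x)" for x
  have int: "x \<in> interior {- (\<bar>x\<bar> + 1)..\<bar>x\<bar> + 1}" for x :: real by auto
  have sv: "summable (\<lambda>n. v n x)" and sw: "summable (\<lambda>n. w n x)" for x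
    by (rule summable_comparison_test'[OF geo[of "A * cosh (k * \<bar>x\<bar>)"]], use bound(1)[of x] in simp)
       (rule summable_comparison_test'[OF geo[of "B1 \<bar>x\<bar>"]], use bound(2)[of x] in simp)
  have du: "(u has_real_derivative u' x) (at x)" for x
    unfolding u_def u'_def
  proof (rule has_field_derivative_series'(2)[OF _ _ _ _ _ int])
    show "uniformly_convergent_on {- (\<bar>x\<bar> + 1)..\<bar>x\<bar> + 1} (\<lambda>n x. \<Sum>i<n. w i x)"
      by (rule Weierstrass_m_test'[OF _ geo[of "B1 (\<bar>x\<bar> + 1)"]]) (use bound(2)[of _ "\<bar>x\<bar> + 1"] in auto)
  qed (use all sv in \<open>auto intro: has_field_derivative_at_within[where x = x for x]\<close>)
  have du': "(u' has_real_derivative (\<Sum>n. z n x)) (at x)" for x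
    unfolding u'_def
  proof (rule has_field_derivative_series'(2)[OF _ _ _ _ _ int])
    show "uniformly_convergent_on {- (\<bar>x\<bar> + 1)..\<bar>x\<bar> + 1} (\<lambda>n x. \<Sum>i<n. z i x)"
      by (rule Weierstrass_m_test'[OF _ geo[of "B2 (\<bar>x\<bar> + 1)"]]) (use bound(3)[of _ "\<bar>x\<bar> + 1"] in auto)
  qed (use all sw in \<open>auto intro: has_field_derivative_at_within[where x = x for x]\<close>)
  have z: "(\<Sum>n. z n x) = Q x * u x" for x
  proof -
    have "summable (\<lambda>n. z n x)"
      by (rule summable_comparison_test'[OF geo[of "B2 \<bar>x\<bar>"]]) (use bound(3)[of x] in simp)
    then have "(\<Sum>n. z n x) = (\<Sum>n. z (Suc n) x)" by (subst suminf_split_head) (auto simp: z_def)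
    also have "\<dots> = Q x * u x" unfolding u_def using suminf_mult[OF sv] by (simp add: z_def)
    finally show ?thesis .
  qed
  have "u 0 = \<alpha>" "u' 0 = \<beta>"
  proof -
    have "v (Suc n) 0 = 0" for n
      unfolding vS using all[of "Suc n"]
      by (intro antideriv_0) (meson DERIV_isCont continuous_at_imp_continuous_on)
    moreover have "w (Suc n) 0 = 0" for n
      unfolding wS using all[of n] Q by (intro antideriv_0) (auto simp: z_def intro!: continuous_intros)
    ultimately show "u 0 = \<alpha>" "u' 0 = \<beta>"
      using suminf_split_head[OF sv, of 0] suminf_split_head[OF sw, of 0] unfolding u_def u'_def
      by (auto simp: v0 w_def)
  qed
  moreover have "solves_ode Q u u'" unfolding solves_ode_def using du du' z by simp
  ultimately show ?thesis by blast
qed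

lemma solves_ode_exists:
  assumes Q: "continuous_on UNIV Q" and K: "\<And>x. \<bar>Q x\<bar> \<le> K"
  shows "\<exists>u u'. solves_ode Q u u' \<and> u p = \<alpha> \<and> u' p = \<beta>"
proof -
  have "continuous_on UNIV (\<lambda>x. Q (x + p))"
    by (rule continuous_on_compose2[OF Q]) (auto intro!: continuous_intros)
  moreover have "\<bar>Q (x + p)\<bar> \<le> \<bar>K\<bar> + 1" for x using K[of "x + p"] by linarith
  ultimately obtain u u' where u: "solves_ode (\<lambda>x. Q (x + p)) u u'" "u 0 = \<alpha>" "u' 0 = \<beta>"
    using solves_ode_exists_0[of "\<lambda>x. Q (x + p)" "\<bar>K\<bar> + 1" \<alpha> \<beta>] by (auto simp: add_nonneg_pos)
  show ?thesis
    using solves_ode_shift[OF u(1), of "- p"] u(2,3) by force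
qed

text \<open>Gronwall's inequality for \<open>E = d\<^sup>2 + d'\<^sup>2\<close>: by Young's
  inequality the derivative of \<open>E\<close> is at most \<open>(K + 2) * E + r\<^sup>2\<close>.
  With \<open>r = 0\<close> this gives uniqueness, with \<open>r > 0\<close> the dependence of
  solutions on the spectral parameter.\<close>

lemma energy_estimate:
  fixes d d' e :: "real \<Rightarrow> real"
  assumes ab: "a \<le> b" and "K \<ge> 0"
    and d: "\<And>x. (d has_real_derivative d' x) (at x)" "\<And>x. (d' has_real_derivative e x) (at x)"
    and e: "\<And>x. x \<in> {a..b} \<Longrightarrow> \<bar>e x\<bar> \<le> K * \<bar>d x\<bar> + r"
  shows "(d b)\<^sup>2 + (d' b)\<^sup>2 \<le> ((d a)\<^sup>2 + (d' a)\<^sup>2 + r\<^sup>2 * (b - a)) * exp ((K + 2) * (b - a))"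
proof -
  define E where "E x = (d x)\<^sup>2 + (d' x)\<^sup>2" for x
  define G where "G x = E x * exp (- ((K + 2) * (x - a)))" for x
  have dG: "(G has_real_derivative (2 * d x * d' x + 2 * d' x * e x - (K + 2) * E x) * exp (- ((K + 2) * (x - a)))) (at x)" for x
    unfolding G_def E_def by (rule derivative_eq_intros d refl | simp)+ (simp add: algebra_simps)
  have "G b - G a \<le> r\<^sup>2 * b - r\<^sup>2 * a"
  proof (rule deriv_le_imp_diff_le[OF ab dG, where g = "\<lambda>_. r\<^sup>2"])
    fix x assume x: "x \<in> {a..b}"
    have "2 * d' x * e x \<le> 2 * (\<bar>d' x\<bar> * \<bar>e x\<bar>)" by (simp add: flip: abs_mult)
    also have "\<dots> \<le> 2 * (\<bar>d' x\<bar> * (K * \<bar>d x\<bar> + r))" using e[OF x] by (intro mult_left_mono) auto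
    also have "\<dots> = K * (2 * \<bar>d x\<bar> * \<bar>d' x\<bar>) + 2 * r * \<bar>d' x\<bar>" by (simp add: algebra_simps)
    also have "\<dots> \<le> K * E x + (r\<^sup>2 + (d' x)\<^sup>2)"
    proof (intro add_mono mult_left_mono)
      show "2 * \<bar>d x\<bar> * \<bar>d' x\<bar> \<le> E x"
        using sum_squares_bound[of "\<bar>d x\<bar>" "\<bar>d' x\<bar>"] by (simp add: E_def)
      show "2 * r * \<bar>d' x\<bar> \<le> r\<^sup>2 + (d' x)\<^sup>2" using sum_squares_bound[of r "\<bar>d' x\<bar>"] by simp
    qed fact
    finally have 1: "2 * d' x * e x \<le> K * E x + (r\<^sup>2 + (d' x)\<^sup>2)" .
    have 2: "2 * d x * d' x \<le> E x" using sum_squares_bound[of "d x" "d' x"] by (simp add: E_def)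
    have 3: "(d' x)\<^sup>2 \<le> E x" by (simp add: E_def)
    have "2 * d x * d' x + 2 * d' x * e x - (K + 2) * E x \<le> r\<^sup>2" using 1 2 3 by (simp add: algebra_simps)
    then have "(2 * d x * d' x + 2 * d' x * e x - (K + 2) * E x) * exp (- ((K + 2) * (x - a)))
       \<le> r\<^sup>2 * exp (- ((K + 2) * (x - a)))" by (intro mult_right_mono) auto
    also have "\<dots> \<le> r\<^sup>2 * 1" using x assms(2) by (intro mult_left_mono) auto
    finally show "(2 * d x * d' x + 2 * d' x * e x - (K + 2) * E x) * exp (- ((K + 2) * (x - a))) \<le> r\<^sup>2" by simp
  qed (auto intro!: derivative_eq_intros)
  then have "G b \<le> E a + r\<^sup>2 * (b - a)" by (simp add: G_def algebra_simps)
  then have "G b * exp ((K + 2) * (b - a)) \<le> (E a + r\<^sup>2 * (b - a)) * exp ((K + 2) * (b - a))"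
    by (intro mult_right_mono) auto
  moreover have "G b * exp ((K + 2) * (b - a)) = E b" by (simp add: G_def flip: exp_add)
  ultimately show ?thesis by (simp add: E_def)
qed

lemma solves_ode_zero:
  assumes u: "solves_ode Q u u'" "u p = 0" "u' p = 0" and K: "\<And>x. \<bar>Q x\<bar> \<le> K"
  shows "u x = 0 \<and> u' x = 0"
proof -
  have K0: "K \<ge> 0" using K[of 0] by linarith
  have R: "v x = 0 \<and> v' x = 0"
    if v: "solves_ode R v v'" "v q = 0" "v' q = 0" and R: "\<And>x. \<bar>R x\<bar> \<le> K" and "q \<le> x" for R v v' q x
  proof -
    have "(v x)\<^sup>2 + (v' x)\<^sup>2 \<le> ((v q)\<^sup>2 + (v' q)\<^sup>2 + 0\<^sup>2 * (x - q)) * exp ((K + 2) * (x - q))"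
      by (rule energy_estimate[OF \<open>q \<le> x\<close> K0 solves_odeD(1,2)[OF v(1)]])
         (use R in \<open>auto simp: abs_mult intro!: mult_right_mono\<close>)
    then show ?thesis using v(2,3) by (simp add: sum_power2_le_zero_iff)
  qed
  show ?thesis
  proof (cases "p \<le> x")
    case True
    then show ?thesis using R[OF u K] by simp
  next
    case False
    have "u (0 - (- x)) = 0 \<and> - u' (0 - (- x)) = 0"
      by (rule R[OF solves_ode_reflect[OF u(1), of 0], of "- p"]) (use u(2,3) K False in auto)
    then show ?thesis by simp
  qed
qed

lemma solves_ode_unique:
  assumes "solves_ode Q u u'" "solves_ode Q v v'" "u p = v p" "u' p = v' p" and K: "\<And>x. \<bar>Q x\<bar> \<le> K"
  shows "u x = v x \<and> u' x = v' x"
  using solves_ode_zero[OF solves_ode_lincomb[OF assms(1,2), of "-1"] _ _ K, of p x] assms(3,4) by simp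

subsection \<open>Principal eigenvalues on an interval\<close>

text \<open>Positivity is required to the right of \<open>p\<close> and not at \<open>p\<close>,
  because \<open>v p\<close> is itself zero in the Dirichlet case.\<close>

lemma first_zero:
  fixes v :: "real \<Rightarrow> real"
  assumes cont: "continuous_on {p..z} v" and e: "p < e" "e \<le> z" "\<And>x. x \<in> {p<..e} \<Longrightarrow> v x > 0" and z: "v z \<le> 0"
  shows "\<exists>y\<in>{p<..z}. v y = 0 \<and> (\<forall>x\<in>{p<..<y}. v x > 0)"
proof -
  define Z where "Z = {x \<in> {e..z}. v x = 0}"
  have c: "continuous_on {e..z} v" using cont by (rule continuous_on_subset) (use e in auto)
  obtain z0 where z0: "e \<le> z0" "z0 \<le> z" "v z0 = 0"
    using IVT2'[of v z 0 e] e z c by force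
  have "closed Z" unfolding Z_def
    using continuous_closed_preimage_constant[OF c closed_atLeastAtMost] by simp
  have "bdd_below Z" by (auto simp: Z_def)
  have "Z \<noteq> {}" using z0 by (auto simp: Z_def)
  have inZ: "Inf Z \<in> Z" by (rule closed_contains_Inf) fact+
  have "v x > 0" if x: "p < x" "x < Inf Z" for x
  proof (rule ccontr)
    assume n: "\<not> v x > 0"
    then have ex: "e < x" using e(3)[of x] x by force
    have xz: "x \<le> z" using x inZ by (auto simp: Z_def)
    obtain y where y: "e \<le> y" "y \<le> x" "v y = 0"
      using IVT2'[of v x 0 e] e(1,3) n ex continuous_on_subset[OF c, of "{e..x}"] xz by force
    then have "y \<in> Z" using xz by (auto simp: Z_def)
    then have "Inf Z \<le> y" using \<open>bdd_below Z\<close> by (rule cInf_lower)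
    then show False using x y by simp
  qed
  moreover have "Inf Z \<in> {p<..z}" "v (Inf Z) = 0" using inZ e by (auto simp: Z_def)
  ultimately show ?thesis by (intro bexI[of _ "Inf Z"]) auto
qed

lemma deriv_nonpos_at_right_zero:
  fixes v :: "real \<Rightarrow> real"
  assumes "(v has_real_derivative v') (at y)" "p < y" "\<And>x. x \<in> {p<..<y} \<Longrightarrow> v x \<ge> v y"
  shows "v' \<le> 0"
proof (rule ccontr)
  assume "\<not> v' \<le> 0"
  then obtain d where d: "d > 0" "\<And>h. 0 < h \<Longrightarrow> h < d \<Longrightarrow> v (y - h) < v y"
    using DERIV_pos_inc_left[OF assms(1)] by auto
  define h where "h = min d (y - p) / 2"
  have "0 < h" "h < d" "h < y - p" using d(1) assms(2) by (auto simp: h_def min_def)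
  then show False using d(2)[of h] assms(3)[of "y - h"] by auto
qed

lemma nonneg_at_right_end:
  fixes f :: "real \<Rightarrow> real"
  assumes "isCont f b" "p < b" "\<And>x. x \<in> {p<..<b} \<Longrightarrow> f x \<ge> 0"
  shows "f b \<ge> 0"
proof -
  have "(f \<longlongrightarrow> f b) (at_left b)" using assms(1) by (simp add: isCont_def filterlim_at_split)
  moreover have "eventually (\<lambda>x. f x \<ge> 0) (at_left b)"
    using eventually_at_left_real[OF assms(2)] by eventually_elim (use assms(3) in auto)
  ultimately show ?thesis by (intro tendsto_lowerbound) auto
qed

text \<open>The Wronskian \<open>W = v' * \<psi> - v * \<psi>'\<close> has derivative
  \<open>(Q - R) * v * \<psi>\<close>, positive as long as \<open>v\<close> is. At a first zero of
  \<open>v\<close> it would equal \<open>v' * \<psi> \<le> 0\<close>, although it started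
  nonnegative and increased.\<close>

lemma sturm_comparison:
  assumes v: "solves_ode Q v v'" and psi: "solves_ode R \<psi> \<psi>'" and "p < b"
    and QR: "\<And>x. x \<in> {p<..<b} \<Longrightarrow> R x < Q x" and pos: "\<And>x. x \<in> {p<..<b} \<Longrightarrow> \<psi> x > 0"
    and W: "v' p * \<psi> p - v p * \<psi>' p \<ge> 0" and start: "v p > 0 \<or> (v p = 0 \<and> v' p > 0)"
  shows "\<forall>x\<in>{p<..b}. v x > 0" "v' b * \<psi> b - v b * \<psi>' b > 0"
proof -
  define W where "W x = v' x * \<psi> x - v x * \<psi>' x" for x
  have dW: "(W has_real_derivative (Q x - R x) * v x * \<psi> x) (at x)" for x
    unfolding W_def
    by (rule derivative_eq_intros solves_odeD[OF v] solves_odeD[OF psi] refl)+ (simp add: algebra_simps)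
  have W_less: "W y > 0" if y: "p < y" "y \<le> b" and vy: "\<And>x. x \<in> {p<..<y} \<Longrightarrow> v x > 0" for y
  proof -
    have "W p < W y"
    proof (rule DERIV_pos_imp_increasing_open[OF y(1)])
      fix x assume "p < x" "x < y"
      then show "\<exists>d. (W has_real_derivative d) (at x) \<and> 0 < d"
        using dW[of x] QR[of x] pos[of x] vy[of x] y by (intro exI[of _ "(Q x - R x) * v x * \<psi> x"]) auto
    qed (intro continuous_at_imp_continuous_on ballI DERIV_isCont[OF dW])
    then show ?thesis using W by (simp add: W_def)
  qed
  obtain e where e: "p < e" "\<And>x. x \<in> {p<..e} \<Longrightarrow> v x > 0"
  proof -
    have "\<exists>d>0. \<forall>x. p < x \<and> x < p + d \<longrightarrow> v x > 0"
      using start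
    proof
      assume "v p > 0"
      then have "\<forall>\<^sub>F x in at p. v x > 0"
        using solves_odeD(5)[OF v, of p] by (intro order_tendstoD) (auto simp: isCont_def)
      then obtain d where "d > 0" "\<forall>x. x \<noteq> p \<and> dist x p < d \<longrightarrow> v x > 0" by (auto simp: eventually_at)
      then show ?thesis by (intro exI[of _ d]) (auto simp: dist_real_def)
    next
      assume a: "v p = 0 \<and> v' p > 0"
      then obtain d where d: "d > 0" "\<And>h. 0 < h \<Longrightarrow> h < d \<Longrightarrow> v p < v (p + h)"
        using DERIV_pos_inc_right[OF solves_odeD(1)[OF v], of p] by auto
      have "v x > 0" if "p < x" "x < p + d" for x using d(2)[of "x - p"] that a by auto
      then show ?thesis using d(1) by blast
    qed
    then obtain d where "d > 0" "\<forall>x. p < x \<and> x < p + d \<longrightarrow> v x > 0" by blast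
    then show ?thesis by (intro that[of "p + d / 2"]) auto
  qed
  show pos_v: "\<forall>x\<in>{p<..b}. v x > 0"
  proof (rule ccontr)
    assume "\<not> (\<forall>x\<in>{p<..b}. v x > 0)"
    then obtain z where z: "p < z" "z \<le> b" "v z \<le> 0" by force
    have "\<exists>y\<in>{p<..z}. v y = 0 \<and> (\<forall>x\<in>{p<..<y}. v x > 0)"
    proof (rule first_zero[OF solves_odeD(3)[OF v] e(1) _ e(2) z(3)])
      show "e \<le> z" using e z by force
    qed auto
    then obtain y where y: "p < y" "y \<le> z" "v y = 0" "\<And>x. x \<in> {p<..<y} \<Longrightarrow> v x > 0" by auto
    have "v' y \<le> 0"
      by (rule deriv_nonpos_at_right_zero[OF solves_odeD(1)[OF v] y(1)]) (use y in \<open>auto intro: less_imp_le\<close>)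
    moreover have "\<psi> y \<ge> 0"
      by (rule nonneg_at_right_end[OF solves_odeD(5)[OF psi] y(1)]) (use pos y z in \<open>auto intro: less_imp_le\<close>)
    ultimately have "W y \<le> 0" by (simp add: W_def y(3) mult_nonpos_nonneg)
    then show False using W_less[of y] y z by auto
  qed
  show "v' b * \<psi> b - v b * \<psi>' b > 0"
    using W_less[OF \<open>p < b\<close>] pos_v by (auto simp: W_def)
qed

text \<open>The first of three explicit comparison functions: the constant serves spectral
  parameters below \<open>- K\<close>, the sine bounds the parameters with a positive solution from
  above, and the cosine handles short intervals.\<close>

lemma solves_ode_const: "solves_ode (\<lambda>_. 0) (\<lambda>_. 1) (\<lambda>_. 0)"
  by (auto simp: solves_ode_def)

lemma solves_ode_sin: "solves_ode (\<lambda>_. - k\<^sup>2) (\<lambda>x. sin (k * (x - a))) (\<lambda>x. k * cos (k * (x - a)))"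
  unfolding solves_ode_def by (auto intro!: derivative_eq_intros simp: power2_eq_square)

lemma solves_ode_cos: "solves_ode (\<lambda>_. - k\<^sup>2) (\<lambda>x. cos (k * (x - a))) (\<lambda>x. - k * sin (k * (x - a)))"
  unfolding solves_ode_def by (auto intro!: derivative_eq_intros simp: power2_eq_square)

section \<open>Shooting in the spectral parameter\<close>

locale bounded_potential =
  fixes c :: "real \<Rightarrow> real" and K :: real
  assumes continuous_c: "continuous_on UNIV c" and bounded_c: "\<bar>c x\<bar> \<le> K"
begin

lemma K_nonneg: "K \<ge> 0" using bounded_c[of 0] by linarith

lemma ivp_exists: "\<exists>u u'. solves_ode (\<lambda>x. c x - \<nu>) u u' \<and> u p = \<alpha> \<and> u' p = \<beta>"
proof (rule solves_ode_exists)
  show "continuous_on UNIV (\<lambda>x. c x - \<nu>)" using continuous_c by (intro continuous_intros)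
  show "\<bar>c x - \<nu>\<bar> \<le> K + \<bar>\<nu>\<bar>" for x using bounded_c[of x] by linarith
qed

lemma bounded_c_minus: "\<bar>c x - \<nu>\<bar> \<le> K + \<bar>\<nu>\<bar>" using bounded_c[of x] by linarith

text \<open>The difference of the solutions for \<open>\<nu>\<close> and \<open>\<mu>\<close> has
  zero Cauchy data at \<open>a\<close> and solves the equation for \<open>\<nu>\<close> with source
  \<open>(\<mu> - \<nu>) * u \<mu>\<close>, so \<open>energy_estimate\<close> applies with
  \<open>r\<close> proportional to \<open>\<bar>\<nu> - \<mu>\<bar>\<close>. Distance at most 1
  makes \<open>L\<close> a bound for the potential uniformly in \<open>\<nu>\<close>.\<close>

lemma shooting_lipschitz:
  assumes u: "\<And>\<nu>. solves_ode (\<lambda>x. c x - \<nu>) (u \<nu>) (u' \<nu>)" "\<And>\<nu>. u \<nu> a = \<alpha>" "\<And>\<nu>. u' \<nu> a = \<beta>"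
    and ab: "a \<le> b"
  shows "\<exists>C\<ge>0. \<forall>\<nu>. \<forall>x\<in>{a..b}. \<bar>\<nu> - \<mu>\<bar> \<le> 1 \<longrightarrow>
     \<bar>u \<nu> x - u \<mu> x\<bar> \<le> C * \<bar>\<nu> - \<mu>\<bar> \<and> \<bar>u' \<nu> x - u' \<mu> x\<bar> \<le> C * \<bar>\<nu> - \<mu>\<bar>"
proof -
  have "bounded (u \<mu> ` {a..b})"
    by (rule compact_imp_bounded[OF compact_continuous_image[OF solves_odeD(3)[OF u(1)]]]) simp
  then obtain M where M': "\<forall>y \<in> u \<mu> ` {a..b}. norm y \<le> M" unfolding bounded_iff by blast
  have M: "\<bar>u \<mu> x\<bar> \<le> M" if "x \<in> {a..b}" for x using M' that by auto
  have M0: "M \<ge> 0" using M[of a] ab by force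
  define L where "L = K + \<bar>\<mu>\<bar> + 1"
  have L0: "L \<ge> 0" using K_nonneg by (simp add: L_def)
  define C where "C = sqrt (M\<^sup>2 * (b - a) * exp ((L + 2) * (b - a)))"
  have C0: "C \<ge> 0" unfolding C_def using ab by simp
  have C2: "C\<^sup>2 = M\<^sup>2 * (b - a) * exp ((L + 2) * (b - a))" unfolding C_def using ab by simp
  have main: "\<bar>u \<nu> x - u \<mu> x\<bar> \<le> C * \<bar>\<nu> - \<mu>\<bar> \<and> \<bar>u' \<nu> x - u' \<mu> x\<bar> \<le> C * \<bar>\<nu> - \<mu>\<bar>"
    if l: "\<bar>\<nu> - \<mu>\<bar> \<le> 1" and x: "x \<in> {a..b}" for \<nu> x
  proof -
    have "(u \<nu> x - u \<mu> x)\<^sup>2 + (u' \<nu> x - u' \<mu> x)\<^sup>2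
       \<le> ((u \<nu> a - u \<mu> a)\<^sup>2 + (u' \<nu> a - u' \<mu> a)\<^sup>2 + (\<bar>\<nu> - \<mu>\<bar> * M)\<^sup>2 * (x - a)) * exp ((L + 2) * (x - a))"
    proof (rule energy_estimate[where e = "\<lambda>x. (c x - \<nu>) * u \<nu> x - (c x - \<mu>) * u \<mu> x"])
      fix y assume y: "y \<in> {a..x}"
      have "(c y - \<nu>) * u \<nu> y - (c y - \<mu>) * u \<mu> y = (c y - \<nu>) * (u \<nu> y - u \<mu> y) + (\<mu> - \<nu>) * u \<mu> y"
        by (simp add: algebra_simps)
      then have "\<bar>(c y - \<nu>) * u \<nu> y - (c y - \<mu>) * u \<mu> y\<bar> \<le> \<bar>c y - \<nu>\<bar> * \<bar>u \<nu> y - u \<mu> y\<bar> + \<bar>\<nu> - \<mu>\<bar> * \<bar>u \<mu> y\<bar>"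
        using abs_triangle_ineq[of "(c y - \<nu>) * (u \<nu> y - u \<mu> y)" "(\<mu> - \<nu>) * u \<mu> y"]
        by (simp add: abs_mult abs_minus_commute[of \<nu> \<mu>])
      also have "\<dots> \<le> L * \<bar>u \<nu> y - u \<mu> y\<bar> + \<bar>\<nu> - \<mu>\<bar> * M"
        using M[of y] y x l bounded_c[of y] by (intro add_mono mult_right_mono mult_left_mono) (auto simp: L_def)
      finally show "\<bar>(c y - \<nu>) * u \<nu> y - (c y - \<mu>) * u \<mu> y\<bar> \<le> L * \<bar>u \<nu> y - u \<mu> y\<bar> + \<bar>\<nu> - \<mu>\<bar> * M" .
    qed (use x L0 in \<open>auto intro!: derivative_eq_intros solves_odeD[OF u(1)]\<close>)
    also have "\<dots> = (\<bar>\<nu> - \<mu>\<bar>\<^sup>2 * M\<^sup>2) * ((x - a) * exp ((L + 2) * (x - a)))"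
      by (simp add: u power_mult_distrib)
    also have "\<dots> \<le> (\<bar>\<nu> - \<mu>\<bar>\<^sup>2 * M\<^sup>2) * ((b - a) * exp ((L + 2) * (b - a)))"
      using x L0 by (intro mult_left_mono mult_mono) (auto intro!: mult_left_mono)
    also have "\<dots> = (C * \<bar>\<nu> - \<mu>\<bar>)\<^sup>2" by (simp add: power_mult_distrib C2)
    finally have s: "(u \<nu> x - u \<mu> x)\<^sup>2 + (u' \<nu> x - u' \<mu> x)\<^sup>2 \<le> (C * \<bar>\<nu> - \<mu>\<bar>)\<^sup>2" .
    have n: "C * \<bar>\<nu> - \<mu>\<bar> \<ge> 0" using C0 by simp
    show ?thesis
      using n by (intro conjI power2_le_imp_le[OF _ n, of "\<bar>_\<bar>"]) (use s in \<open>simp_all add: order_trans[OF _ s]\<close>)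
  qed
  show ?thesis using C0 main by (intro exI[of _ C]) simp
qed

lemma shooting_continuous:
  assumes u: "\<And>\<nu>. solves_ode (\<lambda>x. c x - \<nu>) (u \<nu>) (u' \<nu>)" "\<And>\<nu>. u \<nu> a = \<alpha>" "\<And>\<nu>. u' \<nu> a = \<beta>"
    and x: "a \<le> x"
  shows "isCont (\<lambda>\<nu>. u \<nu> x) \<mu>" "isCont (\<lambda>\<nu>. u' \<nu> x) \<mu>"
proof -
  obtain C where C0: "C \<ge> 0" and C': "\<forall>\<nu>. \<forall>y\<in>{a..x}. \<bar>\<nu> - \<mu>\<bar> \<le> 1 \<longrightarrow>
     \<bar>u \<nu> y - u \<mu> y\<bar> \<le> C * \<bar>\<nu> - \<mu>\<bar> \<and> \<bar>u' \<nu> y - u' \<mu> y\<bar> \<le> C * \<bar>\<nu> - \<mu>\<bar>"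
    using shooting_lipschitz[where u = u and u' = u' and a = a and b = x and \<mu> = \<mu>, OF u x] by (elim exE conjE)
  have C: "\<bar>u \<nu> x - u \<mu> x\<bar> \<le> C * \<bar>\<nu> - \<mu>\<bar>" "\<bar>u' \<nu> x - u' \<mu> x\<bar> \<le> C * \<bar>\<nu> - \<mu>\<bar>" if "\<bar>\<nu> - \<mu>\<bar> \<le> 1" for \<nu>
    using bspec[OF spec[OF C', of \<nu>], of x] x that by auto
  have lim: "((\<lambda>\<nu>. C * \<bar>\<nu> - \<mu>\<bar>) \<longlongrightarrow> 0) (at \<mu>)"
    by (auto intro!: tendsto_eq_intros)
  have "eventually (\<lambda>\<nu>. dist \<nu> \<mu> < 1) (at \<mu>)" by (auto simp: eventually_at intro!: exI[of _ 1])
  then have ev: "eventually (\<lambda>\<nu>. \<bar>\<nu> - \<mu>\<bar> \<le> 1) (at \<mu>)" by eventually_elim (simp add: dist_real_def)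
  have "((\<lambda>\<nu>. u \<nu> x - u \<mu> x) \<longlongrightarrow> 0) (at \<mu>)"
    by (rule Lim_null_comparison[OF eventually_mono[OF ev] lim]) (use C(1) in auto)
  then show "isCont (\<lambda>\<nu>. u \<nu> x) \<mu>" by (simp add: isCont_def LIM_zero_iff)
  have "((\<lambda>\<nu>. u' \<nu> x - u' \<mu> x) \<longlongrightarrow> 0) (at \<mu>)"
    by (rule Lim_null_comparison[OF eventually_mono[OF ev] lim]) (use C(2) in auto)
  then show "isCont (\<lambda>\<nu>. u' \<nu> x) \<mu>" by (simp add: isCont_def LIM_zero_iff)
qed

lemma shooting_positive_mono:
  assumes u: "\<And>\<nu>. solves_ode (\<lambda>x. c x - \<nu>) (u \<nu>) (u' \<nu>)" "\<And>\<nu>. u \<nu> a = \<alpha>" "\<And>\<nu>. u' \<nu> a = \<beta>"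
    and ab: "a < b" and start: "\<alpha> > 0 \<or> (\<alpha> = 0 \<and> \<beta> > 0)"
    and "\<mu> < \<nu>" "\<And>x. x \<in> {a<..<b} \<Longrightarrow> u \<nu> x > 0"
  shows "\<forall>x\<in>{a<..b}. u \<mu> x > 0"
proof (rule sturm_comparison(1)[OF u(1)[of \<mu>] u(1)[of \<nu>] ab])
  show "u' \<mu> a * u \<nu> a - u \<mu> a * u' \<nu> a \<ge> 0" "u \<mu> a > 0 \<or> (u \<mu> a = 0 \<and> u' \<mu> a > 0)"
    unfolding u(2,3) using start by simp_all
qed (use assms(6,7) in simp_all)

lemma shooting_below:
  assumes u: "solves_ode (\<lambda>x. c x - \<nu>) u u'" and start: "u a > 0 \<and> u' a \<ge> 0 \<or> (u a = 0 \<and> u' a > 0)"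
    and "a < b" "\<nu> < - K"
  shows "\<forall>x\<in>{a<..b}. u x > 0" "u' b > 0"
proof -
  have Q: "0 < c x - \<nu>" for x using bounded_c[of x] assms(4) by linarith
  show "\<forall>x\<in>{a<..b}. u x > 0"
    by (rule sturm_comparison(1)[OF u solves_ode_const \<open>a < b\<close>]) (use Q start in auto)
  have "u' b * 1 - u b * 0 > 0"
    by (rule sturm_comparison(2)[OF u solves_ode_const \<open>a < b\<close>]) (use Q start in auto)
  then show "u' b > 0" by simp
qed

text \<open>The value is the supremum \<open>l\<close> of the parameters whose solution is positive
  on (a,b]. By continuity the solution at \<open>l\<close> is nonnegative; an interior zero would be
  a double zero; and positivity up to \<open>b\<close> would persist slightly above
  \<open>l\<close>. So it vanishes at \<open>b\<close> first. The bound by \<open>- K - 1\<close> is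
  the left end for later intermediate value arguments.\<close>

lemma dirichlet_shooting:
  assumes u: "\<And>\<nu>. solves_ode (\<lambda>x. c x - \<nu>) (u \<nu>) (u' \<nu>)" "\<And>\<nu>. u \<nu> a = \<alpha>" "\<And>\<nu>. u' \<nu> a = \<beta>"
    and ab: "a < b" and start: "\<alpha> > 0 \<and> \<beta> \<ge> 0 \<or> (\<alpha> = 0 \<and> \<beta> > 0)"
  shows "\<exists>\<nu>. u \<nu> b = 0 \<and> u' \<nu> b < 0 \<and> (\<forall>x\<in>{a<..<b}. u \<nu> x > 0) \<and>
    (\<forall>\<mu><\<nu>. \<forall>x\<in>{a<..b}. u \<mu> x > 0) \<and> - K - 1 < \<nu>"
proof -
  define E where "E = {\<nu>. \<forall>x\<in>{a<..b}. u \<nu> x > 0}"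
  have start': "\<alpha> > 0 \<or> (\<alpha> = 0 \<and> \<beta> > 0)" using start by auto
  have low: "\<nu> \<in> E" if "\<nu> < - K" for \<nu>
    using shooting_below(1)[OF u(1) _ ab that] start unfolding E_def by (auto simp: u(2,3))
  \<comment> \<open>With this \<open>k\<close> the sine vanishes at \<open>b\<close>; comparison
    with a parameter in \<open>E\<close> above \<open>K + k\<^sup>2\<close> would make it positive
    there.\<close>
  define k where "k = pi / (b - a)"
  have k: "k > 0" using ab by (simp add: k_def)
  have up: "\<nu> \<le> K + k\<^sup>2" if "\<nu> \<in> E" for \<nu>
  proof (rule ccontr)
    assume n: "\<not> \<nu> \<le> K + k\<^sup>2"
    have "\<forall>x\<in>{a<..b}. sin (k * (x - a)) > 0"
    proof (rule sturm_comparison(1)[OF solves_ode_sin u(1)[of \<nu>] ab])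
      fix x show "c x - \<nu> < - k\<^sup>2" using n bounded_c[of x] by linarith
    qed (use k that start in \<open>auto simp: E_def u\<close>)
    then have "sin (k * (b - a)) > 0" using ab by auto
    then show False using ab by (simp add: k_def)
  qed
  have ne: "E \<noteq> {}" using low[of "- K - 1"] by auto
  have bdd: "bdd_above E" using up by (auto simp: bdd_above_def)
  define l where "l = Sup E"
  have Kl: "- K - 1 < l"
    using cSup_upper[OF low[of "- K - 1/2"] bdd] by (simp add: l_def)
  have below: "u \<mu> x > 0" if \<mu>: "\<mu> < l" and "x \<in> {a<..b}" for \<mu> x
  proof -
    obtain \<nu> where "\<nu> \<in> E" "\<mu> < \<nu>" using less_cSupD[OF ne, of \<mu>] \<mu> unfolding l_def by blast
    then show ?thesis
      using shooting_positive_mono[where u = u and u' = u' and a = a and b = b and \<mu> = \<mu> and \<nu> = \<nu>, OF u ab start'] that(2)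
      by (simp add: E_def)
  qed
  have nonneg: "u l x \<ge> 0" if "x \<in> {a<..b}" for x
    by (rule nonneg_at_right_end[where f = "\<lambda>\<nu>. u \<nu> x" and b = l and p = "l - 1"])
       (use shooting_continuous(1)[where u = u and u' = u' and a = a and x = x, OF u] below that in \<open>auto intro: less_imp_le\<close>)
  have dz: "\<not> (u l x = 0 \<and> u' l x = 0)" for x
    using solves_ode_zero[OF u(1)[of l] _ _ bounded_c_minus, of x a] start by (auto simp: u)
  have inner: "u l x > 0" if x: "x \<in> {a<..<b}" for x
  proof (rule ccontr)
    assume "\<not> u l x > 0"
    then have z: "u l x = 0" using nonneg[of x] x by auto
    have "u' l x \<le> 0"
      by (rule deriv_nonpos_at_right_zero[OF solves_odeD(1)[OF u(1)], of a]) (use z nonneg x in auto)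
    \<comment> \<open>Reflection gives the opposite sign of the slope, so an interior zero is a
      double zero.\<close>
    moreover have "- u' l (- (- x)) \<le> 0"
    proof (rule deriv_nonpos_at_right_zero[of "\<lambda>y. u l (- y)" _ "- x" "- b"])
      show "((\<lambda>y. u l (- y)) has_real_derivative - u' l (- (- x))) (at (- x))"
        using solves_odeD(1)[OF solves_ode_reflect[OF u(1)[of l], of 0], of "- x"] by simp
    qed (use z nonneg x in auto)
    ultimately show False using dz z by auto
  qed
  have "u l b = 0"
  proof (rule ccontr)
    assume "u l b \<noteq> 0"
    then have lE: "u l x > 0" if "x \<in> {a<..b}" for x
      using inner nonneg that by (cases "x = b") (auto simp: order_less_le)
    obtain C where C0: "C \<ge> 0" and C': "\<forall>\<nu>. \<forall>y\<in>{a..b}. \<bar>\<nu> - l\<bar> \<le> 1 \<longrightarrow>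
       \<bar>u \<nu> y - u l y\<bar> \<le> C * \<bar>\<nu> - l\<bar> \<and> \<bar>u' \<nu> y - u' l y\<bar> \<le> C * \<bar>\<nu> - l\<bar>"
      using shooting_lipschitz[where u = u and u' = u' and a = a and b = b and \<mu> = l, OF u less_imp_le[OF ab]]
      by (elim exE conjE)
    have C: "C \<ge> 0" "\<bar>u \<nu> y - u l y\<bar> \<le> C * \<bar>\<nu> - l\<bar> \<and> \<bar>u' \<nu> y - u' l y\<bar> \<le> C * \<bar>\<nu> - l\<bar>"
      if "\<bar>\<nu> - l\<bar> \<le> 1" "y \<in> {a..b}" for \<nu> y
      using C0 bspec[OF spec[OF C', of \<nu>], of y] that by auto
    \<comment> \<open>Uniform closeness does not preserve positivity near \<open>a\<close> when the
      solution vanishes at \<open>a\<close>; in that case a lower bound for the derivative is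
      carried over instead.\<close>
    obtain e \<eta> where e: "a < e" "e \<le> b" "\<eta> > 0"
      and e': "(\<forall>x\<in>{a..e}. u l x > \<eta>) \<or> \<alpha> = 0 \<and> (\<forall>x\<in>{a..e}. u' l x > \<eta>)"
    proof -
      have ex: "\<exists>e. a < e \<and> e \<le> b \<and> (\<forall>x\<in>{a..e}. f x > f a / 2)" if "isCont f a" "f a > 0" for f :: "real \<Rightarrow> real"
      proof -
        have "\<forall>\<^sub>F x in at a. f x > f a / 2"
          using that by (intro order_tendstoD) (auto simp: isCont_def)
        then obtain d where d: "d > 0" "\<forall>x. x \<noteq> a \<and> dist x a < d \<longrightarrow> f x > f a / 2" by (auto simp: eventually_at)
        have "f x > f a / 2" if "x \<in> {a..min b (a + d / 2)}" for x
          using d that \<open>f a > 0\<close> by (cases "x = a") (auto simp: dist_real_def)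
        then show ?thesis using d(1) ab by (intro exI[of _ "min b (a + d / 2)"]) auto
      qed
      show thesis
      proof (cases "\<alpha> > 0")
        case True
        then show thesis using ex[OF solves_odeD(5)[OF u(1)[of l]]] that[of _ "\<alpha> / 2"] by (auto simp: u)
      next
        case False
        then have "\<alpha> = 0" "\<beta> > 0" using start by auto
        then show thesis using ex[OF solves_odeD(6)[OF u(1)[of l]]] that[of _ "\<beta> / 2"] by (auto simp: u)
      qed
    qed
    have "\<exists>y0\<in>{e..b}. \<forall>y\<in>{e..b}. u l y0 \<le> u l y"
      by (rule continuous_attains_inf[OF compact_Icc _ solves_odeD(3)[OF u(1)]]) (use e in simp)
    then obtain y0 where y0: "y0 \<in> {e..b}" "\<And>y. y \<in> {e..b} \<Longrightarrow> u l y0 \<le> u l y" by blast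
    define \<epsilon> where "\<epsilon> = min \<eta> (u l y0)"
    have "u l y0 > 0" using e(1) y0(1) by (intro lE) simp
    then have eps: "\<epsilon> > 0" using e(3) by (simp add: \<epsilon>_def)
    \<comment> \<open>The perturbation \<open>C * \<bar>\<nu> - l\<bar>\<close> stays below both
      lower bounds collected in \<open>\<epsilon>\<close>; \<open>C + 1\<close> guards against
      \<open>C = 0\<close>.\<close>
    define \<nu> where "\<nu> = l + min 1 (\<epsilon> / (2 * (C + 1)))"
    have "\<epsilon> / (2 * (C + 1)) > 0" using eps C0 by simp
    then have l1: "\<bar>\<nu> - l\<bar> \<le> 1" "\<nu> > l" unfolding \<nu>_def by linarith+
    have "C * \<bar>\<nu> - l\<bar> \<le> C * (\<epsilon> / (2 * (C + 1)))"
      using C0 l1(2) by (intro mult_left_mono) (auto simp: \<nu>_def)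
    also have "\<dots> < \<epsilon>" using C0 eps by (simp add: field_simps add_nonneg_pos)
    finally have Ce: "C * \<bar>\<nu> - l\<bar> < \<epsilon>" .
    have far: "u \<nu> x > 0" if "x \<in> {e..b}" for x
    proof -
      have "\<bar>u \<nu> x - u l x\<bar> < u l y0" using C(2)[OF l1(1), of x] Ce that e by (simp add: \<epsilon>_def)
      then show ?thesis using y0(2)[OF that] by linarith
    qed
    have near: "u \<nu> x > 0" if x: "x \<in> {a<..e}" for x
      using e'
    proof
      assume "\<forall>x\<in>{a..e}. u l x > \<eta>"
      then have "u l x > \<eta>" using x by auto
      moreover have "\<bar>u \<nu> x - u l x\<bar> < \<eta>" using C(2)[OF l1(1), of x] Ce x e by (simp add: \<epsilon>_def)
      ultimately show ?thesis by linarith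
    next
      assume s: "\<alpha> = 0 \<and> (\<forall>x\<in>{a..e}. u' l x > \<eta>)"
      have pos': "u' \<nu> y > 0" if "y \<in> {a..x}" for y
      proof -
        have "u' l y > \<eta>" using s that x by auto
        moreover have "\<bar>u' \<nu> y - u' l y\<bar> < \<eta>" using C(2)[OF l1(1), of y] Ce x e that by (simp add: \<epsilon>_def)
        ultimately show ?thesis by linarith
      qed
      have "u \<nu> a < u \<nu> x"
      proof (rule DERIV_pos_imp_increasing[where f = "u \<nu>"])
        fix y assume "a \<le> y" "y \<le> x"
        then show "\<exists>d. (u \<nu> has_real_derivative d) (at y) \<and> 0 < d"
          using pos' solves_odeD(1)[OF u(1)[of \<nu>], of y] by (intro exI[of _ "u' \<nu> y"]) simp
      qed (use x in simp)
      then show ?thesis using s by (simp add: u)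
    qed
    have "\<nu> \<in> E" unfolding E_def
    proof (intro CollectI ballI)
      fix x assume "x \<in> {a<..b}"
      then show "u \<nu> x > 0" using far[of x] near[of x] by (cases "x \<le> e") auto
    qed
    then have "\<nu> \<le> l" unfolding l_def using bdd by (rule cSup_upper)
    then show False using l1 by simp
  qed
  moreover have "u' l b \<le> 0"
    by (rule deriv_nonpos_at_right_zero[OF solves_odeD(1)[OF u(1)] ab]) (use \<open>u l b = 0\<close> inner in \<open>auto intro: less_imp_le\<close>)
  then have "u' l b < 0" using dz[of b] \<open>u l b = 0\<close> by (simp add: order_less_le)
  ultimately show ?thesis using inner below Kl by (intro exI[of _ l]) simp
qed

text \<open>Positivity is asked inside only, since either end may be a zero. As a global solution it
  restricts to the functions that occur in \<open>principal_eigenvalue\<close>.\<close>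

definition eigenfunction :: "boundary_condition \<Rightarrow> boundary_condition \<Rightarrow> real \<Rightarrow> real \<Rightarrow> real \<Rightarrow> (real \<Rightarrow> real) \<Rightarrow> (real \<Rightarrow> real) \<Rightarrow> bool" where
  "eigenfunction i j a b \<nu> u u' \<longleftrightarrow> solves_ode (\<lambda>x. c x - \<nu>) u u' \<and> satisfies_bc i a u u' \<and> satisfies_bc j b u u' \<and>
     (\<forall>x\<in>{a<..<b}. u x > 0)"

text \<open>The Cauchy data at \<open>a\<close> encode the left condition. A Dirichlet condition at
  \<open>b\<close> is met at the shooting value \<open>l\<close>. For a Neumann condition the slope
  at \<open>b\<close> is positive at \<open>- K - 1\<close> and negative at \<open>l\<close>, so it
  vanishes for some parameter in between.\<close>

lemma eigenfunction_exists:
  assumes ab: "a < b"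
  shows "\<exists>\<nu> u u'. eigenfunction i j a b \<nu> u u'"
proof -
  define \<alpha> \<beta> :: real where "\<alpha> = (if i = Neumann then 1 else 0)" and "\<beta> = (if i = Neumann then 0 else 1)"
  have start: "\<alpha> > 0 \<and> \<beta> \<ge> 0 \<or> (\<alpha> = 0 \<and> \<beta> > 0)" by (simp add: \<alpha>_def \<beta>_def)
  obtain u u' where u: "\<And>\<nu>. solves_ode (\<lambda>x. c x - \<nu>) (u \<nu>) (u' \<nu>)" "\<And>\<nu>. u \<nu> a = \<alpha>" "\<And>\<nu>. u' \<nu> a = \<beta>"
  proof -
    have "\<forall>\<nu>. \<exists>f. solves_ode (\<lambda>x. c x - \<nu>) (fst f) (snd f) \<and> fst f a = \<alpha> \<and> snd f a = \<beta>"
      using ivp_exists[of _ a \<alpha> \<beta>] by simp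
    then obtain f where "\<forall>\<nu>. solves_ode (\<lambda>x. c x - \<nu>) (fst (f \<nu>)) (snd (f \<nu>)) \<and> fst (f \<nu>) a = \<alpha> \<and> snd (f \<nu>) a = \<beta>"
      unfolding choice_iff by (elim exE)
    then show thesis by (intro that[of "\<lambda>\<nu>. fst (f \<nu>)" "\<lambda>\<nu>. snd (f \<nu>)"]) auto
  qed
  have bc: "satisfies_bc i a (u \<nu>) (u' \<nu>)" for \<nu> by (cases i) (auto simp: u \<alpha>_def \<beta>_def)
  obtain l where l: "u l b = 0" "u' l b < 0" "\<forall>x\<in>{a<..<b}. u l x > 0"
    "\<forall>\<mu><l. \<forall>x\<in>{a<..b}. u \<mu> x > 0" "- K - 1 < l"
    using dirichlet_shooting[where u = u and u' = u' and a = a and b = b, OF u ab start] by (elim exE conjE)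
  show ?thesis
  proof (cases j)
    case Dirichlet
    then show ?thesis
      using u(1)[of l] bc[of l] l(1,3) unfolding eigenfunction_def
      by (intro exI[of _ l] exI[of _ "u l"] exI[of _ "u' l"]) simp
  next
    case Neumann
    have low: "u' (- K - 1) b > 0"
      using shooting_below(2)[OF u(1) _ ab, of "- K - 1"] start by (auto simp: u)
    have "\<exists>x\<ge>- K - 1. x \<le> l \<and> u' x b = 0"
    proof (rule IVT2)
      show "\<forall>x. - K - 1 \<le> x \<and> x \<le> l \<longrightarrow> isCont (\<lambda>x. u' x b) x"
        by (intro allI impI shooting_continuous(2)[where u = u and u' = u', OF u less_imp_le[OF ab]])
    qed (use low l in auto)
    then obtain \<mu> where mu: "\<mu> \<le> l" "u' \<mu> b = 0" by blast
    \<comment> \<open>Strictness matters: below \<open>l\<close> the solution is positive up to and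
      including \<open>b\<close>.\<close>
    then have "\<mu> < l" using l(2) by (cases "\<mu> = l") auto
    then have "eigenfunction i j a b \<mu> (u \<mu>) (u' \<mu>)"
      using u(1)[of \<mu>] bc[of \<mu>] l(4) mu Neumann unfolding eigenfunction_def by simp
    then show ?thesis by blast
  qed
qed

end

lemma deriv_nonneg_at_left_zero:
  fixes v :: "real \<Rightarrow> real"
  assumes "(v has_real_derivative v') (at y)" "y < p" "\<And>x. x \<in> {y<..<p} \<Longrightarrow> v x \<ge> v y"
  shows "v' \<ge> 0"
proof (rule ccontr)
  assume "\<not> v' \<ge> 0"
  then obtain d where d: "d > 0" "\<And>h. 0 < h \<Longrightarrow> h < d \<Longrightarrow> v (y + h) < v y"
    using DERIV_neg_dec_right[OF assms(1)] by auto
  define h where "h = min d (p - y) / 2"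
  have "0 < h" "h < d" "h < p - y" using d(1) assms(2) by (auto simp: h_def min_def)
  then show False using d(2)[of h] assms(3)[of "y + h"] by auto
qed

lemma nonneg_at_left_end:
  fixes f :: "real \<Rightarrow> real"
  assumes "isCont f a" "a < p" "\<And>x. x \<in> {a<..<p} \<Longrightarrow> f x \<ge> 0"
  shows "f a \<ge> 0"
proof -
  have "(f \<longlongrightarrow> f a) (at_right a)" using assms(1) by (simp add: isCont_def filterlim_at_split)
  moreover have "eventually (\<lambda>x. f x \<ge> 0) (at_right a)"
    using eventually_at_right_real[OF assms(2)] by eventually_elim (use assms(3) in auto)
  ultimately show ?thesis by (intro tendsto_lowerbound) auto
qed

text \<open>Comparison with \<open>cos ((x - a) / (b - a))\<close>, which is positive on \<open>[a, b]\<close>.\<close>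

lemma positive_of_short_interval:
  assumes u: "solves_ode Q u u'" and ab: "a < b" and Q: "\<And>x. - (1 / (b - a))\<^sup>2 < Q x"
    and start: "u a > 0 \<and> u' a = 0 \<or> u a = 0 \<and> u' a > 0"
  shows "u b > 0"
proof -
  define k where "k = 1 / (b - a)"
  have "\<forall>x\<in>{a<..b}. u x > 0"
  proof (rule sturm_comparison(1)[OF u solves_ode_cos[of k a] ab])
    fix x assume "x \<in> {a<..<b}"
    then have "k * (x - a) < 1" "k * (x - a) > 0" using ab by (auto simp: k_def)
    then show "cos (k * (x - a)) > 0" using pi_gt3 by (intro cos_gt_zero) auto
  qed (use Q start in \<open>auto simp: k_def\<close>)
  then show ?thesis using ab by simp
qed

context bounded_potential begin

text \<open>A nontrivial solution has no double zero, so the weak signs at the ends become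
  strict.\<close>

lemma eigenfunction_ends:
  assumes e: "eigenfunction i j a b \<nu> u u'" and ab: "a < b"
  shows "if i = Neumann then u a > 0 \<and> u' a = 0 else u a = 0 \<and> u' a > 0"
    "if j = Neumann then u b > 0 \<and> u' b = 0 else u b = 0 \<and> u' b < 0"
proof -
  have s: "solves_ode (\<lambda>x. c x - \<nu>) u u'" and i: "satisfies_bc i a u u'" and j: "satisfies_bc j b u u'"
    and pos: "\<And>x. x \<in> {a<..<b} \<Longrightarrow> u x > 0"
    using e by (auto simp: eigenfunction_def)
  have dz: "\<not> (u x = 0 \<and> u' x = 0)" for x
    using solves_ode_zero[OF s _ _ bounded_c_minus, of x "(a + b) / 2"] pos[of "(a + b) / 2"] ab by auto
  have ua: "u a \<ge> 0" by (rule nonneg_at_left_end[OF solves_odeD(5)[OF s] ab]) (use pos in \<open>auto intro: less_imp_le\<close>)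
  have ub: "u b \<ge> 0" by (rule nonneg_at_right_end[OF solves_odeD(5)[OF s] ab]) (use pos in \<open>auto intro: less_imp_le\<close>)
  have da: "u' a \<ge> 0" if "u a = 0"
    by (rule deriv_nonneg_at_left_zero[OF solves_odeD(1)[OF s] ab]) (use pos that in \<open>auto intro: less_imp_le\<close>)
  have db: "u' b \<le> 0" if "u b = 0"
    by (rule deriv_nonpos_at_right_zero[OF solves_odeD(1)[OF s] ab]) (use pos that in \<open>auto intro: less_imp_le\<close>)
  show "if i = Neumann then u a > 0 \<and> u' a = 0 else u a = 0 \<and> u' a > 0"
    using i dz[of a] ua da by (cases i) (auto simp: order_less_le)
  show "if j = Neumann then u b > 0 \<and> u' b = 0 else u b = 0 \<and> u' b < 0"
    using j dz[of b] ub db by (cases j) (auto simp: order_less_le)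
qed

text \<open>The solution at a smaller spectral parameter with the Cauchy data of the eigenfunction at the
  midpoint stays positive up to both end points.\<close>

lemma supersolution_exists:
  assumes e: "eigenfunction i j a b \<nu> \<psi> \<psi>'" and ab: "a < b" and "\<mu> < \<nu>"
  shows "\<exists>v v'. solves_ode (\<lambda>x. c x - \<mu>) v v' \<and> (\<forall>x\<in>{a..b}. v x > 0) \<and>
    (i = Neumann \<longrightarrow> v' a < 0) \<and> (j = Neumann \<longrightarrow> v' b > 0)"
proof -
  define p where "p = (a + b) / 2"
  have p: "a < p" "p < b" using ab by (auto simp: p_def)
  have s: "solves_ode (\<lambda>x. c x - \<nu>) \<psi> \<psi>'" and pos: "\<And>x. x \<in> {a<..<b} \<Longrightarrow> \<psi> x > 0"
    using e by (auto simp: eigenfunction_def)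
  obtain v v' where v: "solves_ode (\<lambda>x. c x - \<mu>) v v'" "v p = \<psi> p" "v' p = \<psi>' p"
    using ivp_exists by blast
  have vp: "v p > 0" using pos[of p] p v by simp
  have R: "\<forall>x\<in>{p<..b}. v x > 0" "v' b * \<psi> b - v b * \<psi>' b > 0"
    by (rule sturm_comparison[OF v(1) s p(2)]; use pos p v vp assms(3) in simp)+
  have L: "\<forall>x\<in>{- p<..- a}. v (0 - x) > 0"
      "- v' (0 - (- a)) * \<psi> (0 - (- a)) - v (0 - (- a)) * (- \<psi>' (0 - (- a))) > 0"
    by (rule sturm_comparison[where p = "- p" and b = "- a", OF solves_ode_reflect[OF v(1), of 0] solves_ode_reflect[OF s, of 0]]; use pos p v vp assms(3) in simp)+
  have "v x > 0" if "x \<in> {a..b}" for x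
    using R(1) L(1)[rule_format, of "- x"] vp that by (cases x p rule: linorder_cases) auto
  moreover have "v' a < 0" if "i = Neumann"
  proof -
    have "- v' a * \<psi> a > 0" "\<psi> a > 0" using L(2) eigenfunction_ends(1)[OF e ab] that by auto
    then show ?thesis by (simp add: mult_less_0_iff)
  qed
  moreover have "v' b > 0" if "j = Neumann"
  proof -
    have "v' b * \<psi> b > 0" "\<psi> b > 0" using R(2) eigenfunction_ends(2)[OF e ab] that by auto
    then show ?thesis by (simp add: zero_less_mult_iff)
  qed
  ultimately show ?thesis using v(1) by blast
qed

text \<open>For a smaller \<open>\<nu>\<close> the cosine comparison would make the function
  positive at a Dirichlet end. The bound grows as the interval shrinks, which is why minima over
  infinite families of segments are attained.\<close>

lemma dirichlet_eigenvalue_lower: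
  assumes e: "eigenfunction i j a b \<nu> u u'" and ab: "a < b" and D: "i = Dirichlet \<or> j = Dirichlet"
  shows "\<nu> \<ge> (1 / (b - a))\<^sup>2 - K"
proof (rule ccontr)
  assume "\<not> \<nu> \<ge> (1 / (b - a))\<^sup>2 - K"
  then have Q: "- (1 / (b - a))\<^sup>2 < c x - \<nu>" for x using bounded_c[of x] by linarith
  have s: "solves_ode (\<lambda>x. c x - \<nu>) u u'" using e by (auto simp: eigenfunction_def)
  have sa: "u a > 0 \<and> u' a = 0 \<or> u a = 0 \<and> u' a > 0"
    using eigenfunction_ends(1)[OF e ab] by (cases "i = Neumann") simp_all
  have sb: "u b > 0 \<and> u' b = 0 \<or> u b = 0 \<and> - u' b > 0"
    using eigenfunction_ends(2)[OF e ab] by (cases "j = Neumann") simp_all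
  show False
  proof (cases "j = Dirichlet")
    case True
    have "u b > 0" by (rule positive_of_short_interval[OF s ab Q sa])
    then show False using eigenfunction_ends(2)[OF e ab] True by simp
  next
    case False
    then have i: "i = Dirichlet" using D by simp
    have "u (0 - (- a)) > 0"
      by (rule positive_of_short_interval[OF solves_ode_reflect[OF s, of 0], of "- b" "- a"])
         (use sb Q ab in simp_all)
    then show False using eigenfunction_ends(1)[OF e ab] i by simp
  qed
qed

text \<open>The Wronskian of the two positive solutions vanishes at both ends by the common boundary
  conditions, but it is strictly increasing if \<open>\<nu> < \<mu>\<close>. The setting is
  \<open>C2_with\<close> because the competitors in the definite description are differentiable
  within [a,b] only.\<close>

lemma principal_eigenvalue_less:
  assumes ab: "a < b" and f: "C2_with {a..b} f f' f''" "satisfies_bc i a f f'" "satisfies_bc j b f f'"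
      "\<And>x. x \<in> {a<..<b} \<Longrightarrow> f x > 0" "\<And>x. x \<in> {a<..<b} \<Longrightarrow> - f'' x + c x * f x = \<nu> * f x"
    and g: "C2_with {a..b} g g' g''" "satisfies_bc i a g g'" "satisfies_bc j b g g'"
      "\<And>x. x \<in> {a<..<b} \<Longrightarrow> g x > 0" "\<And>x. x \<in> {a<..<b} \<Longrightarrow> - g'' x + c x * g x = \<mu> * g x"
  shows "\<not> \<nu> < \<mu>"
proof
  assume less: "\<nu> < \<mu>"
  define W where "W x = f' x * g x - f x * g' x" for x
  have dW: "(W has_real_derivative (f'' x * g x - f x * g'' x)) (at x within {a..b})" if "x \<in> {a..b}" for x
  proof -
    have d: "(f has_real_derivative f' x) (at x within {a..b})" "(f' has_real_derivative f'' x) (at x within {a..b})"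
       "(g has_real_derivative g' x) (at x within {a..b})" "(g' has_real_derivative g'' x) (at x within {a..b})"
      using f(1) g(1) that unfolding C2_with_def by blast+
    show ?thesis
      unfolding W_def using DERIV_diff[OF DERIV_mult[OF d(2,3)] DERIV_mult[OF d(1,4)]]
      by (rule DERIV_cong) (simp add: algebra_simps)
  qed
  have "W a < W b"
  proof (rule DERIV_pos_imp_increasing_open[OF ab])
    fix x assume x: "a < x" "x < b"
    have "f'' x * g x - f x * g'' x = (\<mu> - \<nu>) * (f x * g x)"
    proof -
      have "- f'' x + c x * f x = \<nu> * f x" "- g'' x + c x * g x = \<mu> * g x" using f(5)[of x] g(5)[of x] x by simp_all
      then have fg: "f'' x = c x * f x - \<nu> * f x" "g'' x = c x * g x - \<mu> * g x" by linarith+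
      show ?thesis unfolding fg by (simp add: algebra_simps)
    qed
    moreover have "\<dots> > 0" using less f(4)[of x] g(4)[of x] x by simp
    moreover have "(W has_real_derivative (f'' x * g x - f x * g'' x)) (at x)"
      using dW[of x] x by (simp add: at_within_Icc_at)
    ultimately show "\<exists>y. (W has_real_derivative y) (at x) \<and> 0 < y"
      by (intro exI[of _ "f'' x * g x - f x * g'' x"]) simp
  qed (rule DERIV_continuous_on[OF dW])
  moreover have "W a = 0" using f(2) g(2) by (cases i) (auto simp: W_def)
  moreover have "W b = 0" using f(3) g(3) by (cases j) (auto simp: W_def)
  ultimately show False by simp
qed

lemma eigenfunction_C2_with:
  assumes "solves_ode (\<lambda>x. c x - \<nu>) u u'"
  shows "C2_with S u u' (\<lambda>x. (c x - \<nu>) * u x)"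
proof -
  have "continuous_on S (\<lambda>x. (c x - \<nu>) * u x)"
    by (intro continuous_on_mult continuous_on_diff continuous_on_const solves_odeD(3)[OF assms]
        continuous_on_subset[OF continuous_c]) simp
  then show ?thesis
    unfolding C2_with_def by (simp add: has_field_derivative_at_within solves_odeD(1,2)[OF assms])
qed

lemma principal_eigenvalue_eq:
  assumes ab: "a < b" and e: "eigenfunction i j a b \<nu> u u'"
  shows "principal_eigenvalue c i j a b = \<nu>"
  unfolding principal_eigenvalue_def
proof (rule the_equality)
  have u: "C2_with {a..b} u u' (\<lambda>x. (c x - \<nu>) * u x)" "satisfies_bc i a u u'" "satisfies_bc j b u u'"
      "\<And>x. x \<in> {a<..<b} \<Longrightarrow> u x > 0"
      "\<And>x. x \<in> {a<..<b} \<Longrightarrow> - ((c x - \<nu>) * u x) + c x * u x = \<nu> * u x"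
    using e eigenfunction_C2_with[of \<nu> u u'] by (simp_all add: eigenfunction_def left_diff_distrib)
  then show "\<exists>\<phi> \<phi>' \<phi>''. C2_with {a..b} \<phi> \<phi>' \<phi>'' \<and>
        satisfies_bc i a \<phi> \<phi>' \<and> satisfies_bc j b \<phi> \<phi>' \<and>
        (\<forall>x\<in>{a<..<b}. \<phi> x > 0) \<and>
        (\<forall>x\<in>{a<..<b}. - \<phi>'' x + c x * \<phi> x = \<nu> * \<phi> x)"
    by (intro exI[of _ u] exI[of _ u'] exI[of _ "\<lambda>x. (c x - \<nu>) * u x"]) simp
  fix \<mu> assume "\<exists>\<phi> \<phi>' \<phi>''. C2_with {a..b} \<phi> \<phi>' \<phi>'' \<and>
        satisfies_bc i a \<phi> \<phi>' \<and> satisfies_bc j b \<phi> \<phi>' \<and>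
        (\<forall>x\<in>{a<..<b}. \<phi> x > 0) \<and>
        (\<forall>x\<in>{a<..<b}. - \<phi>'' x + c x * \<phi> x = \<mu> * \<phi> x)"
  then obtain g g' g'' where g: "C2_with {a..b} g g' g''" "satisfies_bc i a g g'" "satisfies_bc j b g g'"
      "\<And>x. x \<in> {a<..<b} \<Longrightarrow> g x > 0" "\<And>x. x \<in> {a<..<b} \<Longrightarrow> - g'' x + c x * g x = \<mu> * g x"
    by (elim exE conjE) (simp only: Ball_def)
  show "\<mu> = \<nu>"
    using principal_eigenvalue_less[OF ab u g] principal_eigenvalue_less[OF ab g u] by linarith
qed

lemma principal_eigenfunction_exists:
  assumes "a < b"
  shows "\<exists>u u'. eigenfunction i j a b (principal_eigenvalue c i j a b) u u'"
proof -
  obtain \<nu> u u' where e: "eigenfunction i j a b \<nu> u u'" using eigenfunction_exists[OF assms, of i j] by (elim exE)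
  show ?thesis using e unfolding principal_eigenvalue_eq[OF assms e] by (intro exI)
qed

end

subsection \<open>The periodic principal eigenvalue\<close>

lemma periodic_int:
  fixes f :: "real \<Rightarrow> 'a"
  assumes "\<And>x. f (x + 1) = f x"
  shows "f (x + of_int n) = f x"
proof (induction n rule: int_induct[where k = 0])
  case (step1 i)
  then show ?case using assms[of "x + of_int i"] by (simp add: add.assoc)
next
  case (step2 i)
  then show ?case using assms[of "x + of_int (i - 1)"] by simp
qed simp

lemma periodic_frac:
  fixes f :: "real \<Rightarrow> 'a"
  assumes "\<And>x. f (x + 1) = f x"
  shows "f x = f (frac x)"
  using periodic_int[of f "frac x" "\<lfloor>x\<rfloor>", OF assms] by (simp add: frac_def)

lemma periodic_bounded:
  fixes f :: "real \<Rightarrow> real"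
  assumes f: "continuous_on UNIV f" and per: "\<And>x. f (x + 1) = f x"
  shows "\<exists>K. \<forall>x. \<bar>f x\<bar> \<le> K"
proof -
  have "bounded (f ` {0..1})"
    by (rule compact_imp_bounded[OF compact_continuous_image[OF continuous_on_subset[OF f]]]) auto
  then obtain K where K: "\<forall>y \<in> f ` {0..1}. norm y \<le> K" unfolding bounded_iff by blast
  have "\<bar>f x\<bar> \<le> K" for x
  proof -
    have "frac x \<in> {0..1}" using frac_ge_0[of x] frac_lt_1[of x] by simp
    then show ?thesis using K periodic_frac[where f = f and x = x, OF per] by (metis image_eqI real_norm_def)
  qed
  then show ?thesis by blast
qed

lemma (in bounded_potential) wronskian_const:
  assumes u: "solves_ode (\<lambda>x. c x - \<nu>) u u'" and v: "solves_ode (\<lambda>x. c x - \<nu>) v v'"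
  shows "u' x * v x - u x * v' x = u' p * v p - u p * v' p"
proof -
  have "\<forall>x. ((\<lambda>x. u' x * v x - u x * v' x) has_real_derivative 0) (at x)"
  proof
    fix x show "((\<lambda>x. u' x * v x - u x * v' x) has_real_derivative 0) (at x)"
      by (rule derivative_eq_intros solves_odeD[OF u] solves_odeD[OF v] refl)+ (simp add: algebra_simps)
  qed
  from DERIV_isconst_all[OF this, of x p] show ?thesis .
qed

text \<open>Below the first Dirichlet eigenvalue of \<open>[0, 1]\<close> the solution with \<open>y 0 = y 1 = 1\<close> exists and
  is positive; its derivatives at \<open>0\<close> and \<open>1\<close> agree once the trace of the monodromy matrix is \<open>2\<close>.\<close>

lemma (in bounded_potential) periodic_solution_exists:
  assumes per: "\<And>x. c (x + 1) = c x"
  shows "\<exists>\<nu> y y'. solves_ode (\<lambda>x. c x - \<nu>) y y' \<and> (\<forall>x. y x > 0) \<and> (\<forall>x. y (x + 1) = y x)"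
proof -
  have ch: "\<exists>u u'. \<forall>\<nu>. solves_ode (\<lambda>x. c x - \<nu>) (u \<nu>) (u' \<nu>) \<and> u \<nu> 0 = \<alpha> \<and> u' \<nu> 0 = \<beta>" for \<alpha> \<beta>
  proof -
    have "\<forall>\<nu>. \<exists>f. solves_ode (\<lambda>x. c x - \<nu>) (fst f) (snd f) \<and> fst f 0 = \<alpha> \<and> snd f 0 = \<beta>"
      using ivp_exists[of _ 0 \<alpha> \<beta>] by simp
    then obtain f where "\<forall>\<nu>. solves_ode (\<lambda>x. c x - \<nu>) (fst (f \<nu>)) (snd (f \<nu>)) \<and> fst (f \<nu>) 0 = \<alpha> \<and> snd (f \<nu>) 0 = \<beta>"
      unfolding choice_iff by (elim exE)
    then show ?thesis by (intro exI[of _ "\<lambda>\<nu>. fst (f \<nu>)"] exI[of _ "\<lambda>\<nu>. snd (f \<nu>)"])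
  qed
  obtain t t' where t': "\<forall>\<nu>. solves_ode (\<lambda>x. c x - \<nu>) (t \<nu>) (t' \<nu>) \<and> t \<nu> 0 = 1 \<and> t' \<nu> 0 = 0"
    using ch[of 1 0] by (elim exE)
  obtain f f' where f': "\<forall>\<nu>. solves_ode (\<lambda>x. c x - \<nu>) (f \<nu>) (f' \<nu>) \<and> f \<nu> 0 = 0 \<and> f' \<nu> 0 = 1"
    using ch[of 0 1] by (elim exE)
  have t: "solves_ode (\<lambda>x. c x - \<nu>) (t \<nu>) (t' \<nu>)" "t \<nu> 0 = 1" "t' \<nu> 0 = 0" for \<nu> using t' by auto
  have f: "solves_ode (\<lambda>x. c x - \<nu>) (f \<nu>) (f' \<nu>)" "f \<nu> 0 = 0" "f' \<nu> 0 = 1" for \<nu> using f' by auto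
  have wr: "f' \<nu> 1 * t \<nu> 1 - f \<nu> 1 * t' \<nu> 1 = 1" for \<nu>
    using wronskian_const[OF f(1) t(1), of \<nu> 1 0] by (simp add: f(2,3) t(2,3))
  obtain d where d: "f d 1 = 0" "f' d 1 < 0" "\<forall>x\<in>{0<..<1}. f d x > 0"
    "\<forall>\<mu><d. \<forall>x\<in>{0<..1}. f \<mu> x > 0" "- K - 1 < d"
    using dirichlet_shooting[where u = f and u' = f' and a = 0 and b = 1, OF f] by auto
  define T where "T \<nu> = t \<nu> 1 + f' \<nu> 1" for \<nu>
  \<comment> \<open>At \<open>- K - 1\<close> both diagonal entries of the monodromy matrix are at
    least 1. At \<open>d\<close>, where \<open>f d 1 = 0\<close>, their product is 1 and one of them
    is negative, hence both are. So the trace passes through 2.\<close>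
  have "\<exists>\<nu>\<ge>- K - 1. \<nu> \<le> d \<and> T \<nu> = 2"
  proof (rule IVT2)
    show "\<forall>x. - K - 1 \<le> x \<and> x \<le> d \<longrightarrow> isCont T x"
      unfolding T_def using shooting_continuous(1)[where u = t and u' = t' and a = 0 and x = 1, OF t]
        shooting_continuous(2)[where u = f and u' = f' and a = 0 and x = 1, OF f]
      by (intro allI impI continuous_intros) simp_all
    have "f' d 1 * t d 1 = 1" using wr[of d] d(1) by simp
    then have "t d 1 < 0" using d(2) by (metis mult_nonpos_nonneg not_le zero_less_one order_less_imp_le)
    then show "T d \<le> 2" using d(2) by (simp add: T_def)
    define l where "l = - K - 1"
    have l: "l < - K" by (simp add: l_def)
    have tp: "\<forall>x\<in>{0<..r}. t l x > 0" "t' l r > 0" "\<forall>x\<in>{0<..r}. f l x > 0" if "r > 0" for r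
      using shooting_below[OF t(1) _ that l] shooting_below[OF f(1) _ that l] by (simp_all add: t f)
    have "t l 0 \<le> t l 1"
    proof (rule DERIV_nonneg_imp_nondecreasing[where f = "t l"])
      fix x :: real assume "0 \<le> x" "x \<le> 1"
      then show "\<exists>y. (t l has_real_derivative y) (at x) \<and> 0 \<le> y"
        using solves_odeD(1)[OF t(1)[of l], of x] tp(2)[of x] t(3)[of l] by (cases "x = 0") force+
    qed simp
    moreover have "f' l 0 \<le> f' l 1"
    proof (rule DERIV_nonneg_imp_nondecreasing[where f = "f' l"])
      fix x :: real assume x: "0 \<le> x" "x \<le> 1"
      have "f l x \<ge> 0" using tp(3)[of 1] x f(2)[of l] by (cases "x = 0") (auto intro: less_imp_le)
      moreover have "c x - l \<ge> 0" using bounded_c[of x] l by linarith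
      ultimately show "\<exists>y. (f' l has_real_derivative y) (at x) \<and> 0 \<le> y"
        using solves_odeD(2)[OF f(1)[of l], of x] by (intro exI[of _ "(c x - l) * f l x"]) simp
    qed simp
    ultimately show "2 \<le> T (- K - 1)" by (simp add: T_def t f l_def)
    show "- K - 1 \<le> d" using d(5) by simp
  qed
  then obtain \<nu> where nu: "\<nu> \<le> d" "T \<nu> = 2" by blast
  have "T d < 2"
  proof -
    have "f' d 1 * t d 1 = 1" using wr[of d] d(1) by simp
    then have "t d 1 < 0" using d(2) by (metis mult_nonpos_nonneg not_le zero_less_one order_less_imp_le)
    then show ?thesis using d(2) by (simp add: T_def)
  qed
  then have less: "\<nu> < d" using nu by (cases "\<nu> = d") auto
  have f1: "f \<nu> 1 > 0" using d(4) less by simp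
  \<comment> \<open>Chosen so that \<open>t + k * f\<close> returns to the value 1 at the point 1;
    trace 2 and determinant 1 then give the slope \<open>k\<close> there as well.\<close>
  define k where "k = (1 - t \<nu> 1) / f \<nu> 1"
  define y where "y x = t \<nu> x + k * f \<nu> x" for x
  define y' where "y' x = t' \<nu> x + k * f' \<nu> x" for x
  have y: "solves_ode (\<lambda>x. c x - \<nu>) y y'" unfolding y_def y'_def by (rule solves_ode_lincomb[OF t(1) f(1)])
  have y0: "y 0 = 1" "y 1 = 1" "y' 0 = k" using f1 by (auto simp: y_def y'_def t f k_def)
  have "y' 1 = k"
  proof -
    have P: "f' \<nu> 1 = 2 - t \<nu> 1" using nu by (simp add: T_def)
    have "t' \<nu> 1 * f \<nu> 1 = (2 - t \<nu> 1) * t \<nu> 1 - 1" using wr[of \<nu>] P by (simp add: algebra_simps)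
    moreover have "k * f \<nu> 1 = 1 - t \<nu> 1" using f1 by (simp add: k_def)
    ultimately have "y' 1 * f \<nu> 1 = (2 - t \<nu> 1) * t \<nu> 1 - 1 + (1 - t \<nu> 1) * (2 - t \<nu> 1)"
    proof -
      have "y' 1 * f \<nu> 1 = t' \<nu> 1 * f \<nu> 1 + k * f \<nu> 1 * (2 - t \<nu> 1)"
        unfolding y'_def P by (simp add: algebra_simps)
      then show ?thesis using \<open>t' \<nu> 1 * f \<nu> 1 = _\<close> \<open>k * f \<nu> 1 = _\<close> by simp
    qed
    also have "\<dots> = 1 - t \<nu> 1" by (simp add: algebra_simps)
    finally show ?thesis using f1 by (simp add: k_def field_simps)
  qed
  have e: "eigenfunction Dirichlet Dirichlet 0 1 d (f d) (f' d)"
    using f d(1,3) by (simp add: eigenfunction_def)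
  obtain v v' where v: "solves_ode (\<lambda>x. c x - \<nu>) v v'" "\<forall>x\<in>{0..1}. v x > 0"
    using supersolution_exists[OF e _ less] by auto
  \<comment> \<open>The Wronskian with the positive solution \<open>v\<close> of the same equation
    is constant, so \<open>y / v\<close> is monotone on [0,1]; being positive at both ends, it is
    positive in between.\<close>
  have y_pos: "y x > 0" if x: "x \<in> {0..1}" for x
  proof -
    define w where "w = y' 0 * v 0 - y 0 * v' 0"
    define q where "q x = y x / v x" for x
    have dq: "(q has_real_derivative w / (v x)\<^sup>2) (at x)" if "x \<in> {0..1}" for x
    proof -
      have "v x \<noteq> 0" using v(2) that by force
      moreover have "y' x * v x - y x * v' x = w" using wronskian_const[OF y v(1), of x 0] by (simp add: w_def)
      ultimately show ?thesis unfolding q_def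
        by (auto intro!: derivative_eq_intros solves_odeD[OF y] solves_odeD[OF v(1)] simp: power2_eq_square)
    qed
    have q01: "q 0 > 0" "q 1 > 0" using v(2) y0 by (auto simp: q_def)
    have "q x > 0"
    proof (cases "w \<ge> 0")
      case True
      have "q 0 \<le> q x"
      proof (rule DERIV_nonneg_imp_nondecreasing[where f = q])
        fix z assume "0 \<le> z" "z \<le> x"
        then show "\<exists>d. (q has_real_derivative d) (at z) \<and> 0 \<le> d"
          using x dq[of z] True by (intro exI[of _ "w / (v z)\<^sup>2"]) (auto simp: divide_nonpos_nonneg)
      qed (use x in simp)
      then show ?thesis using q01 by simp
    next
      case False
      have "q 1 \<le> q x"
      proof (rule DERIV_nonpos_imp_nonincreasing[where f = q])
        fix z assume "x \<le> z" "z \<le> 1"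
        then show "\<exists>d. (q has_real_derivative d) (at z) \<and> d \<le> 0"
          using x dq[of z] False by (intro exI[of _ "w / (v z)\<^sup>2"]) (auto simp: divide_nonpos_nonneg)
      qed (use x in simp)
      then show ?thesis using q01 by simp
    qed
    moreover have "v x > 0" using v(2) x by simp
    ultimately show ?thesis by (simp add: q_def zero_less_divide_iff)
  qed
  have "solves_ode (\<lambda>x. c x - \<nu>) (\<lambda>x. y (x + 1)) (\<lambda>x. y' (x + 1))"
    using solves_ode_shift[OF y, of 1] by (simp add: per)
  then have y_per: "y (x + 1) = y x" for x
    using solves_ode_unique[OF _ y _ _ bounded_c_minus, of "\<lambda>x. y (x + 1)" "\<lambda>x. y' (x + 1)" 0 x] y0 \<open>y' 1 = k\<close>
    by simp
  have "y x > 0" for x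
    using y_pos[of "frac x"] frac_ge_0[of x] frac_lt_1[of x] periodic_frac[where f = y and x = x, OF y_per] by simp
  then show ?thesis using y y_per by (intro exI[of _ \<nu>] exI[of _ y] exI[of _ y']) simp
qed

subsection \<open>Concentration of the principal eigenfunctions\<close>

text \<open>Strictness is required against \<open>t\<close> alone: plateaus of \<open>m\<close> may
  accumulate at \<open>t\<close>, so strict monotonicity would be too much to ask. The next three
  predicates are the variants under reflection of the axis and of \<open>m\<close>.\<close>

definition rises_right :: "(real \<Rightarrow> real) \<Rightarrow> real \<Rightarrow> bool" where
  "rises_right m t \<longleftrightarrow> (\<exists>d>0. mono_on {t..t + d} m \<and> (\<forall>y\<in>{t<..t + d}. m t < m y))"

definition falls_right :: "(real \<Rightarrow> real) \<Rightarrow> real \<Rightarrow> bool" where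
  "falls_right m t \<longleftrightarrow> (\<exists>d>0. antimono_on {t..t + d} m \<and> (\<forall>y\<in>{t<..t + d}. m y < m t))"

definition rises_left :: "(real \<Rightarrow> real) \<Rightarrow> real \<Rightarrow> bool" where
  "rises_left m t \<longleftrightarrow> (\<exists>d>0. mono_on {t - d..t} m \<and> (\<forall>y\<in>{t - d..<t}. m y < m t))"

definition falls_left :: "(real \<Rightarrow> real) \<Rightarrow> real \<Rightarrow> bool" where
  "falls_left m t \<longleftrightarrow> (\<exists>d>0. antimono_on {t - d..t} m \<and> (\<forall>y\<in>{t - d..<t}. m t < m y))"

lemma falls_left_reflect:
  assumes "falls_left m t"
  shows "rises_right (\<lambda>x. m (- x)) (- t)"
proof -
  obtain d where d: "d > 0" "antimono_on {t - d..t} m" "\<forall>y\<in>{t - d..<t}. m t < m y"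
    using assms unfolding falls_left_def by blast
  have "mono_on {- t..- t + d} (\<lambda>x. m (- x))"
    by (intro monotone_onI monotone_onD[OF d(2)]) auto
  then show ?thesis using d(1,3) unfolding rises_right_def by (intro exI[of _ d]) auto
qed

lemma falls_right_reflect:
  assumes "falls_right m t"
  shows "rises_left (\<lambda>x. m (- x)) (- t)"
proof -
  obtain d where d: "d > 0" "antimono_on {t..t + d} m" "\<forall>y\<in>{t<..t + d}. m y < m t"
    using assms unfolding falls_right_def by blast
  have "mono_on {- t - d..- t} (\<lambda>x. m (- x))"
    by (intro monotone_onI monotone_onD[OF d(2)]) auto
  then show ?thesis using d(1,3) unfolding rises_left_def by (intro exI[of _ d]) auto
qed

lemma rises_left_reflect:
  assumes "rises_left m t"
  shows "falls_right (\<lambda>x. m (- x)) (- t)"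
proof -
  obtain d where d: "d > 0" "mono_on {t - d..t} m" "\<forall>y\<in>{t - d..<t}. m y < m t"
    using assms unfolding rises_left_def by blast
  have "antimono_on {- t..- t + d} (\<lambda>x. m (- x))"
    by (intro monotone_onI monotone_onD[OF d(2)]) auto
  then show ?thesis using d(1,3) unfolding falls_right_def by (intro exI[of _ d]) auto
qed

lemma nonflat_right:
  fixes m m' :: "real \<Rightarrow> real"
  assumes m: "\<And>x. (m has_real_derivative m' x) (at x)" and "rises_right m b \<or> falls_right m b" "d > 0"
  shows "\<exists>x\<in>{b<..<b + d}. m' x \<noteq> 0"
proof -
  obtain e where e: "e > 0" "\<forall>y\<in>{b<..b + e}. m y \<noteq> m b"
    using assms(2) unfolding rises_right_def falls_right_def by fastforce
  define y where "y = b + min e (d / 2)"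
  have y: "b < y" "y \<le> b + e" "y < b + d" using e assms(3) by (auto simp: y_def)
  obtain z where z: "b < z" "z < y" "m y - m b = (y - b) * m' z"
    using MVT2[OF y(1), of m m'] m by blast
  have "m' z \<noteq> 0" using z(3) e(2) y by auto
  then show ?thesis using z y by force
qed

lemma nonflat_left:
  fixes m m' :: "real \<Rightarrow> real"
  assumes m: "\<And>x. (m has_real_derivative m' x) (at x)" and "rises_left m a \<or> falls_left m a" "d > 0"
  shows "\<exists>x\<in>{a - d<..<a}. m' x \<noteq> 0"
proof -
  obtain e where e: "e > 0" "\<forall>y\<in>{a - e..<a}. m y \<noteq> m a"
    using assms(2) unfolding rises_left_def falls_left_def by fastforce
  define y where "y = a - min e (d / 2)"
  have y: "y < a" "a - e \<le> y" "a - d < y" using e assms(3) by (auto simp: y_def)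
  obtain z where z: "y < z" "z < a" "m a - m y = (a - y) * m' z"
    using MVT2[OF y(1), of m m'] m by blast
  have "m' z \<noteq> 0" using z(3) e(2) y by auto
  then show ?thesis using z y by force
qed

text \<open>\<open>M s\<close>, \<open>E s\<close> and \<open>G s\<close> are antiderivatives of the densities of mass, gradient energy and potential
  energy of \<open>\<phi> s\<close> with respect to the weight \<open>e\<^sup>2\<^sup>s\<^sup>m\<close>.\<close>

locale drift_family = bounded_potential c K for c K +
  fixes m m' :: "real \<Rightarrow> real" and \<phi> \<phi>' M E G :: "real \<Rightarrow> real \<Rightarrow> real" and C :: real
  assumes DERIV_m: "(m has_real_derivative m' x) (at x)"
    and phi_pos: "\<phi> s x > 0"
    and DERIV_phi: "(\<phi> s has_real_derivative \<phi>' s x) (at x)"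
    and DERIV_M: "(M s has_real_derivative exp (2 * s * m x) * (\<phi> s x)\<^sup>2) (at x)"
    and DERIV_E: "(E s has_real_derivative exp (2 * s * m x) * (\<phi>' s x)\<^sup>2) (at x)"
    and DERIV_G: "(G s has_real_derivative c x * (exp (2 * s * m x) * (\<phi> s x)\<^sup>2)) (at x)"
    and M_period: "M s (x + 1) - M s x = 1"
    and E_period: "E s (x + 1) - E s x \<le> C"
begin

definition w :: "real \<Rightarrow> real \<Rightarrow> real" where "w s x = exp (s * m x) * \<phi> s x"

lemma w_pos: "w s x > 0" by (simp add: w_def phi_pos)

lemma w_square: "(w s x)\<^sup>2 = exp (2 * s * m x) * (\<phi> s x)\<^sup>2"
  by (simp add: w_def power_mult_distrib mult.assoc flip: exp_double)

lemma M_mono: "x \<le> y \<Longrightarrow> M s x \<le> M s y"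
  by (rule DERIV_nonneg_imp_nondecreasing[of _ _ "M s"]) (use DERIV_M in \<open>force\<close>)+

lemma E_mono: "x \<le> y \<Longrightarrow> E s x \<le> E s y"
  by (rule DERIV_nonneg_imp_nondecreasing[of _ _ "E s"]) (use DERIV_E in \<open>force\<close>)+

lemma C_nonneg: "C \<ge> 0" using E_mono[of 0 1 s] E_period[of s 0] by simp

lemma isCont_m: "isCont m x" using DERIV_m DERIV_isCont by blast

text \<open>\<open>M\<close>, \<open>E\<close> and \<open>G\<close> change sign so that they remain
  antiderivatives of the reflected densities. Through this instance, statements about left
  neighbourhoods follow from those about right neighbourhoods.\<close>

lemma reflect: "drift_family (\<lambda>x. c (- x)) K (\<lambda>x. m (- x)) (\<lambda>x. - m' (- x)) (\<lambda>s x. \<phi> s (- x)) (\<lambda>s x. - \<phi>' s (- x))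
  (\<lambda>s x. - M s (- x)) (\<lambda>s x. - E s (- x)) (\<lambda>s x. - G s (- x)) C"
proof
  have g: "(uminus has_real_derivative -1) (at x)" for x :: real by (auto intro!: derivative_eq_intros)
  show "continuous_on UNIV (\<lambda>x. c (- x))"
    by (rule continuous_on_compose2[OF continuous_c]) (auto intro!: continuous_intros)
  show "\<bar>c (- x)\<bar> \<le> K" for x by (rule bounded_c)
  show "\<phi> s (- x) > 0" for s x by (rule phi_pos)
  show "((\<lambda>x. m (- x)) has_real_derivative - m' (- x)) (at x)" for x
    using DERIV_chain2[OF DERIV_m g, of x] by simp
  show "((\<lambda>x. \<phi> s (- x)) has_real_derivative - \<phi>' s (- x)) (at x)" for s x
    using DERIV_chain2[OF DERIV_phi g, of s x] by simp
  show "((\<lambda>x. - M s (- x)) has_real_derivative exp (2 * s * m (- x)) * (\<phi> s (- x))\<^sup>2) (at x)" for s x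
    using DERIV_minus[OF DERIV_chain2[OF DERIV_M g, of s x]] by simp
  show "((\<lambda>x. - E s (- x)) has_real_derivative exp (2 * s * m (- x)) * (- \<phi>' s (- x))\<^sup>2) (at x)" for s x
    using DERIV_minus[OF DERIV_chain2[OF DERIV_E g, of s x]] by simp
  show "((\<lambda>x. - G s (- x)) has_real_derivative c (- x) * (exp (2 * s * m (- x)) * (\<phi> s (- x))\<^sup>2)) (at x)" for s x
    using DERIV_minus[OF DERIV_chain2[OF DERIV_G g, of s x]] by simp
  show "- M s (- (x + 1)) - - M s (- x) = 1" for s x
    using M_period[of s "- x - 1"] by simp
  show "- E s (- (x + 1)) - - E s (- x) \<le> C" for s x
    using E_period[of s "- x - 1"] by simp
qed

text \<open>The energy bound controls the oscillation of \<open>e\<^sup>s\<^sup>m\<^sup>(\<^sup>x\<^sup>) \<phi>\<close> as long as \<open>m\<close> increases, and the mass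
  bound produces a point of \<open>[y1, y2]\<close> where \<open>w\<close> is not large.\<close>

lemma escape_right:
  assumes s: "s \<ge> 0" and mono: "mono_on {x..y2} m" and y: "x \<le> y1" "y1 < y2" and h: "y2 - x \<le> h" "h \<le> 1"
  shows "w s x \<le> exp (- s * (m y1 - m x)) / sqrt (y2 - y1) + (C + 1) / 2 * sqrt h"
proof -
  have h0: "h > 0" using y h by simp
  obtain z where z: "y1 < z" "z < y2" "M s y2 - M s y1 = (y2 - y1) * (exp (2 * s * m z) * (\<phi> s z)\<^sup>2)"
    using MVT2[OF y(2), of "M s" "\<lambda>z. exp (2 * s * m z) * (\<phi> s z)\<^sup>2"] DERIV_M by blast
  have "M s y2 - M s y1 \<le> 1"
    using M_mono[of x y1 s] M_mono[of y2 "x + 1" s] M_period[of s x] y h by simp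
  then have "(w s z)\<^sup>2 \<le> 1 / (y2 - y1)"
    using z(3) y(2) by (simp add: w_square pos_le_divide_eq mult.commute)
  then have "sqrt ((w s z)\<^sup>2) \<le> sqrt (1 / (y2 - y1))" by (rule real_sqrt_le_mono)
  then have wz: "w s z \<le> 1 / sqrt (y2 - y1)" using w_pos[of s z] by (simp add: real_sqrt_divide)
  have xz: "x \<le> z" using y z by simp
  \<comment> \<open>Young's inequality with weight \<open>sqrt h\<close> takes the place of
    Cauchy-Schwarz: energy at most \<open>C\<close> and length at most \<open>h\<close> each
    contribute a multiple of \<open>sqrt h\<close>. Freezing the weight at \<open>x\<close> is
    harmless because \<open>m x \<le> m t\<close> on the way to \<open>z\<close>.\<close>
  have "exp (s * m x) * \<phi> s x - exp (s * m x) * \<phi> s z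
     \<le> (sqrt h * E s z + z / sqrt h) / 2 - (sqrt h * E s x + x / sqrt h) / 2"
  proof -
    have "(\<lambda>t. - (exp (s * m x) * \<phi> s t)) z - (\<lambda>t. - (exp (s * m x) * \<phi> s t)) x
      \<le> (\<lambda>t. (sqrt h * E s t + t / sqrt h) / 2) z - (\<lambda>t. (sqrt h * E s t + t / sqrt h) / 2) x"
    proof (rule deriv_le_imp_diff_le[OF xz])
      fix t assume t: "t \<in> {x..z}"
      show "((\<lambda>t. - (exp (s * m x) * \<phi> s t)) has_real_derivative - (exp (s * m x) * \<phi>' s t)) (at t)"
        by (auto intro!: derivative_eq_intros DERIV_phi)
      show "((\<lambda>t. (sqrt h * E s t + t / sqrt h) / 2) has_real_derivative
          (sqrt h * (exp (2 * s * m t) * (\<phi>' s t)\<^sup>2) + 1 / sqrt h) / 2) (at t)"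
        using h0 by (auto intro!: derivative_eq_intros DERIV_E simp: field_simps)
      have "m x \<le> m t" by (rule mono_onD[OF mono]) (use t z y in auto)
      then have "exp (s * m x) \<le> exp (s * m t)" using s by (simp add: mult_left_mono)
      then have "- (exp (s * m x) * \<phi>' s t) \<le> exp (s * m t) * \<bar>\<phi>' s t\<bar>"
      proof -
        assume le: "exp (s * m x) \<le> exp (s * m t)"
        have "- (exp (s * m x) * \<phi>' s t) \<le> exp (s * m x) * \<bar>\<phi>' s t\<bar>"
          by (metis abs_exp_cancel abs_ge_minus_self abs_mult)
        also have "\<dots> \<le> exp (s * m t) * \<bar>\<phi>' s t\<bar>" using le by (intro mult_right_mono) auto
        finally show ?thesis .
      qed
      also have "\<dots> \<le> (sqrt h * (exp (s * m t) * \<bar>\<phi>' s t\<bar>)\<^sup>2 + 1 / sqrt h) / 2"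
      proof -
        define k a where "k = sqrt h" and "a = exp (s * m t) * \<bar>\<phi>' s t\<bar>"
        have k: "k > 0" using h0 by (simp add: k_def)
        have "0 \<le> (k * a - 1)\<^sup>2 / k" using k by simp
        also have "\<dots> = k * a\<^sup>2 + 1 / k - 2 * a" using k by (simp add: power2_eq_square field_simps)
        finally show ?thesis by (simp add: k_def a_def)
      qed
      also have "(exp (s * m t) * \<bar>\<phi>' s t\<bar>)\<^sup>2 = exp (2 * s * m t) * (\<phi>' s t)\<^sup>2"
        by (simp add: power_mult_distrib mult.assoc flip: exp_double)
      finally show "- (exp (s * m x) * \<phi>' s t) \<le> (sqrt h * (exp (2 * s * m t) * (\<phi>' s t)\<^sup>2) + 1 / sqrt h) / 2" .
    qed
    then show ?thesis by simp
  qed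
  also have "\<dots> = (sqrt h * (E s z - E s x) + (z - x) / sqrt h) / 2" by (simp only: right_diff_distrib diff_divide_distrib add_divide_distrib)
  also have "\<dots> \<le> (sqrt h * C + h / sqrt h) / 2"
  proof -
    have "E s z - E s x \<le> C" using E_mono[of z "x + 1" s] E_period[of s x] z y h by simp
    then show ?thesis using h0 z h by (intro divide_right_mono add_mono mult_left_mono) auto
  qed
  also have "h / sqrt h = sqrt h" using h0 by (simp add: real_div_sqrt)
  finally have "w s x \<le> exp (s * m x) * \<phi> s z + (C + 1) / 2 * sqrt h" by (simp add: w_def algebra_simps add_divide_distrib)
  also have "exp (s * m x) * \<phi> s z = exp (- s * (m z - m x)) * w s z"
    by (simp add: w_def algebra_simps exp_diff)
  also have "\<dots> \<le> exp (- s * (m y1 - m x)) * (1 / sqrt (y2 - y1))"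
  proof (rule mult_mono)
    have "m y1 \<le> m z" by (rule mono_onD[OF mono]) (use z y in auto)
    then have "s * m y1 \<le> s * m z" using s by (rule mult_left_mono)
    then show "exp (- s * (m z - m x)) \<le> exp (- s * (m y1 - m x))" by (simp add: algebra_simps)
  qed (use wz w_pos[of s z] in \<open>auto intro: less_imp_le\<close>)
  finally show ?thesis by simp
qed

text \<open>In \<open>escape_right\<close> the last term is small by the choice of a short
  \<open>h\<close>, and the first decays in \<open>s\<close> because \<open>m y1 - m x\<close> stays
  above a positive constant for all \<open>x\<close> near \<open>T\<close>. Taking
  \<open>p < T\<close> gives a two-sided neighbourhood when \<open>m\<close> is also nondecreasing
  on the left.\<close>

lemma small_right:
  assumes d: "d > 0" and mono: "mono_on {p..T + d} m" and p: "p \<le> T" and up: "\<And>y. y \<in> {T<..T + d} \<Longrightarrow> m T < m y"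
    and \<eta>: "\<eta> > 0"
  shows "\<exists>\<delta>>0. eventually (\<lambda>s. \<forall>x\<in>{max p (T - \<delta>)..T + \<delta>}. w s x \<le> \<eta>) at_top"
proof -
  define r where "r = \<eta> / (C + 1)"
  have r: "r > 0" using \<eta> C_nonneg by (simp add: r_def)
  define h where "h = min 1 (r\<^sup>2)"
  have h: "h > 0" "h \<le> 1" using r by (auto simp: h_def)
  have "sqrt h \<le> r" using r by (simp add: h_def real_le_lsqrt)
  then have small: "(C + 1) / 2 * sqrt h \<le> \<eta> / 2"
    using C_nonneg by (simp add: r_def pos_le_divide_eq mult.commute)
  define e where "e = T + min d (h / 2)"
  have e: "T < e" "e \<le> T + d" "e \<le> T + h / 2" using d h by (auto simp: e_def)
  have me: "m T < m e" using up e by simp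
  \<comment> \<open>Of the rise from \<open>T\<close> to \<open>e\<close>, one third is lost to the
    oscillation near \<open>T\<close> and one third to that near \<open>e\<close>; the last third
    remains as the gap \<open>k\<close>.\<close>
  define k where "k = (m e - m T) / 3"
  have k: "k > 0" using me by (simp add: k_def)
  obtain \<delta>1 where d1: "\<delta>1 > 0" "\<And>y. \<bar>y - T\<bar> < \<delta>1 \<Longrightarrow> \<bar>m y - m T\<bar> < k"
    using isCont_m[of T] k unfolding continuous_at_eps_delta by (metis dist_real_def real_norm_def)
  obtain \<delta>2 where d2: "\<delta>2 > 0" "\<And>y. \<bar>y - e\<bar> < \<delta>2 \<Longrightarrow> \<bar>m y - m e\<bar> < k"
    using isCont_m[of e] k unfolding continuous_at_eps_delta by (metis dist_real_def real_norm_def)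
  define y1 where "y1 = max ((T + e) / 2) (e - \<delta>2 / 2)"
  have y1: "T < y1" "y1 < e" "(T + e) / 2 \<le> y1" using e d2(1) by (auto simp: y1_def less_max_iff_disj)
  have "\<bar>y1 - e\<bar> < \<delta>2" using y1(1,2) d2(1) e(1) unfolding y1_def by linarith
  then have my1: "m y1 > m e - k" using d2(2)[of y1] by linarith
  define \<delta> where "\<delta> = min (\<delta>1 / 2) (min ((e - T) / 2) (h / 2))"
  have del: "\<delta> > 0" "\<delta> < \<delta>1" "\<delta> \<le> (e - T) / 2" "\<delta> \<le> h / 2" using d1(1) e h by (auto simp: \<delta>_def min_def)
  have lim: "((\<lambda>s. exp (- s * k) / sqrt (e - y1)) \<longlongrightarrow> 0) at_top"
  proof -
    have "filterlim (\<lambda>s::real. - s * k) at_bot at_top"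
      using filterlim_tendsto_pos_mult_at_top[OF tendsto_const k filterlim_ident]
      by (simp add: filterlim_uminus_at_bot mult.commute)
    from filterlim_compose[OF exp_at_bot this] have "((\<lambda>s. exp (- s * k)) \<longlongrightarrow> 0) at_top" .
    then show ?thesis by (rule tendsto_divide_zero)
  qed
  have "eventually (\<lambda>s. exp (- s * k) / sqrt (e - y1) < \<eta> / 2) at_top"
    by (rule order_tendstoD(2)[OF lim]) (use \<eta> in simp)
  then have "eventually (\<lambda>s. \<forall>x\<in>{max p (T - \<delta>)..T + \<delta>}. w s x \<le> \<eta>) at_top"
    using eventually_ge_at_top[of 0]
  proof eventually_elim
    case (elim s)
    show ?case
    proof
      fix x assume x: "x \<in> {max p (T - \<delta>)..T + \<delta>}"
      have "\<bar>x - T\<bar> < \<delta>1" using x del by auto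
      then have mx: "m x < m T + k" using d1(2)[of x] by linarith
      have "w s x \<le> exp (- s * (m y1 - m x)) / sqrt (e - y1) + (C + 1) / 2 * sqrt h"
      proof (rule escape_right)
        show "mono_on {x..e} m" by (rule monotone_on_subset[OF mono]) (use x e in auto)
        show "x \<le> y1" using x del y1 by auto
        show "e - x \<le> h" using x del e by auto
      qed (use elim y1 h in auto)
      also have "exp (- s * (m y1 - m x)) / sqrt (e - y1) \<le> exp (- s * k) / sqrt (e - y1)"
      proof (rule divide_right_mono)
        have "s * k \<le> s * (m y1 - m x)" proof (rule mult_left_mono)
          have "m e - m T = 3 * k" by (simp add: k_def)
          then show "k \<le> m y1 - m x" using my1 mx by linarith
        qed (use elim in simp)
        then show "exp (- s * (m y1 - m x)) \<le> exp (- s * k)" by simp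
      qed (use y1 in simp)
      finally show "w s x \<le> \<eta>" using elim small by linarith
    qed
  qed
  then show ?thesis using del(1) by blast
qed

end

section \<open>Local lower bounds for the energy\<close>

context drift_family begin

text \<open>Antiderivative of the energy density shifted by \<open>\<mu>\<close>. For the
  eigenfamily its increment over [0,1] is \<open>lam s - \<mu>\<close> (see
  \<open>F_period\<close>), so lower bounds for increments bound the eigenvalue.\<close>

definition F :: "real \<Rightarrow> real \<Rightarrow> real \<Rightarrow> real" where "F \<mu> s x = E s x + G s x - \<mu> * M s x"

lemma DERIV_F: "(F \<mu> s has_real_derivative exp (2 * s * m x) * ((\<phi>' s x)\<^sup>2 + (c x - \<mu>) * (\<phi> s x)\<^sup>2)) (at x)"
  unfolding F_def by (rule derivative_eq_intros DERIV_E DERIV_G DERIV_M refl)+ (simp add: algebra_simps)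

lemma F_lower:
  assumes "u \<le> v" and w: "\<And>x. x \<in> {u..v} \<Longrightarrow> w s x \<le> \<eta>"
  shows "F \<mu> s v - F \<mu> s u \<ge> - ((K + \<bar>\<mu>\<bar>) * \<eta>\<^sup>2 * (v - u))"
proof -
  have "(- ((K + \<bar>\<mu>\<bar>) * \<eta>\<^sup>2)) * v - (- ((K + \<bar>\<mu>\<bar>) * \<eta>\<^sup>2)) * u \<le> F \<mu> s v - F \<mu> s u"
  proof (rule deriv_le_imp_diff_le[OF assms(1) _ DERIV_F])
    fix x assume x: "x \<in> {u..v}"
    show "((\<lambda>x. (- ((K + \<bar>\<mu>\<bar>) * \<eta>\<^sup>2)) * x) has_real_derivative (- ((K + \<bar>\<mu>\<bar>) * \<eta>\<^sup>2))) (at x)"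
      by (auto intro!: derivative_eq_intros)
    have "(w s x)\<^sup>2 \<le> \<eta>\<^sup>2" using w[OF x] w_pos[of s x] by (intro power_mono) auto
    then have "(K + \<bar>\<mu>\<bar>) * (w s x)\<^sup>2 \<le> (K + \<bar>\<mu>\<bar>) * \<eta>\<^sup>2" using K_nonneg by (intro mult_left_mono) auto
    moreover have "- (K + \<bar>\<mu>\<bar>) * (w s x)\<^sup>2 \<le> (c x - \<mu>) * (w s x)\<^sup>2"
      using bounded_c[of x] by (intro mult_right_mono) auto
    moreover have "0 \<le> exp (2 * s * m x) * (\<phi>' s x)\<^sup>2" by simp
    moreover have "exp (2 * s * m x) * ((\<phi>' s x)\<^sup>2 + (c x - \<mu>) * (\<phi> s x)\<^sup>2) =
      exp (2 * s * m x) * (\<phi>' s x)\<^sup>2 + (c x - \<mu>) * (w s x)\<^sup>2" by (simp add: w_square algebra_simps)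
    ultimately show "- ((K + \<bar>\<mu>\<bar>) * \<eta>\<^sup>2) \<le> exp (2 * s * m x) * ((\<phi>' s x)\<^sup>2 + (c x - \<mu>) * (\<phi> s x)\<^sup>2)" by linarith
  qed
  then show ?thesis by (simp add: algebra_simps)
qed

lemma F_mono:
  assumes "u \<le> v" and c: "\<And>x. x \<in> {u..v} \<Longrightarrow> c x \<ge> \<mu>"
  shows "F \<mu> s u \<le> F \<mu> s v"
proof (rule DERIV_nonneg_imp_nondecreasing[OF assms(1)])
  fix x assume "u \<le> x" "x \<le> v"
  then have "c x - \<mu> \<ge> 0" using c[of x] by simp
  then show "\<exists>y. (F \<mu> s has_real_derivative y) (at x) \<and> 0 \<le> y"
    by (intro exI[of _ "exp (2 * s * m x) * ((\<phi>' s x)\<^sup>2 + (c x - \<mu>) * (\<phi> s x)\<^sup>2)"] conjI DERIV_F mult_nonneg_nonneg add_nonneg_nonneg) auto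
qed

text \<open>Picone's identity for the Riccati quotient \<open>g'/g\<close>.\<close>

lemma picone_lower:
  assumes g: "solves_ode (\<lambda>x. c x - \<mu>) g g'" and "x \<le> y" and pos: "\<And>t. t \<in> {x..y} \<Longrightarrow> g t > 0"
    and sign: "\<And>t. t \<in> {x..y} \<Longrightarrow> s * m' t * g' t \<le> 0"
  shows "F \<mu> s y - F \<mu> s x \<ge> g' y / g y * (w s y)\<^sup>2 - g' x / g x * (w s x)\<^sup>2"
  unfolding w_square
proof (rule deriv_le_imp_diff_le[OF \<open>x \<le> y\<close> _ DERIV_F])
  fix t assume t: "t \<in> {x..y}"
  define q where "q = g' t / g t"
  have gt: "g t > 0" by (rule pos[OF t])
  let ?d = "exp (2 * s * m t) * ((c t - \<mu> - q\<^sup>2) * (\<phi> s t)\<^sup>2 + 2 * s * m' t * q * (\<phi> s t)\<^sup>2 + 2 * q * \<phi> s t * \<phi>' s t)"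
  show "((\<lambda>t. g' t / g t * (exp (2 * s * m t) * (\<phi> s t)\<^sup>2)) has_real_derivative ?d) (at t)"
    using gt unfolding q_def
    by (auto intro!: derivative_eq_intros solves_odeD[OF g] DERIV_phi DERIV_m simp: field_simps power2_eq_square)
  have "s * m' t * q \<le> 0" using sign[OF t] gt by (simp add: q_def divide_nonpos_pos)
  then have "2 * (s * m' t * q) * (\<phi> s t)\<^sup>2 \<le> 0" using mult_nonpos_nonneg[of "s * m' t * q" "2 * (\<phi> s t)\<^sup>2"] by simp
  moreover have "0 \<le> (\<phi>' s t - q * \<phi> s t)\<^sup>2" by simp
  ultimately have "(c t - \<mu> - q\<^sup>2) * (\<phi> s t)\<^sup>2 + 2 * s * m' t * q * (\<phi> s t)\<^sup>2 + 2 * q * \<phi> s t * \<phi>' s t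
      \<le> (\<phi>' s t)\<^sup>2 + (c t - \<mu>) * (\<phi> s t)\<^sup>2"
    by (simp add: power2_eq_square algebra_simps)
  then show "?d \<le> exp (2 * s * m t) * ((\<phi>' s t)\<^sup>2 + (c t - \<mu>) * (\<phi> s t)\<^sup>2)" by (intro mult_left_mono) auto
qed

lemma small_right_of_rise:
  assumes up: "rises_right m T" and \<eta>: "\<eta> > 0"
  shows "\<exists>\<delta>>0. eventually (\<lambda>s. \<forall>x\<in>{T..T + \<delta>}. w s x \<le> \<eta>) at_top"
proof -
  obtain d where d: "d > 0" "mono_on {T..T + d} m" "\<forall>y\<in>{T<..T + d}. m T < m y"
    using up unfolding rises_right_def by blast
  obtain \<delta> where "\<delta> > 0" "eventually (\<lambda>s. \<forall>x\<in>{max T (T - \<delta>)..T + \<delta>}. w s x \<le> \<eta>) at_top"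
    using small_right[OF d(1,2) _ _ \<eta>] d(3) by blast
  moreover have "max T (T - \<delta>) = T" using \<open>\<delta> > 0\<close> by simp
  ultimately show ?thesis by auto
qed

lemma small_right_both:
  assumes up: "rises_right m T" "rises_left m T" and \<eta>: "\<eta> > 0"
  shows "\<exists>\<delta>>0. eventually (\<lambda>s. \<forall>x\<in>{T - \<delta>..T + \<delta>}. w s x \<le> \<eta>) at_top"
proof -
  obtain d where d: "d > 0" "mono_on {T..T + d} m" "\<forall>y\<in>{T<..T + d}. m T < m y"
    using up unfolding rises_right_def by blast
  obtain e where e: "e > 0" "mono_on {T - e..T} m"
    using up unfolding rises_left_def by blast
  have "mono_on {T - e..T + d} m"
  proof (rule mono_onI)
    fix r s assume rs: "r \<in> {T - e..T + d}" "s \<in> {T - e..T + d}" "r \<le> s"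
    consider "s \<le> T" | "r \<ge> T" | "r < T" "s > T" by linarith
    then show "m r \<le> m s"
    proof cases
      case 3
      then show ?thesis using mono_onD[OF e(2), of r T] mono_onD[OF d(2), of T s] rs d e by force
    qed (use rs mono_onD[OF e(2), of r s] mono_onD[OF d(2), of r s] in auto)
  qed
  then obtain \<delta> where "\<delta> > 0" "eventually (\<lambda>s. \<forall>x\<in>{max (T - e) (T - \<delta>)..T + \<delta>}. w s x \<le> \<eta>) at_top"
    using small_right[OF d(1) _ _ _ \<eta>, of "T - e" T] d(3) e(1) by force
  then show ?thesis
    using e(1) by (intro exI[of _ "min e \<delta>"] conjI, simp) (erule eventually_mono, auto simp: min_def split: if_splits)
qed

text \<open>Dirichlet and Neumann ends work differently. If \<open>m\<close> rises beyond
  \<open>b\<close>, then \<open>w s\<close> is small near \<open>b\<close>, which controls both the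
  increment of \<open>F\<close> and the boundary term. If \<open>m\<close> falls, \<open>g'\<close>
  stays positive slightly beyond \<open>b\<close>, and Picone's inequality continues up to
  \<open>v\<close>, leaving an outer boundary term of the good sign.\<close>

lemma plateau_right:
  assumes g: "solves_ode (\<lambda>x. c x - \<mu>) g g'" and gb: "g b > 0"
    and b: "rises_right m b \<or> (falls_right m b \<and> g' b > 0)" and \<epsilon>: "\<epsilon> > 0"
  shows "\<exists>\<delta>>0. \<forall>v\<in>{b..b + \<delta>}. eventually (\<lambda>s. F \<mu> s v - F \<mu> s b + g' b / g b * (w s b)\<^sup>2 \<ge> - \<epsilon>) at_top"
  using b
proof
  assume r: "rises_right m b"
  \<comment> \<open>\<open>L\<close> adds up the coefficients of \<open>\<eta>\<^sup>2\<close>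
    coming from the potential, on a window cut to length 1, and from the boundary term at
    \<open>b\<close>.\<close>
  define L where "L = K + \<bar>\<mu>\<bar> + \<bar>g' b / g b\<bar> + 1"
  have L: "L > 0" using K_nonneg unfolding L_def by linarith
  define \<eta> where "\<eta> = sqrt (\<epsilon> / L)"
  have \<eta>: "\<eta> > 0" "\<eta>\<^sup>2 * L = \<epsilon>" using \<epsilon> L by (auto simp: \<eta>_def)
  obtain \<delta> where del: "\<delta> > 0" "eventually (\<lambda>s. \<forall>x\<in>{b..b + \<delta>}. w s x \<le> \<eta>) at_top"
    using small_right_of_rise[OF r \<eta>(1)] by blast
  have "eventually (\<lambda>s. F \<mu> s v - F \<mu> s b + g' b / g b * (w s b)\<^sup>2 \<ge> - \<epsilon>) at_top" if v: "v \<in> {b..b + min 1 \<delta>}" for v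
    using del(2)
  proof eventually_elim
    case (elim s)
    have 1: "F \<mu> s v - F \<mu> s b \<ge> - ((K + \<bar>\<mu>\<bar>) * \<eta>\<^sup>2 * (v - b))"
      by (rule F_lower) (use v elim in auto)
    have 2: "(K + \<bar>\<mu>\<bar>) * \<eta>\<^sup>2 * (v - b) \<le> (K + \<bar>\<mu>\<bar>) * \<eta>\<^sup>2 * 1"
      using v K_nonneg by (intro mult_left_mono) auto
    have "w s b \<le> \<eta>" using elim del(1) by simp
    then have "(w s b)\<^sup>2 \<le> \<eta>\<^sup>2" using w_pos[of s b] by (intro power_mono) auto
    then have 3: "\<bar>g' b / g b\<bar> * (w s b)\<^sup>2 \<le> \<bar>g' b / g b\<bar> * \<eta>\<^sup>2" by (intro mult_left_mono) auto
    have "- \<bar>g' b / g b\<bar> \<le> g' b / g b" by linarith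
    then have 4: "- \<bar>g' b / g b\<bar> * (w s b)\<^sup>2 \<le> g' b / g b * (w s b)\<^sup>2" by (intro mult_right_mono) auto
    have 5: "(K + \<bar>\<mu>\<bar>) * \<eta>\<^sup>2 + \<bar>g' b / g b\<bar> * \<eta>\<^sup>2 \<le> \<epsilon>" unfolding \<eta>(2)[symmetric] L_def by (simp add: algebra_simps)
    show ?case using 1 2 3 4 5 by linarith
  qed
  then show ?thesis using del(1) by (intro exI[of _ "min 1 \<delta>"]) auto
next
  assume f: "falls_right m b \<and> g' b > 0"
  then obtain d where d: "d > 0" "antimono_on {b..b + d} m" unfolding falls_right_def by blast
  have "(g \<longlongrightarrow> g b) (nhds b)" "(g' \<longlongrightarrow> g' b) (nhds b)"
    using solves_odeD(5,6)[OF g, of b] by (simp_all add: continuous_at tendsto_at_iff_tendsto_nhds)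
  then have "eventually (\<lambda>x. g x > 0 \<and> g' x > 0) (nhds b)"
    using gb f by (intro eventually_conj order_tendstoD(1)[of g "g b"] order_tendstoD(1)[of g' "g' b"]) simp_all
  then obtain e where e: "e > 0" "\<And>x. dist x b < e \<Longrightarrow> g x > 0 \<and> g' x > 0" unfolding eventually_nhds_metric by blast
  \<comment> \<open>Strictly less than \<open>d\<close>, so that every point of the window has right
    neighbours inside the interval of monotonicity; this fixes the sign of
    \<open>m'\<close>.\<close>
  define \<delta> where "\<delta> = min (d / 2) (e / 2)"
  have del: "\<delta> > 0" "\<delta> < d" "\<delta> < e" using d e by (auto simp: \<delta>_def)
  have gp: "g x > 0" "g' x > 0" if "x \<in> {b..b + \<delta>}" for x using e(2)[of x] that del by (auto simp: dist_real_def)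
  have m': "m' t \<le> 0" if t: "t \<in> {b..b + \<delta>}" for t
  proof (rule ccontr)
    assume "\<not> m' t \<le> 0"
    then obtain z where z: "z > 0" "\<And>h. 0 < h \<Longrightarrow> h < z \<Longrightarrow> m t < m (t + h)"
      using DERIV_pos_inc_right[OF DERIV_m, of t] by auto
    define h where "h = min (z / 2) ((d - \<delta>) / 2)"
    have h: "h > 0" "h < z" "h < d - \<delta>" using z del by (auto simp: h_def min_def)
    have "m (t + h) \<le> m t" using monotone_onD[OF d(2), of t "t + h"] t h by auto
    then show False using z(2)[of h] h by simp
  qed
  have "eventually (\<lambda>s. F \<mu> s v - F \<mu> s b + g' b / g b * (w s b)\<^sup>2 \<ge> - \<epsilon>) at_top" if v: "v \<in> {b..b + \<delta>}" for v
    using eventually_ge_at_top[of 0]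
  proof eventually_elim
    case (elim s)
    have "F \<mu> s v - F \<mu> s b \<ge> g' v / g v * (w s v)\<^sup>2 - g' b / g b * (w s b)\<^sup>2"
    proof (rule picone_lower[OF g])
      fix t assume t: "t \<in> {b..v}"
      then show "g t > 0" using gp v by auto
      have "s * m' t \<le> 0" using m'[of t] t v elim by (simp add: mult_nonneg_nonpos)
      then show "s * m' t * g' t \<le> 0" using mult_nonpos_nonneg[of "s * m' t" "g' t"] gp(2)[of t] t v by auto
    qed (use v in auto)
    moreover have "g' v / g v * (w s v)\<^sup>2 \<ge> 0" using gp[OF v] by simp
    ultimately show ?case using \<epsilon> by linarith
  qed
  then show ?thesis using del(1) by blast
qed

end

text \<open>The good points are those where \<open>m'\<close> does not vanish; a plateau \<open>[a, b]\<close> contains none of them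
  and has to be crossed in one step.\<close>

lemma chain_of_intervals:
  fixes P :: "real \<Rightarrow> real \<Rightarrow> bool" and m' :: "real \<Rightarrow> real"
  assumes refl: "P 0 0" and trans: "\<And>u v w. P u v \<Longrightarrow> P v w \<Longrightarrow> P u w"
    and m0: "m' 0 \<noteq> 0"
    and loc: "\<And>T. T \<in> {0..1} \<Longrightarrow> \<exists>a b \<delta>. a \<le> T \<and> T \<le> b \<and> b \<le> 1 \<and> \<delta> > 0 \<and> (\<forall>x\<in>{a<..b}. m' x = 0) \<and>
       (\<forall>d>0. \<exists>v\<in>{b<..<b + d}. m' v \<noteq> 0) \<and> (\<forall>u\<in>{a - \<delta>..a}. \<forall>v\<in>{b..b + \<delta>}. P u v)"
  shows "P 0 1"
proof -
  \<comment> \<open>Requiring \<open>m' t \<noteq> 0\<close> keeps the points of \<open>S\<close>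
    near the supremum out of the plateau around it. Such a point therefore lies in the left window,
    and one step crosses the plateau.\<close>
  define S where "S = {t \<in> {0..1}. m' t \<noteq> 0 \<and> P 0 t}"
  have S0: "0 \<in> S" using refl m0 by (simp add: S_def)
  have bdd: "bdd_above S" by (rule bdd_aboveI[of _ 1]) (simp add: S_def)
  define T where "T = Sup S"
  have T0: "0 \<le> T" unfolding T_def by (rule cSup_upper[OF S0 bdd])
  have T1: "T \<le> 1" unfolding T_def by (rule cSup_least) (use S0 in blast, simp add: S_def)
  obtain a b \<delta> where ab: "a \<le> T" "T \<le> b" "b \<le> 1" "\<delta> > 0" "\<And>x. x \<in> {a<..b} \<Longrightarrow> m' x = 0"
    "\<And>d. d > 0 \<Longrightarrow> \<exists>v\<in>{b<..<b + d}. m' v \<noteq> 0" "\<And>u v. u \<in> {a - \<delta>..a} \<Longrightarrow> v \<in> {b..b + \<delta>} \<Longrightarrow> P u v"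
    using loc[of T] T0 T1 by auto
  obtain t where t: "t \<in> S" "a - \<delta> < t"
    using less_cSup_iff[OF _ bdd, of "a - \<delta>"] S0 ab(1,4) unfolding T_def by fastforce
  have tT: "t \<le> T" unfolding T_def by (rule cSup_upper[OF t(1) bdd])
  have "t \<notin> {a<..b}" using t(1) ab(5)[of t] by (auto simp: S_def)
  then have ta: "t \<le> a" using tT ab(2) by simp
  have Pt: "P 0 v" if "v \<in> {b..b + \<delta>}" for v
    using trans[of 0 t v] ab(7)[of t v] t ta that by (auto simp: S_def)
  have "b = 1"
  proof (rule ccontr)
    assume "b \<noteq> 1"
    then have b1: "b < 1" using ab(3) by simp
    obtain v where v: "b < v" "v < b + min \<delta> (1 - b)" "m' v \<noteq> 0"
      using ab(6)[of "min \<delta> (1 - b)"] ab(4) b1 by auto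
    then have "v \<in> S" using Pt[of v] T0 ab(2) by (auto simp: S_def)
    then have "v \<le> T" unfolding T_def by (rule cSup_upper[OF _ bdd])
    then show False using v ab(2) by simp
  qed
  then show ?thesis using Pt[of 1] ab(4) by simp
qed

section \<open>Gluing the local lower bounds over one period\<close>

context drift_family begin

text \<open>The threshold for \<open>s\<close> may depend on \<open>u\<close> and \<open>v\<close>,
  which suffices because the relation is composed by transitivity. An error proportional to
  \<open>v - u\<close> is what makes it transitive for a fixed \<open>\<epsilon>\<close>.\<close>

definition energy_ge :: "real \<Rightarrow> real \<Rightarrow> real \<Rightarrow> real \<Rightarrow> bool" where
  "energy_ge \<mu> \<epsilon> u v \<longleftrightarrow> eventually (\<lambda>s. F \<mu> s v - F \<mu> s u \<ge> - \<epsilon> * (v - u)) at_top"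

lemma energy_ge_trans: "energy_ge \<mu> \<epsilon> u v \<Longrightarrow> energy_ge \<mu> \<epsilon> v z \<Longrightarrow> energy_ge \<mu> \<epsilon> u z"
  unfolding energy_ge_def by (erule (1) eventually_elim2) (simp add: algebra_simps)

text \<open>Unless \<open>T\<close> is a peak, mass can escape uphill from both sides of
  \<open>T\<close>: along one monotone stretch through \<open>T\<close> in either direction, or away
  from a valley, where two one-sided neighbourhoods are joined.\<close>

lemma small_at_point:
  assumes T: "rises_right m T \<or> falls_right m T" "rises_left m T \<or> falls_left m T"
    "\<not> (rises_left m T \<and> falls_right m T)" and \<eta>: "\<eta> > 0"
  shows "\<exists>\<delta>>0. eventually (\<lambda>s. \<forall>x\<in>{T - \<delta>..T + \<delta>}. w s x \<le> \<eta>) at_top"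
proof -
  interpret r: drift_family "\<lambda>x. c (- x)" K "\<lambda>x. m (- x)" "\<lambda>x. - m' (- x)" "\<lambda>s x. \<phi> s (- x)" "\<lambda>s x. - \<phi>' s (- x)"
    "\<lambda>s x. - M s (- x)" "\<lambda>s x. - E s (- x)" "\<lambda>s x. - G s (- x)" C by (rule reflect)
  have rw: "r.w s x = w s (- x)" for s x by (simp add: r.w_def w_def)
  consider "rises_right m T" "rises_left m T" | "falls_right m T" "falls_left m T" | "rises_right m T" "falls_left m T"
    using T by blast
  then show ?thesis
  proof cases
    case 1
    then show ?thesis by (rule small_right_both[OF _ _ \<eta>])
  next
    case 2
    have "rises_left (\<lambda>x. m (- x)) (- T)" by (rule falls_right_reflect[OF 2(1)])
    then obtain \<delta> where del: "\<delta> > 0" "eventually (\<lambda>s. \<forall>x\<in>{- T - \<delta>..- T + \<delta>}. r.w s x \<le> \<eta>) at_top"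
      using r.small_right_both[OF falls_left_reflect[OF 2(2)] _ \<eta>] by blast
    from del(2) have "eventually (\<lambda>s. \<forall>x\<in>{T - \<delta>..T + \<delta>}. w s x \<le> \<eta>) at_top"
    proof eventually_elim
      case (elim s)
      show ?case
      proof
        fix x assume "x \<in> {T - \<delta>..T + \<delta>}"
        then show "w s x \<le> \<eta>" using elim[rule_format, of "- x"] by (simp add: rw)
      qed
    qed
    then show ?thesis using del(1) by blast
  next
    case 3
    obtain \<delta>1 where d1: "\<delta>1 > 0" "eventually (\<lambda>s. \<forall>x\<in>{T..T + \<delta>1}. w s x \<le> \<eta>) at_top"
      using small_right_of_rise[OF 3(1) \<eta>] by blast
    obtain \<delta>2 where d2: "\<delta>2 > 0" "eventually (\<lambda>s. \<forall>x\<in>{- T..- T + \<delta>2}. r.w s x \<le> \<eta>) at_top"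
      using r.small_right_of_rise[OF falls_left_reflect[OF 3(2)] \<eta>] by blast
    have "eventually (\<lambda>s. \<forall>x\<in>{T - min \<delta>1 \<delta>2..T + min \<delta>1 \<delta>2}. w s x \<le> \<eta>) at_top"
      using d1(2) d2(2)
    proof eventually_elim
      case (elim s)
      show ?case
      proof
        fix x assume x: "x \<in> {T - min \<delta>1 \<delta>2..T + min \<delta>1 \<delta>2}"
        show "w s x \<le> \<eta>"
        proof (cases "x \<ge> T")
          case True
          then show ?thesis using elim(1) x by auto
        next
          case False
          then have "- x \<in> {- T..- T + \<delta>2}" using x by auto
          then show ?thesis using elim(2)[rule_format, of "- x"] by (simp add: rw)
        qed
      qed
    qed
    then show ?thesis using d1(1) d2(1) by (intro exI[of _ "min \<delta>1 \<delta>2"]) auto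
  qed
qed

text \<open>At a peak the density itself is nonnegative nearby, since \<open>\<mu> < c T\<close>;
  elsewhere the smallness of \<open>w s\<close> bounds its negative part.\<close>

lemma energy_at_point:
  assumes T: "rises_right m T \<or> falls_right m T" "rises_left m T \<or> falls_left m T"
    "rises_left m T \<and> falls_right m T \<Longrightarrow> \<mu> < c T" and \<epsilon>: "\<epsilon> > 0"
  shows "\<exists>\<delta>>0. \<forall>u\<in>{T - \<delta>..T}. \<forall>v\<in>{T..T + \<delta>}. energy_ge \<mu> \<epsilon> u v"
proof (cases "rises_left m T \<and> falls_right m T")
  case True
  have "isCont c T" using continuous_c by (simp add: continuous_on_eq_continuous_at)
  then have "(c \<longlongrightarrow> c T) (nhds T)" by (simp add: continuous_at tendsto_at_iff_tendsto_nhds)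
  then have "eventually (\<lambda>x. \<mu> < c x) (nhds T)" using T(3)[OF True] by (rule order_tendstoD)
  then obtain e where e: "e > 0" "\<And>x. dist x T < e \<Longrightarrow> \<mu> < c x" unfolding eventually_nhds_metric by blast
  have "energy_ge \<mu> \<epsilon> u v" if uv: "u \<in> {T - e / 2..T}" "v \<in> {T..T + e / 2}" for u v
  proof -
    have "F \<mu> s u \<le> F \<mu> s v" for s
    proof (rule F_mono)
      fix x assume "x \<in> {u..v}"
      then have "dist x T < e" using uv e(1) unfolding dist_real_def by auto
      then show "\<mu> \<le> c x" using e(2)[of x] by simp
    qed (use uv in simp)
    moreover have "\<epsilon> * (v - u) \<ge> 0" using uv \<epsilon> by (intro mult_nonneg_nonneg) auto
    ultimately show ?thesis unfolding energy_ge_def by (intro always_eventually allI) (smt (verit) mult_minus_left)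
  qed
  then show ?thesis using e(1) by (intro exI[of _ "e / 2"]) auto
next
  case False
  define L where "L = K + \<bar>\<mu>\<bar> + 1"
  have L: "L > 0" using K_nonneg unfolding L_def by linarith
  define \<eta> where "\<eta> = sqrt (\<epsilon> / L)"
  have \<eta>: "\<eta> > 0" "L * \<eta>\<^sup>2 = \<epsilon>" using \<epsilon> L by (auto simp: \<eta>_def)
  obtain \<delta> where del: "\<delta> > 0" "eventually (\<lambda>s. \<forall>x\<in>{T - \<delta>..T + \<delta>}. w s x \<le> \<eta>) at_top"
    using small_at_point[OF T(1,2) False \<eta>(1)] by blast
  have "energy_ge \<mu> \<epsilon> u v" if uv: "u \<in> {T - \<delta>..T}" "v \<in> {T..T + \<delta>}" for u v
    unfolding energy_ge_def using del(2)
  proof eventually_elim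
    case (elim s)
    have 1: "F \<mu> s v - F \<mu> s u \<ge> - ((K + \<bar>\<mu>\<bar>) * \<eta>\<^sup>2 * (v - u))"
      by (rule F_lower) (use uv elim in auto)
    have "(K + \<bar>\<mu>\<bar>) * \<eta>\<^sup>2 * (v - u) \<le> L * \<eta>\<^sup>2 * (v - u)"
      using uv by (intro mult_right_mono) (auto simp: L_def)
    then show ?case using 1 \<eta>(2) by simp
  qed
  then show ?thesis using del(1) by blast
qed

lemma plateau_left:
  assumes g: "solves_ode (\<lambda>x. c x - \<mu>) g g'" and ga: "g a > 0"
    and a: "falls_left m a \<or> (rises_left m a \<and> g' a < 0)" and \<epsilon>: "\<epsilon> > 0"
  shows "\<exists>\<delta>>0. \<forall>u\<in>{a - \<delta>..a}. eventually (\<lambda>s. F \<mu> s a - F \<mu> s u - g' a / g a * (w s a)\<^sup>2 \<ge> - \<epsilon>) at_top"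
proof -
  interpret r: drift_family "\<lambda>x. c (- x)" K "\<lambda>x. m (- x)" "\<lambda>x. - m' (- x)" "\<lambda>s x. \<phi> s (- x)" "\<lambda>s x. - \<phi>' s (- x)"
    "\<lambda>s x. - M s (- x)" "\<lambda>s x. - E s (- x)" "\<lambda>s x. - G s (- x)" C by (rule reflect)
  have rF: "r.F \<mu> s x = - F \<mu> s (- x)" for s x by (simp add: r.F_def F_def)
  have rw: "r.w s x = w s (- x)" for s x by (simp add: r.w_def w_def)
  have "solves_ode (\<lambda>x. c (- x) - \<mu>) (\<lambda>x. g (- x)) (\<lambda>x. - g' (- x))"
    using solves_ode_reflect[OF g, of 0] by simp
  from r.plateau_right[OF this, of "- a" \<epsilon>]
  obtain \<delta> where "\<delta> > 0" and d: "\<And>v. v \<in> {- a..- a + \<delta>} \<Longrightarrow>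
      eventually (\<lambda>s. r.F \<mu> s v - r.F \<mu> s (- a) + - g' a / g a * (r.w s (- a))\<^sup>2 \<ge> - \<epsilon>) at_top"
    using ga a \<epsilon> falls_left_reflect[of m a] rises_left_reflect[of m a] by auto
  have "eventually (\<lambda>s. F \<mu> s a - F \<mu> s u - g' a / g a * (w s a)\<^sup>2 \<ge> - \<epsilon>) at_top" if "u \<in> {a - \<delta>..a}" for u
    using d[of "- u"] that by (simp add: rF rw)
  then show ?thesis using \<open>\<delta> > 0\<close> by blast
qed

text \<open>Picone's inequality on [a,b] leaves boundary terms at \<open>a\<close> and
  \<open>b\<close>, which cancel exactly against those carried along in \<open>plateau_left\<close>
  and \<open>plateau_right\<close>.\<close>

lemma energy_at_plateau:
  assumes ab: "a < b" and flat: "\<And>x. x \<in> {a..b} \<Longrightarrow> m' x = 0"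
    and g: "solves_ode (\<lambda>x. c x - \<mu>) g g'" "\<And>x. x \<in> {a..b} \<Longrightarrow> g x > 0"
    and a: "falls_left m a \<or> (rises_left m a \<and> g' a < 0)"
    and b: "rises_right m b \<or> (falls_right m b \<and> g' b > 0)" and \<epsilon>: "\<epsilon> > 0"
  shows "\<exists>\<delta>>0. \<forall>u\<in>{a - \<delta>..a}. \<forall>v\<in>{b..b + \<delta>}. energy_ge \<mu> \<epsilon> u v"
proof -
  \<comment> \<open>Every interval [u,v] considered contains [a,b], so an error of
    \<open>\<epsilon> * (b - a)\<close>, half for each end, is within the allowance
    \<open>\<epsilon> * (v - u)\<close>.\<close>
  define \<eta> where "\<eta> = \<epsilon> * (b - a) / 2"
  have \<eta>: "\<eta> > 0" using \<epsilon> ab by (simp add: \<eta>_def)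
  obtain \<delta>1 where d1: "\<delta>1 > 0" "\<And>u. u \<in> {a - \<delta>1..a} \<Longrightarrow>
      eventually (\<lambda>s. F \<mu> s a - F \<mu> s u - g' a / g a * (w s a)\<^sup>2 \<ge> - \<eta>) at_top"
    using plateau_left[OF g(1) _ a \<eta>] g(2)[of a] ab by auto
  obtain \<delta>2 where d2: "\<delta>2 > 0" "\<And>v. v \<in> {b..b + \<delta>2} \<Longrightarrow>
      eventually (\<lambda>s. F \<mu> s v - F \<mu> s b + g' b / g b * (w s b)\<^sup>2 \<ge> - \<eta>) at_top"
    using plateau_right[OF g(1) _ b \<eta>] g(2)[of b] ab by auto
  have "energy_ge \<mu> \<epsilon> u v" if uv: "u \<in> {a - min \<delta>1 \<delta>2..a}" "v \<in> {b..b + min \<delta>1 \<delta>2}" for u v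
  proof -
    have "u \<in> {a - \<delta>1..a}" "v \<in> {b..b + \<delta>2}" using uv by auto
    from d1(2)[OF this(1)] d2(2)[OF this(2)] show ?thesis
      unfolding energy_ge_def
    proof eventually_elim
      case (elim s)
      have "F \<mu> s b - F \<mu> s a \<ge> g' b / g b * (w s b)\<^sup>2 - g' a / g a * (w s a)\<^sup>2"
        by (rule picone_lower[OF g(1)]) (use ab g(2) flat in auto)
      then have "F \<mu> s v - F \<mu> s u \<ge> - (\<epsilon> * (b - a))" using elim by (simp add: \<eta>_def)
      moreover have "\<epsilon> * (b - a) \<le> \<epsilon> * (v - u)" using uv \<epsilon> by (intro mult_left_mono) auto
      ultimately show ?case by simp
    qed
  qed
  then show ?thesis using d1(1) d2(1) by (intro exI[of _ "min \<delta>1 \<delta>2"]) auto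
qed

text \<open>\<open>hull\<close> supplies the local data for \<open>chain_of_intervals\<close>:
  either \<open>T\<close> is by itself a degenerate plateau \<open>a = b = T\<close>, or it lies on
  a plateau that carries a positive solution with the right slopes.\<close>

theorem energy_lower_bound:
  assumes m0: "m' 0 \<noteq> 0" and \<epsilon>: "\<epsilon> > 0"
    and hull: "\<And>T. T \<in> {0..1} \<Longrightarrow>
      ((rises_right m T \<or> falls_right m T) \<and> (rises_left m T \<or> falls_left m T) \<and>
        (rises_left m T \<and> falls_right m T \<longrightarrow> \<mu> < c T)) \<or>
      (\<exists>a b g g'. a < b \<and> a \<le> T \<and> T \<le> b \<and> b \<le> 1 \<and> (\<forall>x\<in>{a..b}. m' x = 0) \<and>
        solves_ode (\<lambda>x. c x - \<mu>) g g' \<and> (\<forall>x\<in>{a..b}. g x > 0) \<and>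
        (falls_left m a \<or> rises_left m a \<and> g' a < 0) \<and> (rises_right m b \<or> falls_right m b \<and> g' b > 0))"
  shows "eventually (\<lambda>s. F \<mu> s 1 - F \<mu> s 0 \<ge> - \<epsilon>) at_top"
proof -
  have "energy_ge \<mu> \<epsilon> 0 1"
  proof (rule chain_of_intervals[OF _ energy_ge_trans, where m' = m', OF _ _ _ m0])
    show "energy_ge \<mu> \<epsilon> 0 0" by (simp add: energy_ge_def)
  next
    fix T :: real assume T: "T \<in> {0..1}"
    show "\<exists>a b \<delta>. a \<le> T \<and> T \<le> b \<and> b \<le> 1 \<and> \<delta> > 0 \<and> (\<forall>x\<in>{a<..b}. m' x = 0) \<and>
       (\<forall>d>0. \<exists>v\<in>{b<..<b + d}. m' v \<noteq> 0) \<and> (\<forall>u\<in>{a - \<delta>..a}. \<forall>v\<in>{b..b + \<delta>}. energy_ge \<mu> \<epsilon> u v)"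
      using hull[OF T]
    proof (rule disjE)
      assume True: "(rises_right m T \<or> falls_right m T) \<and> (rises_left m T \<or> falls_left m T) \<and>
        (rises_left m T \<and> falls_right m T \<longrightarrow> \<mu> < c T)"
      then obtain \<delta> where "\<delta> > 0" "\<forall>u\<in>{T - \<delta>..T}. \<forall>v\<in>{T..T + \<delta>}. energy_ge \<mu> \<epsilon> u v"
        using energy_at_point[of T \<mu> \<epsilon>] \<epsilon> by blast
      moreover have "\<forall>d>0. \<exists>v\<in>{T<..<T + d}. m' v \<noteq> 0" using nonflat_right[OF DERIV_m, of T] True by blast
      ultimately show ?thesis using T by (intro exI[of _ T] exI[of _ \<delta>]) auto
    next
      assume "\<exists>a b g g'. a < b \<and> a \<le> T \<and> T \<le> b \<and> b \<le> 1 \<and> (\<forall>x\<in>{a..b}. m' x = 0) \<and>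
        solves_ode (\<lambda>x. c x - \<mu>) g g' \<and> (\<forall>x\<in>{a..b}. g x > 0) \<and>
        (falls_left m a \<or> rises_left m a \<and> g' a < 0) \<and> (rises_right m b \<or> falls_right m b \<and> g' b > 0)"
      then obtain a b g g' where ab: "a < b" "a \<le> T" "T \<le> b" "b \<le> 1" "\<forall>x\<in>{a..b}. m' x = 0"
        "solves_ode (\<lambda>x. c x - \<mu>) g g'" "\<forall>x\<in>{a..b}. g x > 0"
        "falls_left m a \<or> rises_left m a \<and> g' a < 0" "rises_right m b \<or> falls_right m b \<and> g' b > 0"
        by (elim exE conjE) (rule that)
      obtain \<delta> where "\<delta> > 0" "\<forall>u\<in>{a - \<delta>..a}. \<forall>v\<in>{b..b + \<delta>}. energy_ge \<mu> \<epsilon> u v"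
        using energy_at_plateau[OF ab(1) _ ab(6) _ ab(8,9) \<epsilon>] ab(5,7) by blast
      moreover have "\<forall>d>0. \<exists>v\<in>{b<..<b + d}. m' v \<noteq> 0" using nonflat_right[OF DERIV_m, of b] ab(9) by blast
      ultimately show ?thesis using ab(2-5) by (intro exI[of _ a] exI[of _ b] exI[of _ \<delta>]) auto
    qed
  qed
  then show ?thesis by (simp add: energy_ge_def)
qed

end

text \<open>The assumption \<open>energy_eq_reflected\<close> makes the locale invariant under \<open>x \<mapsto> - x\<close>.\<close>

locale drift_eigenfamily = drift_family +
  fixes lam :: "real \<Rightarrow> real"
  assumes DERIV_phi': "(\<phi>' s has_real_derivative (c x - lam s) * \<phi> s x - 2 * s * m' x * \<phi>' s x) (at x)"
    and energy_eq: "E s 1 - E s 0 + (G s 1 - G s 0) = lam s"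
    and lam_bound: "\<bar>lam s\<bar> \<le> K"
    and energy_eq_reflected: "E s 0 - E s (- 1) + (G s 0 - G s (- 1)) = lam s"
begin

lemma F_period: "F \<mu> s 1 - F \<mu> s 0 = lam s - \<mu>"
proof -
  have "M s 1 - M s 0 = 1" using M_period[of s 0] by simp
  moreover have "F \<mu> s 1 - F \<mu> s 0 = (E s 1 - E s 0 + (G s 1 - G s 0)) - \<mu> * (M s 1 - M s 0)"
    by (simp add: F_def algebra_simps)
  ultimately show ?thesis by (simp add: energy_eq)
qed

lemma reflect_eigen: "drift_eigenfamily (\<lambda>x. c (- x)) K (\<lambda>x. m (- x)) (\<lambda>x. - m' (- x)) (\<lambda>s x. \<phi> s (- x)) (\<lambda>s x. - \<phi>' s (- x))
  (\<lambda>s x. - M s (- x)) (\<lambda>s x. - E s (- x)) (\<lambda>s x. - G s (- x)) C lam"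
proof (intro drift_eigenfamily.intro reflect drift_eigenfamily_axioms.intro)
  have g: "(uminus has_real_derivative -1) (at x)" for x :: real by (auto intro!: derivative_eq_intros)
  show "((\<lambda>x. - \<phi>' s (- x)) has_real_derivative
      (c (- x) - lam s) * \<phi> s (- x) - 2 * s * (- m' (- x)) * (- \<phi>' s (- x))) (at x)" for s x
    using DERIV_minus[OF DERIV_chain2[OF DERIV_phi' g, of s x]] by simp
  show "- E s (- 1) - (- E s (- 0)) + (- G s (- 1) - (- G s (- 0))) = lam s" for s
    using energy_eq_reflected[of s] by simp
  show "- E s (- 0) - (- E s (- (- 1))) + (- G s (- 0) - (- G s (- (- 1)))) = lam s" for s
    using energy_eq[of s] by simp
qed (rule lam_bound)

section \<open>Upper bounds from Picone's inequality\<close>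

definition flux :: "real \<Rightarrow> real \<Rightarrow> real" where "flux s x = exp (2 * s * m x) * (\<phi>' s x / \<phi> s x)"

text \<open>A Riccati equation in divergence form: the weight absorbs the drift term.\<close>

lemma DERIV_flux: "(flux s has_real_derivative exp (2 * s * m x) * (c x - lam s - (\<phi>' s x / \<phi> s x)\<^sup>2)) (at x)"
  unfolding flux_def using phi_pos[of s x]
  by (auto intro!: derivative_eq_intros DERIV_phi DERIV_phi' DERIV_m simp: field_simps power2_eq_square)

text \<open>Complete the square in \<open>(f' - r * f)\<^sup>2 \<ge> 0\<close> with \<open>r\<close>
  the logarithmic derivative of the eigenfunction. Compared with \<open>picone_lower\<close> the
  roles are reversed: the eigenfunction is now the comparison solution and \<open>f\<close> is
  arbitrary. \<open>H\<close> is an antiderivative of an upper bound for the energy density of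
  \<open>f\<close>.\<close>

lemma picone_upper:
  assumes "x \<le> y" and f: "\<And>t. t \<in> {x..y} \<Longrightarrow> (f has_real_derivative f' t) (at t)"
    and H: "\<And>t. t \<in> {x..y} \<Longrightarrow> (H has_real_derivative h t) (at t)"
    and h: "\<And>t. t \<in> {x..y} \<Longrightarrow> exp (2 * s * m t) * ((f' t)\<^sup>2 + (c t - lam s) * (f t)\<^sup>2) \<le> h t"
  shows "flux s y * (f y)\<^sup>2 - flux s x * (f x)\<^sup>2 \<le> H y - H x"
proof (rule deriv_le_imp_diff_le[OF assms(1) _ H])
  fix t assume t: "t \<in> {x..y}"
  define r where "r = \<phi>' s t / \<phi> s t"
  show "((\<lambda>t. flux s t * (f t)\<^sup>2) has_real_derivative
      exp (2 * s * m t) * (c t - lam s - r\<^sup>2) * (f t)\<^sup>2 + exp (2 * s * m t) * r * (2 * f t * f' t)) (at t)"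
    unfolding r_def
    by (rule derivative_eq_intros DERIV_flux f[OF t] refl)+ (simp add: flux_def)
  have "0 \<le> (f' t - r * f t)\<^sup>2" by simp
  then have "(c t - lam s - r\<^sup>2) * (f t)\<^sup>2 + r * (2 * f t * f' t) \<le> (f' t)\<^sup>2 + (c t - lam s) * (f t)\<^sup>2"
    by (simp add: power2_eq_square algebra_simps)
  then have "exp (2 * s * m t) * ((c t - lam s - r\<^sup>2) * (f t)\<^sup>2 + r * (2 * f t * f' t))
      \<le> exp (2 * s * m t) * ((f' t)\<^sup>2 + (c t - lam s) * (f t)\<^sup>2)" by (rule mult_left_mono) simp
  also have "\<dots> \<le> h t" by (rule h[OF t])
  finally show "exp (2 * s * m t) * (c t - lam s - r\<^sup>2) * (f t)\<^sup>2 + exp (2 * s * m t) * r * (2 * f t * f' t) \<le> h t"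
    by (simp add: algebra_simps)
qed

text \<open>The test function is the linear ramp from 0 at \<open>a - \<delta>\<close> to 1 at
  \<open>a\<close>: its slope contributes \<open>1 / \<delta>\<^sup>2\<close>, and
  \<open>c - lam s\<close> is at most \<open>2 * K\<close>.\<close>

lemma flux_upper:
  assumes \<delta>: "\<delta> > 0" and A: "\<And>x. (A has_real_derivative exp (2 * s * m x)) (at x)"
  shows "flux s a \<le> (1 / \<delta>\<^sup>2 + 2 * K) * (A a - A (a - \<delta>))"
proof -
  define L where "L = 1 / \<delta>\<^sup>2 + 2 * K"
  define f where "f t = (t - (a - \<delta>)) / \<delta>" for t
  have "flux s a * (f a)\<^sup>2 - flux s (a - \<delta>) * (f (a - \<delta>))\<^sup>2 \<le> L * A a - L * A (a - \<delta>)"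
  proof (rule picone_upper[where f' = "\<lambda>_. 1 / \<delta>" and h = "\<lambda>t. L * exp (2 * s * m t)"])
    fix t assume t: "t \<in> {a - \<delta>..a}"
    show "(f has_real_derivative 1 / \<delta>) (at t)"
      unfolding f_def using \<delta> by (auto intro!: derivative_eq_intros)
    show "((\<lambda>t. L * A t) has_real_derivative L * exp (2 * s * m t)) (at t)"
      by (auto intro!: derivative_eq_intros A)
    have f01: "0 \<le> f t" "f t \<le> 1" using t \<delta> by (auto simp: f_def)
    have "c t - lam s \<le> 2 * K" using bounded_c[of t] lam_bound[of s] by linarith
    then have "(c t - lam s) * (f t)\<^sup>2 \<le> 2 * K * (f t)\<^sup>2" by (rule mult_right_mono) simp
    also have "\<dots> \<le> 2 * K * 1" using f01 K_nonneg by (intro mult_left_mono) (auto simp: power_le_one)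
    finally have "(1 / \<delta>)\<^sup>2 + (c t - lam s) * (f t)\<^sup>2 \<le> L" by (simp add: L_def power_divide)
    then have "exp (2 * s * m t) * ((1 / \<delta>)\<^sup>2 + (c t - lam s) * (f t)\<^sup>2) \<le> exp (2 * s * m t) * L"
      by (rule mult_left_mono) simp
    then show "exp (2 * s * m t) * ((1 / \<delta>)\<^sup>2 + (c t - lam s) * (f t)\<^sup>2) \<le> L * exp (2 * s * m t)"
      by (simp add: mult.commute)
  qed (use \<delta> in simp)
  moreover have "f a = 1" "f (a - \<delta>) = 0" using \<delta> by (auto simp: f_def)
  ultimately show ?thesis by (simp add: L_def right_diff_distrib)
qed

lemma weight_diff_le:
  assumes A: "\<And>x. (A has_real_derivative exp (2 * s * m x)) (at x)" and "x \<le> y" "s \<ge> 0"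
    and le: "\<And>t. t \<in> {x..y} \<Longrightarrow> m t \<le> k"
  shows "A y - A x \<le> exp (2 * s * k) * (y - x)"
proof -
  have "A y - A x \<le> exp (2 * s * k) * y - exp (2 * s * k) * x"
    by (rule deriv_le_imp_diff_le[OF \<open>x \<le> y\<close> A, where g = "\<lambda>_. exp (2 * s * k)"])
       (use le \<open>s \<ge> 0\<close> in \<open>auto intro!: derivative_eq_intros mult_left_mono\<close>)
  then show ?thesis by (simp add: right_diff_distrib)
qed

lemma weight_diff_ge:
  assumes A: "\<And>x. (A has_real_derivative exp (2 * s * m x)) (at x)" and "x \<le> y" "s \<ge> 0"
    and le: "\<And>t. t \<in> {x..y} \<Longrightarrow> k \<le> m t"
  shows "A y - A x \<ge> exp (2 * s * k) * (y - x)"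
proof -
  have "exp (2 * s * k) * y - exp (2 * s * k) * x \<le> A y - A x"
    by (rule deriv_le_imp_diff_le[OF \<open>x \<le> y\<close> _ A, where f = "\<lambda>_. exp (2 * s * k)"])
       (use le \<open>s \<ge> 0\<close> in \<open>auto intro!: derivative_eq_intros mult_left_mono\<close>)
  then show ?thesis by (simp add: right_diff_distrib)
qed

lemma weight_antideriv: "\<exists>A. \<forall>x. (A has_real_derivative exp (2 * s * m x)) (at x)"
proof -
  have "continuous_on UNIV (\<lambda>x. exp (2 * s * m x))"
    by (intro continuous_intros continuous_at_imp_continuous_on ballI isCont_m)
  from DERIV_antideriv[OF this] show ?thesis by blast
qed

lemma max_below:
  assumes "x \<le> y" "\<And>t. t \<in> {x..y} \<Longrightarrow> m t < k"
  shows "\<exists>g>0. \<forall>t\<in>{x..y}. m t \<le> k - g"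
proof -
  obtain z where z: "z \<in> {x..y}" "\<forall>t\<in>{x..y}. m t \<le> m z"
    using continuous_attains_sup[of "{x..y}" m] assms(1) continuous_at_imp_continuous_on[of "{x..y}" m] isCont_m by auto
  then show ?thesis using assms(2)[OF z(1)] by (intro exI[of _ "k - m z"]) auto
qed

lemma exp_decay: "g > 0 \<Longrightarrow> ((\<lambda>s::real. exp (- 2 * s * g)) \<longlongrightarrow> 0) at_top"
proof -
  assume g: "g > 0"
  have "filterlim (\<lambda>s::real. - 2 * s * g) at_bot at_top"
    using filterlim_tendsto_pos_mult_at_top[OF tendsto_const _ filterlim_ident, of "2 * g"] g
    by (simp add: filterlim_uminus_at_bot mult_ac)
  from filterlim_compose[OF exp_at_bot this] show ?thesis .
qed

text \<open>Divide \<open>flux_upper\<close> by \<open>exp (2 * s * m a)\<close>. The stretch of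
  length \<open>\<rho>\<close> next to \<open>a\<close> contributes at most
  \<open>L * \<rho>\<close>; on the rest of the ramp \<open>m\<close> is below \<open>m a\<close> by
  a fixed gap, so that contribution decays exponentially.\<close>

lemma log_derivative_upper:
  assumes up: "rises_left m a" and \<eta>: "\<eta> > 0"
  shows "eventually (\<lambda>s. \<phi>' s a / \<phi> s a \<le> \<eta>) at_top"
proof -
  obtain \<delta> where del: "\<delta> > 0" "\<And>y. y \<in> {a - \<delta>..<a} \<Longrightarrow> m y < m a"
    using up unfolding rises_left_def by blast
  define L where "L = 1 / \<delta>\<^sup>2 + 2 * K"
  have L: "L > 0" using K_nonneg del unfolding L_def by (simp add: add_pos_nonneg)
  define \<rho> where "\<rho> = min (\<delta> / 2) (\<eta> / (2 * L))"
  have rho: "\<rho> > 0" "\<rho> < \<delta>" "L * \<rho> \<le> \<eta> / 2"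
  proof -
    show "\<rho> > 0" "\<rho> < \<delta>" using del(1) \<eta> L by (auto simp: \<rho>_def)
    have "L * \<rho> \<le> L * (\<eta> / (2 * L))" using L by (intro mult_left_mono) (auto simp: \<rho>_def)
    then show "L * \<rho> \<le> \<eta> / 2" using L by simp
  qed
  obtain g where g: "g > 0" "\<forall>t\<in>{a - \<delta>..a - \<rho>}. m t \<le> m a - g"
    using max_below[of "a - \<delta>" "a - \<rho>" "m a"] del rho by auto
  have "((\<lambda>s. L * \<delta> * exp (- 2 * s * g)) \<longlongrightarrow> L * \<delta> * 0) at_top"
    by (intro tendsto_mult tendsto_const exp_decay g)
  then have "eventually (\<lambda>s. L * \<delta> * exp (- 2 * s * g) < \<eta> / 2) at_top"
    by (rule order_tendstoD) (use \<eta> in simp)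
  then show ?thesis using eventually_ge_at_top[of 0]
  proof eventually_elim
    case (elim s)
    obtain A where A: "\<And>x. (A has_real_derivative exp (2 * s * m x)) (at x)" using weight_antideriv by blast
    have "m t \<le> m a" if "t \<in> {a - \<rho>..a}" for t using del(2)[of t] that rho by (cases "t = a") auto
    then have 1: "A a - A (a - \<rho>) \<le> exp (2 * s * m a) * \<rho>"
      using weight_diff_le[of A s "a - \<rho>" a "m a"] A rho(1) elim by simp
    have "A (a - \<rho>) - A (a - \<delta>) \<le> exp (2 * s * (m a - g)) * (\<delta> - \<rho>)"
      using weight_diff_le[of A s "a - \<delta>" "a - \<rho>" "m a - g"] A rho(2) elim g(2) by simp
    also have "\<dots> \<le> exp (2 * s * (m a - g)) * \<delta>" using rho by (intro mult_left_mono) auto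
    also have "exp (2 * s * (m a - g)) = exp (2 * s * m a) * exp (- 2 * s * g)"
      by (simp add: right_diff_distrib flip: exp_add)
    finally have 2: "A (a - \<rho>) - A (a - \<delta>) \<le> exp (2 * s * m a) * (exp (- 2 * s * g) * \<delta>)" by (simp add: mult.assoc)
    have "flux s a \<le> L * (A a - A (a - \<delta>))" using flux_upper[OF del(1) A, of a] by (simp add: L_def)
    also have "\<dots> \<le> L * (exp (2 * s * m a) * \<rho> + exp (2 * s * m a) * (exp (- 2 * s * g) * \<delta>))"
      using 1 2 L by (intro mult_left_mono) linarith+
    also have "\<dots> = exp (2 * s * m a) * (L * \<rho> + L * \<delta> * exp (- 2 * s * g))" by (simp add: algebra_simps)
    finally have "\<phi>' s a / \<phi> s a \<le> L * \<rho> + L * \<delta> * exp (- 2 * s * g)"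
      unfolding flux_def by (simp only: mult_le_cancel_left_pos exp_gt_zero)
    then show ?case using rho(3) elim by linarith
  qed
qed

lemma log_derivative_lower:
  assumes "falls_right m b" and \<eta>: "\<eta> > 0"
  shows "eventually (\<lambda>s. \<phi>' s b / \<phi> s b \<ge> - \<eta>) at_top"
proof -
  interpret r: drift_eigenfamily "\<lambda>x. c (- x)" K "\<lambda>x. m (- x)" "\<lambda>x. - m' (- x)" "\<lambda>s x. \<phi> s (- x)" "\<lambda>s x. - \<phi>' s (- x)"
    "\<lambda>s x. - M s (- x)" "\<lambda>s x. - E s (- x)" "\<lambda>s x. - G s (- x)" C lam by (rule reflect_eigen)
  have "rises_left (\<lambda>x. m (- x)) (- b)" by (rule falls_right_reflect) fact
  from r.log_derivative_upper[OF this \<eta>] show ?thesis by (rule eventually_mono) simp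
qed

text \<open>On the plateau the weight is constant, and the energy density of \<open>\<psi>\<close>
  has the explicit antiderivative \<open>\<psi> * \<psi>' + (\<nu> - lam s) * Q\<close>, whose first
  part vanishes at both ends. Flux terms disappear at Dirichlet ends, where \<open>\<psi>\<close> is
  zero, and are controlled at Neumann ends by the bounds on the logarithmic derivative.\<close>

theorem eigenvalue_upper_plateau:
  assumes ab: "a < b" and flat: "\<And>x. x \<in> {a..b} \<Longrightarrow> m' x = 0"
    and e: "eigenfunction i j a b \<nu> \<psi> \<psi>'"
    and a: "i = Neumann \<Longrightarrow> rises_left m a" and b: "j = Neumann \<Longrightarrow> falls_right m b" and \<epsilon>: "\<epsilon> > 0"
  shows "eventually (\<lambda>s. lam s \<le> \<nu> + \<epsilon>) at_top"
proof -
  have psi: "solves_ode (\<lambda>x. c x - \<nu>) \<psi> \<psi>'" and bc: "satisfies_bc i a \<psi> \<psi>'" "satisfies_bc j b \<psi> \<psi>'"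
    and pos: "\<And>x. x \<in> {a<..<b} \<Longrightarrow> \<psi> x > 0" using e by (auto simp: eigenfunction_def)
  have "continuous_on UNIV (\<lambda>x. (\<psi> x)\<^sup>2)" by (intro continuous_intros solves_odeD(3)[OF psi])
  from DERIV_antideriv[OF this] obtain Q where Q: "\<And>x. (Q has_real_derivative (\<psi> x)\<^sup>2) (at x)" by blast
  define J where "J = Q b - Q a"
  have J: "J > 0"
  proof -
    have "Q a < Q b"
    proof (rule DERIV_pos_imp_increasing_open[OF ab])
      fix x assume "a < x" "x < b"
      then show "\<exists>y. (Q has_real_derivative y) (at x) \<and> 0 < y"
        using pos[of x] Q[of x] by (intro exI[of _ "(\<psi> x)\<^sup>2"]) auto
    qed (intro continuous_at_imp_continuous_on ballI DERIV_isCont[OF Q])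
    then show ?thesis by (simp add: J_def)
  qed
  \<comment> \<open>The summand 1 keeps the denominator positive when both ends are
    Dirichlet.\<close>
  define \<eta> where "\<eta> = \<epsilon> * J / ((\<psi> a)\<^sup>2 + (\<psi> b)\<^sup>2 + 1)"
  have p: "(\<psi> a)\<^sup>2 + (\<psi> b)\<^sup>2 + 1 > 0" by (simp add: add_nonneg_pos)
  have \<eta>: "\<eta> > 0" using \<epsilon> J p by (simp add: \<eta>_def)
  have \<eta>2: "\<eta> * ((\<psi> a)\<^sup>2 + (\<psi> b)\<^sup>2) \<le> \<epsilon> * J"
  proof -
    have "\<eta> * ((\<psi> a)\<^sup>2 + (\<psi> b)\<^sup>2) \<le> \<eta> * ((\<psi> a)\<^sup>2 + (\<psi> b)\<^sup>2 + 1)" using \<eta> by simp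
    then show ?thesis using p by (simp add: \<eta>_def)
  qed
  have ea: "eventually (\<lambda>s. \<phi>' s a / \<phi> s a * (\<psi> a)\<^sup>2 \<le> \<eta> * (\<psi> a)\<^sup>2) at_top"
  proof (cases i)
    case Neumann
    from log_derivative_upper[OF a[OF this] \<eta>] show ?thesis by eventually_elim (rule mult_right_mono, auto)
  qed (use bc(1) in simp)
  have eb: "eventually (\<lambda>s. \<phi>' s b / \<phi> s b * (\<psi> b)\<^sup>2 \<ge> - \<eta> * (\<psi> b)\<^sup>2) at_top"
  proof (cases j)
    case Neumann
    from log_derivative_lower[OF b[OF this] \<eta>] show ?thesis by eventually_elim (rule mult_right_mono, auto)
  qed (use bc(2) in simp)
  from ea eb show ?thesis
  proof eventually_elim
    case (elim s)
    define k where "k = exp (2 * s * m a)"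
    have const: "m x = m a" if x: "x \<in> {a..b}" for x
    proof (rule DERIV_isconst2[OF ab])
      show "continuous_on {a..b} m" by (intro continuous_at_imp_continuous_on ballI isCont_m)
      show "(m has_real_derivative 0) (at y)" if "a < y" "y < b" for y using DERIV_m[of y] flat[of y] that by simp
    qed (use x in auto)
    have "flux s b * (\<psi> b)\<^sup>2 - flux s a * (\<psi> a)\<^sup>2
       \<le> k * (\<psi> b * \<psi>' b + (\<nu> - lam s) * Q b) - k * (\<psi> a * \<psi>' a + (\<nu> - lam s) * Q a)"
    proof (rule picone_upper[where f = \<psi> and f' = \<psi>' and H = "\<lambda>t. k * (\<psi> t * \<psi>' t + (\<nu> - lam s) * Q t)",
          OF less_imp_le[OF ab] solves_odeD(1)[OF psi], where h = "\<lambda>t. k * ((\<psi>' t)\<^sup>2 + (c t - lam s) * (\<psi> t)\<^sup>2)"])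
      fix t assume t: "t \<in> {a..b}"
      show "((\<lambda>t. k * (\<psi> t * \<psi>' t + (\<nu> - lam s) * Q t)) has_real_derivative k * ((\<psi>' t)\<^sup>2 + (c t - lam s) * (\<psi> t)\<^sup>2)) (at t)"
      proof -
        have "((\<lambda>t. k * (\<psi> t * \<psi>' t + (\<nu> - lam s) * Q t)) has_real_derivative
            k * (\<psi>' t * \<psi>' t + (c t - \<nu>) * \<psi> t * \<psi> t + (\<nu> - lam s) * (\<psi> t)\<^sup>2)) (at t)"
          by (rule DERIV_cmult[OF DERIV_add[OF DERIV_mult[OF solves_odeD(1,2)[OF psi]] DERIV_cmult[OF Q]]])
        then show ?thesis by (rule DERIV_cong) (simp add: algebra_simps power2_eq_square)
      qed
      show "exp (2 * s * m t) * ((\<psi>' t)\<^sup>2 + (c t - lam s) * (\<psi> t)\<^sup>2) \<le> k * ((\<psi>' t)\<^sup>2 + (c t - lam s) * (\<psi> t)\<^sup>2)"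
        unfolding const[OF t] k_def by (rule order_refl)
    qed
    moreover have "\<psi> a * \<psi>' a = 0" "\<psi> b * \<psi>' b = 0" using bc by (cases i; cases j; auto)+
    moreover have "flux s b = k * (\<phi>' s b / \<phi> s b)" "flux s a = k * (\<phi>' s a / \<phi> s a)"
      using const[of b] ab by (auto simp: flux_def k_def)
    ultimately have "k * (\<phi>' s b / \<phi> s b * (\<psi> b)\<^sup>2 - \<phi>' s a / \<phi> s a * (\<psi> a)\<^sup>2) \<le> k * ((\<nu> - lam s) * J)"
      unfolding J_def by (simp add: algebra_simps)
    then have "\<phi>' s b / \<phi> s b * (\<psi> b)\<^sup>2 - \<phi>' s a / \<phi> s a * (\<psi> a)\<^sup>2 \<le> (\<nu> - lam s) * J"
      by (simp add: k_def)
    then have "- (\<epsilon> * J) \<le> (\<nu> - lam s) * J" using elim \<eta>2 by (simp add: algebra_simps)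
    then have "(lam s - \<nu>) * J \<le> \<epsilon> * J" by (simp add: algebra_simps)
    then show ?case using J by simp
  qed
qed

text \<open>If \<open>lam s > c x0 + \<epsilon>\<close>, the flux drops across the interval around
  \<open>x0\<close> by at least \<open>\<epsilon> / 2\<close> times the weight of that interval. But
  \<open>flux_upper\<close> and its reflection bound the drop by the weight on two outer ramps,
  where \<open>m\<close> is lower by a fixed gap; for large \<open>s\<close> this is a
  contradiction.\<close>

theorem eigenvalue_upper_point:
  assumes d: "d > 0" and max: "\<And>x. x \<in> {x0 - d<..<x0 + d} - {x0} \<Longrightarrow> m x < m x0" and \<epsilon>: "\<epsilon> > 0"
  shows "eventually (\<lambda>s. lam s \<le> c x0 + \<epsilon>) at_top"
proof -
  interpret r: drift_eigenfamily "\<lambda>x. c (- x)" K "\<lambda>x. m (- x)" "\<lambda>x. - m' (- x)" "\<lambda>s x. \<phi> s (- x)" "\<lambda>s x. - \<phi>' s (- x)"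
    "\<lambda>s x. - M s (- x)" "\<lambda>s x. - E s (- x)" "\<lambda>s x. - G s (- x)" C lam by (rule reflect_eigen)
  have "isCont c x0" using continuous_c by (simp add: continuous_on_eq_continuous_at)
  then obtain e where e: "e > 0" "\<And>x. \<bar>x - x0\<bar> < e \<Longrightarrow> \<bar>c x - c x0\<bar> < \<epsilon> / 2"
    unfolding continuous_at_eps_delta using \<epsilon> by (metis dist_real_def half_gt_zero real_norm_def)
  define \<delta> where "\<delta> = min d e / 3"
  have del: "\<delta> > 0" "2 * \<delta> < d" "2 * \<delta> < e" using d e by (auto simp: \<delta>_def)
  obtain g1 where g1: "g1 > 0" "\<forall>t\<in>{x0 - 2 * \<delta>..x0 - \<delta>}. m t \<le> m x0 - g1"
    using max_below[of "x0 - 2 * \<delta>" "x0 - \<delta>" "m x0"] max del by auto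
  obtain g2 where g2: "g2 > 0" "\<forall>t\<in>{x0 + \<delta>..x0 + 2 * \<delta>}. m t \<le> m x0 - g2"
    using max_below[of "x0 + \<delta>" "x0 + 2 * \<delta>" "m x0"] max del by auto
  \<comment> \<open>On the ramps \<open>m\<close> is at least \<open>g\<close> below its peak, and
    \<open>\<rho>\<close> is then chosen so that near \<open>x0\<close> it is at most
    \<open>g / 2\<close> below. The remaining \<open>g / 2\<close> drives the decay.\<close>
  define g where "g = min g1 g2"
  have g: "g > 0" using g1 g2 by (simp add: g_def)
  obtain z where z: "z > 0" "\<And>x. \<bar>x - x0\<bar> < z \<Longrightarrow> \<bar>m x - m x0\<bar> < g / 2"
    using isCont_m[of x0] g unfolding continuous_at_eps_delta by (metis dist_real_def half_gt_zero real_norm_def)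
  define \<rho> where "\<rho> = min \<delta> (z / 2)"
  have rho: "\<rho> > 0" "\<rho> \<le> \<delta>" "\<rho> < z" using del z by (auto simp: \<rho>_def)
  define L where "L = 1 / \<delta>\<^sup>2 + 2 * K"
  have L: "L \<ge> 0" using K_nonneg by (simp add: L_def)
  have "((\<lambda>s. 2 * L * \<delta> * exp (- 2 * s * (g / 2))) \<longlongrightarrow> 2 * L * \<delta> * 0) at_top"
    by (intro tendsto_mult tendsto_const exp_decay) (use g in simp)
  then have "eventually (\<lambda>s. 2 * L * \<delta> * exp (- 2 * s * (g / 2)) < \<epsilon> / 2 * \<rho>) at_top"
    by (rule order_tendstoD) (use \<epsilon> rho in simp)
  then show ?thesis using eventually_ge_at_top[of 0]
  proof eventually_elim
    case (elim s)
    show ?case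
    proof (rule ccontr)
      assume "\<not> lam s \<le> c x0 + \<epsilon>"
      then have big: "lam s > c x0 + \<epsilon>" by simp
      obtain A where A: "\<And>x. (A has_real_derivative exp (2 * s * m x)) (at x)" using weight_antideriv by blast
      have rA: "((\<lambda>x. - A (- x)) has_real_derivative exp (2 * s * m (- x))) (at x)" for x
      proof -
        have "(uminus has_real_derivative -1) (at x)" by (auto intro!: derivative_eq_intros)
        from DERIV_minus[OF DERIV_chain2[OF A this]] show ?thesis by simp
      qed
      define k where "k = exp (2 * s * (m x0 - g))"
      have 1: "flux s (x0 - \<delta>) \<le> L * (k * \<delta>)"
      proof -
        have "flux s (x0 - \<delta>) \<le> L * (A (x0 - \<delta>) - A (x0 - \<delta> - \<delta>))"
          using flux_upper[OF del(1) A, of "x0 - \<delta>"] by (simp add: L_def)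
        also have "\<dots> \<le> L * (exp (2 * s * (m x0 - g)) * ((x0 - \<delta>) - (x0 - \<delta> - \<delta>)))"
        proof (intro mult_left_mono[OF _ L] weight_diff_le A)
          fix t assume "t \<in> {x0 - \<delta> - \<delta>..x0 - \<delta>}"
          then show "m t \<le> m x0 - g" using bspec[OF g1(2), of t] by (simp add: g_def)
        qed (use del elim in simp_all)
        finally show ?thesis by (simp add: k_def)
      qed
      have 2: "- flux s (x0 + \<delta>) \<le> L * (k * \<delta>)"
      proof -
        have "r.flux s (- (x0 + \<delta>)) \<le> L * (- A (- (- (x0 + \<delta>))) - (- A (- (- (x0 + \<delta>) - \<delta>))))"
          using r.flux_upper[OF del(1) rA, of "- (x0 + \<delta>)"] unfolding L_def .
        then have "- flux s (x0 + \<delta>) \<le> L * (A (x0 + \<delta> + \<delta>) - A (x0 + \<delta>))"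
          by (simp add: r.flux_def flux_def add.commute)
        also have "\<dots> \<le> L * (exp (2 * s * (m x0 - g)) * ((x0 + \<delta> + \<delta>) - (x0 + \<delta>)))"
        proof (intro mult_left_mono[OF _ L] weight_diff_le A)
          fix t assume "t \<in> {x0 + \<delta>..x0 + \<delta> + \<delta>}"
          then show "m t \<le> m x0 - g" using bspec[OF g2(2), of t] by (simp add: g_def)
        qed (use del elim in simp_all)
        finally show ?thesis by (simp add: k_def)
      qed
      have 3: "flux s (x0 + \<delta>) - flux s (x0 - \<delta>) \<le> (- (\<epsilon> / 2)) * A (x0 + \<delta>) - (- (\<epsilon> / 2)) * A (x0 - \<delta>)"
      proof (rule deriv_le_imp_diff_le[where F = "flux s" and G = "\<lambda>t. (- (\<epsilon> / 2)) * A t", OF _ DERIV_flux])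
        fix t assume t: "t \<in> {x0 - \<delta>..x0 + \<delta>}"
        show "((\<lambda>t. (- (\<epsilon> / 2)) * A t) has_real_derivative exp (2 * s * m t) * (- (\<epsilon> / 2))) (at t)"
          by (auto intro!: derivative_eq_intros A)
        have "\<bar>t - x0\<bar> < e" using t del by auto
        then have "c t - lam s \<le> - (\<epsilon> / 2)" using e(2)[of t] big by linarith
        moreover have "(\<phi>' s t / \<phi> s t)\<^sup>2 \<ge> 0" by simp
        ultimately have "c t - lam s - (\<phi>' s t / \<phi> s t)\<^sup>2 \<le> - (\<epsilon> / 2)" by linarith
        then show "exp (2 * s * m t) * (c t - lam s - (\<phi>' s t / \<phi> s t)\<^sup>2) \<le> exp (2 * s * m t) * (- (\<epsilon> / 2))"
          by (rule mult_left_mono) simp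
      qed (use del in simp)
      have 4: "exp (2 * s * (m x0 - g / 2)) * \<rho> \<le> A (x0 + \<delta>) - A (x0 - \<delta>)"
      proof -
        have "A (x0 + \<rho>) - A x0 \<ge> exp (2 * s * (m x0 - g / 2)) * (x0 + \<rho> - x0)"
        proof (rule weight_diff_ge[OF A])
          fix t assume "t \<in> {x0..x0 + \<rho>}"
          then have "\<bar>t - x0\<bar> < z" using rho by auto
          then show "m x0 - g / 2 \<le> m t" using z(2)[of t] by linarith
        qed (use rho elim in auto)
        moreover have mono: "A x \<le> A y" if "x \<le> y" for x y
          by (rule DERIV_nonneg_imp_nondecreasing[OF that]) (use A in force)
        have "A (x0 + \<rho>) \<le> A (x0 + \<delta>)" "A (x0 - \<delta>) \<le> A x0" using rho del by (auto intro!: mono)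
        ultimately show ?thesis by simp
      qed
      have "\<epsilon> / 2 * (exp (2 * s * (m x0 - g / 2)) * \<rho>) \<le> \<epsilon> / 2 * (A (x0 + \<delta>) - A (x0 - \<delta>))"
        by (rule mult_left_mono[OF 4]) (use \<epsilon> in simp)
      also have "\<dots> \<le> 2 * (L * (k * \<delta>))" using 1 2 3 by (simp add: right_diff_distrib)
      also have "k = exp (2 * s * (m x0 - g / 2)) * exp (- 2 * s * (g / 2))"
        unfolding k_def by (simp add: algebra_simps flip: exp_add)
      finally have "exp (2 * s * (m x0 - g / 2)) * (\<epsilon> / 2 * \<rho>) \<le> exp (2 * s * (m x0 - g / 2)) * (2 * L * \<delta> * exp (- 2 * s * (g / 2)))"
        by (simp add: mult_ac)
      then have "\<epsilon> / 2 * \<rho> \<le> 2 * L * \<delta> * exp (- 2 * s * (g / 2))" by simp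
      then show False using elim by linarith
    qed
  qed
qed

end

section \<open>The eigenvalue problem on the circle\<close>

locale periodic_drift =
  fixes m c :: "real \<Rightarrow> real"
  assumes C2_m: "C2_with UNIV m (deriv m) (deriv (deriv m))"
    and cont_c: "continuous_on UNIV c"
    and m_periodic: "m (x + 1) = m x"
    and c_periodic: "c (x + 1) = c x"
begin

lemma DERIV_m: "(m has_real_derivative deriv m x) (at x)"
  and DERIV_m': "(deriv m has_real_derivative deriv (deriv m) x) (at x)"
  and cont_m'': "continuous_on UNIV (deriv (deriv m))"
  using C2_m by (auto simp: C2_with_def)

lemma isCont_m: "isCont m x" and isCont_m': "isCont (deriv m) x"
  using DERIV_m DERIV_m' DERIV_isCont by blast+

lemma DERIV_periodic:
  fixes f f' :: "real \<Rightarrow> real"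
  assumes f: "\<And>x. (f has_real_derivative f' x) (at x)" and per: "\<And>x. f (x + 1) = f x"
  shows "f' (x + 1) = f' x"
proof -
  have "((\<lambda>x. x + 1) has_real_derivative 1) (at x)" by (auto intro!: derivative_eq_intros)
  from DERIV_chain2[OF f this] have "(f has_real_derivative f' (x + 1)) (at x)" by (simp add: per)
  then show ?thesis using f DERIV_unique by blast
qed

lemma m'_periodic: "deriv m (x + 1) = deriv m x"
  by (rule DERIV_periodic[OF DERIV_m m_periodic])

lemma m''_periodic: "deriv (deriv m) (x + 1) = deriv (deriv m) x"
  by (rule DERIV_periodic[OF DERIV_m' m'_periodic])

definition eigenpair :: "real \<Rightarrow> real \<Rightarrow> (real \<Rightarrow> real) \<Rightarrow> (real \<Rightarrow> real) \<Rightarrow> bool" where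
  "eigenpair s l \<phi> \<phi>' \<longleftrightarrow> (\<forall>x. (\<phi> has_real_derivative \<phi>' x) (at x) \<and>
     (\<phi>' has_real_derivative (c x - l) * \<phi> x - 2 * s * deriv m x * \<phi>' x) (at x) \<and> \<phi> x > 0 \<and> \<phi> (x + 1) = \<phi> x)"

lemma eigenpairD:
  assumes "eigenpair s l \<phi> \<phi>'"
  shows "(\<phi> has_real_derivative \<phi>' x) (at x)"
    "(\<phi>' has_real_derivative (c x - l) * \<phi> x - 2 * s * deriv m x * \<phi>' x) (at x)"
    "\<phi> x > 0" "\<phi> (x + 1) = \<phi> x" "\<phi>' (x + 1) = \<phi>' x" "isCont \<phi> x" "isCont \<phi>' x"
proof -
  show *: "(\<phi> has_real_derivative \<phi>' x) (at x)"
    "(\<phi>' has_real_derivative (c x - l) * \<phi> x - 2 * s * deriv m x * \<phi>' x) (at x)"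
    "\<phi> x > 0" "\<phi> (x + 1) = \<phi> x" for x using assms by (auto simp: eigenpair_def)
  show "\<phi>' (x + 1) = \<phi>' x" by (rule DERIV_periodic[OF *(1) *(4)])
  show "isCont \<phi> x" "isCont \<phi>' x" using *(1,2)[of x] DERIV_isCont by blast+
qed

text \<open>The substitution \<open>y = e\<^sup>s\<^sup>m \<phi>\<close> removes the first order term and leads to Hill's equation with
  potential \<open>s m'' + s\<^sup>2 m'\<^sup>2 + c\<close>.\<close>

lemma eigenpair_exists: "\<exists>l \<phi> \<phi>'. eigenpair s l \<phi> \<phi>'"
proof -
  define V where "V x = s * deriv (deriv m) x + s\<^sup>2 * (deriv m x)\<^sup>2 + c x" for x
  have V: "continuous_on UNIV V" unfolding V_def
    by (intro continuous_intros cont_m'' cont_c continuous_at_imp_continuous_on ballI isCont_m')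
  have Vp: "V (x + 1) = V x" for x by (simp add: V_def m'_periodic m''_periodic c_periodic)
  obtain K where "\<And>x. \<bar>V x\<bar> \<le> K" using periodic_bounded[OF V Vp] by blast
  then interpret bounded_potential V K by unfold_locales (rule V)
  obtain \<nu> y y' where y: "solves_ode (\<lambda>x. V x - \<nu>) y y'" "\<And>x. y x > 0" "\<And>x. y (x + 1) = y x"
    using periodic_solution_exists[OF Vp] by blast
  define e where "e x = exp (- s * m x)" for x
  have e: "(e has_real_derivative - s * deriv m x * e x) (at x)" for x
    unfolding e_def by (auto intro!: derivative_eq_intros DERIV_m)
  have "eigenpair s \<nu> (\<lambda>x. e x * y x) (\<lambda>x. e x * (y' x - s * deriv m x * y x))"
    unfolding eigenpair_def
  proof (intro allI conjI)
    fix x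
    show "((\<lambda>x. e x * y x) has_real_derivative e x * (y' x - s * deriv m x * y x)) (at x)"
      by (rule DERIV_cong[OF DERIV_mult[OF e solves_odeD(1)[OF y(1)]]]) (simp add: algebra_simps)
    show "((\<lambda>x. e x * (y' x - s * deriv m x * y x)) has_real_derivative
        (c x - \<nu>) * (e x * y x) - 2 * s * deriv m x * (e x * (y' x - s * deriv m x * y x))) (at x)"
      by (rule DERIV_cong[OF DERIV_mult[OF e DERIV_diff[OF solves_odeD(2)[OF y(1)]
          DERIV_mult[OF DERIV_cmult[OF DERIV_m'] solves_odeD(1)[OF y(1)]]]]])
         (simp add: V_def algebra_simps power2_eq_square)
    show "e x * y x > 0" using y(2)[of x] by (simp add: e_def)
    show "e (x + 1) * y (x + 1) = e x * y x" using y(3)[of x] by (simp add: e_def m_periodic)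
  qed
  then show ?thesis by blast
qed

lemma DERIV_weight: "((\<lambda>x. exp (2 * s * m x)) has_real_derivative 2 * s * deriv m x * exp (2 * s * m x)) (at x)"
  by (auto intro!: derivative_eq_intros DERIV_m)

text \<open>The weight \<open>exp (2 * s * m x)\<close> removes the drift from the Wronskian, which
  would be strictly increasing if \<open>l < k\<close>, yet takes equal values at 0 and 1.\<close>

lemma eigenvalue_not_less:
  assumes f: "eigenpair s l f f'" and g: "eigenpair s k g g'"
  shows "\<not> l < k"
proof
  assume "l < k"
  define W where "W x = exp (2 * s * m x) * (f' x * g x - f x * g' x)" for x
  have "W 0 < W 1"
  proof (rule DERIV_pos_imp_increasing[OF zero_less_one], intro exI conjI)
    fix x :: real
    have "((\<lambda>x. f' x * g x - f x * g' x) has_real_derivative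
        ((c x - l) * f x - 2 * s * deriv m x * f' x) * g x + g' x * f' x -
        (f' x * g' x + ((c x - k) * g x - 2 * s * deriv m x * g' x) * f x)) (at x)"
      by (rule DERIV_diff[OF DERIV_mult[OF eigenpairD(2)[OF f] eigenpairD(1)[OF g]]
        DERIV_mult[OF eigenpairD(1)[OF f] eigenpairD(2)[OF g]]])
    from DERIV_mult[OF DERIV_weight this]
    show "(W has_real_derivative exp (2 * s * m x) * ((k - l) * (f x * g x))) (at x)"
      unfolding W_def by (rule DERIV_cong) (simp add: algebra_simps)
    show "0 < exp (2 * s * m x) * ((k - l) * (f x * g x))"
      using \<open>l < k\<close> eigenpairD(3)[OF f, of x] eigenpairD(3)[OF g, of x] by simp
  qed
  moreover have "W 1 = W 0"
    using m_periodic[of 0] eigenpairD(4,5)[OF f, of 0] eigenpairD(4,5)[OF g, of 0] by (simp add: W_def)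
  ultimately show False by simp
qed

lemma periodic_principal_eigenvalue_eq:
  assumes e: "eigenpair s l \<phi> \<phi>'"
  shows "periodic_principal_eigenvalue m c s = l"
  unfolding periodic_principal_eigenvalue_def
proof (rule the_equality)
  define \<phi>'' where "\<phi>'' x = (c x - l) * \<phi> x - 2 * s * deriv m x * \<phi>' x" for x
  have "continuous_on UNIV \<phi>''" unfolding \<phi>''_def
    by (intro continuous_intros cont_c continuous_at_imp_continuous_on[of UNIV \<phi>]
        continuous_at_imp_continuous_on[of UNIV \<phi>'] continuous_at_imp_continuous_on[of UNIV "deriv m"]
        ballI isCont_m' eigenpairD(6,7)[OF e])
  then have "C2_with UNIV \<phi> \<phi>' \<phi>''"
    using eigenpairD(1,2)[OF e] by (simp add: C2_with_def \<phi>''_def)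
  then show "\<exists>\<phi> \<phi>' \<phi>''. C2_with UNIV \<phi> \<phi>' \<phi>'' \<and>
        (\<forall>x. \<phi> x = \<phi> (x + 1)) \<and> (\<forall>x. \<phi> x > 0) \<and>
        (\<forall>x. - \<phi>'' x - 2 * s * deriv m x * \<phi>' x + c x * \<phi> x = l * \<phi> x)"
    using eigenpairD(3,4)[OF e]
    by (intro exI[of _ \<phi>] exI[of _ \<phi>'] exI[of _ \<phi>'']) (simp add: \<phi>''_def algebra_simps)
next
  fix k assume "\<exists>\<phi> \<phi>' \<phi>''. C2_with UNIV \<phi> \<phi>' \<phi>'' \<and>
        (\<forall>x. \<phi> x = \<phi> (x + 1)) \<and> (\<forall>x. \<phi> x > 0) \<and>
        (\<forall>x. - \<phi>'' x - 2 * s * deriv m x * \<phi>' x + c x * \<phi> x = k * \<phi> x)"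
  then obtain g g' g'' where g: "C2_with UNIV g g' g''" "\<forall>x. g x = g (x + 1)" "\<forall>x. g x > 0"
      "\<forall>x. - g'' x - 2 * s * deriv m x * g' x + c x * g x = k * g x" by (elim exE conjE) (rule that)
  have "g'' x = (c x - k) * g x - 2 * s * deriv m x * g' x" for x
    using g(4)[rule_format, of x] by (simp add: algebra_simps)
  then have "eigenpair s k g g'"
    using g(1-3) unfolding eigenpair_def C2_with_def by simp
  then show "k = l" using eigenvalue_not_less[OF e] eigenvalue_not_less[OF _ e] by (meson linorder_neqE)
qed

text \<open>A function with equal values at 0 and 1 is not strictly monotone: for
  \<open>l > K\<close> the weighted logarithmic derivative would decrease, for
  \<open>l < - K\<close> the weighted derivative would increase.\<close>

lemma eigenvalue_bounded:
  assumes e: "eigenpair s l \<phi> \<phi>'" and K: "\<And>x. \<bar>c x\<bar> \<le> K"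
  shows "\<bar>l\<bar> \<le> K"
proof -
  have "\<not> K < l"
  proof
    assume "K < l"
    define B where "B x = exp (2 * s * m x) * (\<phi>' x / \<phi> x)" for x
    have "B 1 < B 0"
    proof (rule DERIV_neg_imp_decreasing[OF zero_less_one], intro exI conjI)
      fix x :: real
      have nz: "\<phi> x \<noteq> 0" using eigenpairD(3)[OF e, of x] by simp
      have "(B has_real_derivative 2 * s * deriv m x * exp (2 * s * m x) * (\<phi>' x / \<phi> x) +
          (((c x - l) * \<phi> x - 2 * s * deriv m x * \<phi>' x) * \<phi> x - \<phi>' x * \<phi>' x) / (\<phi> x * \<phi> x) * exp (2 * s * m x)) (at x)"
        unfolding B_def by (rule DERIV_mult[OF DERIV_weight DERIV_divide[OF eigenpairD(2,1)[OF e] nz]])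
      then show "(B has_real_derivative exp (2 * s * m x) * (c x - l - (\<phi>' x / \<phi> x)\<^sup>2)) (at x)"
        by (rule DERIV_cong) (use nz in \<open>simp add: field_simps power2_eq_square\<close>)
      have "c x - l < 0" using K[of x] \<open>K < l\<close> by linarith
      moreover have "(\<phi>' x / \<phi> x)\<^sup>2 \<ge> 0" by simp
      ultimately have "c x - l - (\<phi>' x / \<phi> x)\<^sup>2 < 0" by linarith
      then show "exp (2 * s * m x) * (c x - l - (\<phi>' x / \<phi> x)\<^sup>2) < 0" by (simp add: mult_pos_neg)
    qed
    moreover have "B 1 = B 0" using m_periodic[of 0] eigenpairD(4,5)[OF e, of 0] by (simp add: B_def)
    ultimately show False by simp
  qed
  moreover have "\<not> l < - K"
  proof
    assume "l < - K"
    define B where "B x = exp (2 * s * m x) * \<phi>' x" for x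
    have "B 0 < B 1"
    proof (rule DERIV_pos_imp_increasing[OF zero_less_one], intro exI conjI)
      fix x :: real
      show "(B has_real_derivative exp (2 * s * m x) * ((c x - l) * \<phi> x)) (at x)"
        unfolding B_def
        by (rule DERIV_cong[OF DERIV_mult[OF DERIV_weight eigenpairD(2)[OF e]]]) (simp add: algebra_simps)
      have "c x - l > 0" using K[of x] \<open>l < - K\<close> by linarith
      then show "0 < exp (2 * s * m x) * ((c x - l) * \<phi> x)" using eigenpairD(3)[OF e, of x] by simp
    qed
    moreover have "B 1 = B 0" using m_periodic[of 0] eigenpairD(5)[OF e, of 0] by (simp add: B_def)
    ultimately show False by simp
  qed
  ultimately show ?thesis by linarith
qed

lemma antideriv_increment:
  assumes A: "\<And>x. (A has_real_derivative f x) (at x)" and per: "\<And>x. f (x + 1) = f x"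
  shows "A (x + 1) - A x = A 1 - A (0::real)"
proof -
  have "\<forall>x. ((\<lambda>x. A (x + 1) - A x) has_real_derivative 0) (at x)"
  proof
    fix x
    have "((\<lambda>x. x + 1) has_real_derivative 1) (at x)" by (auto intro!: derivative_eq_intros)
    from DERIV_diff[OF DERIV_chain2[OF A this] A]
    show "((\<lambda>x. A (x + 1) - A x) has_real_derivative 0) (at x)" by (simp add: per)
  qed
  from DERIV_isconst_all[OF this, of x 0] show ?thesis by simp
qed

lemma normalised_eigenpair_exists:
  "\<exists>\<phi> \<phi>' M. eigenpair s (periodic_principal_eigenvalue m c s) \<phi> \<phi>' \<and>
    (\<forall>x. (M has_real_derivative exp (2 * s * m x) * (\<phi> x)\<^sup>2) (at x)) \<and> (\<forall>x. M (x + 1) - M x = 1)"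
proof -
  obtain l f f' where f: "eigenpair s l f f'" using eigenpair_exists by blast
  have l: "periodic_principal_eigenvalue m c s = l" by (rule periodic_principal_eigenvalue_eq[OF f])
  have "continuous_on UNIV (\<lambda>x. exp (2 * s * m x) * (f x)\<^sup>2)"
    by (intro continuous_intros continuous_at_imp_continuous_on ballI isCont_m eigenpairD(6)[OF f])
  from DERIV_antideriv[OF this] obtain A where A: "\<And>x. (A has_real_derivative exp (2 * s * m x) * (f x)\<^sup>2) (at x)"
    by blast
  define N where "N = A 1 - A 0"
  have N: "N > 0"
  proof -
    have "A 0 < A 1"
    proof (rule DERIV_pos_imp_increasing[OF zero_less_one], intro exI conjI)
      fix x :: real show "0 < exp (2 * s * m x) * (f x)\<^sup>2" using eigenpairD(3)[OF f, of x] by simp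
    qed (rule A)
    then show ?thesis by (simp add: N_def)
  qed
  define k where "k = 1 / sqrt N"
  have k: "k > 0" "k\<^sup>2 * N = 1" using N by (auto simp: k_def power_divide)
  have inc: "A (x + 1) - A x = N" for x
    unfolding N_def by (rule antideriv_increment[OF A]) (simp add: m_periodic eigenpairD(4)[OF f])
  have "eigenpair s l (\<lambda>x. k * f x) (\<lambda>x. k * f' x)"
    unfolding eigenpair_def
  proof (intro allI conjI)
    fix x
    show "((\<lambda>x. k * f' x) has_real_derivative (c x - l) * (k * f x) - 2 * s * deriv m x * (k * f' x)) (at x)"
      by (rule DERIV_cong[OF DERIV_cmult[OF eigenpairD(2)[OF f]]]) (simp add: algebra_simps)
  qed (use k eigenpairD(3,4)[OF f] DERIV_cmult[OF eigenpairD(1)[OF f]] in simp_all)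
  moreover have "((\<lambda>x. k\<^sup>2 * A x) has_real_derivative exp (2 * s * m x) * (k * f x)\<^sup>2) (at x)" for x
    by (rule DERIV_cong[OF DERIV_cmult[OF A]]) (simp add: power_mult_distrib)
  moreover have "k\<^sup>2 * A (x + 1) - k\<^sup>2 * A x = 1" for x
    using inc[of x] k(2) by (simp flip: right_diff_distrib)
  ultimately show ?thesis unfolding l
    by (intro exI[of _ "\<lambda>x. k * f x"] exI[of _ "\<lambda>x. k * f' x"] exI[of _ "\<lambda>x. k\<^sup>2 * A x"]) simp
qed

lemma drift_eigenfamily_exists:
  "\<exists>K \<phi> \<phi>' M E G C. drift_eigenfamily c K m (deriv m) \<phi> \<phi>' M E G C (periodic_principal_eigenvalue m c)"
proof -
  obtain K where K: "\<And>x. \<bar>c x\<bar> \<le> K" using periodic_bounded[OF cont_c c_periodic] by blast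
  let ?l = "periodic_principal_eigenvalue m c"
  have "\<forall>s. \<exists>p. eigenpair s (?l s) (fst p) (fst (snd p)) \<and>
    (\<forall>x. (snd (snd p) has_real_derivative exp (2 * s * m x) * (fst p x)\<^sup>2) (at x)) \<and>
    (\<forall>x. snd (snd p) (x + 1) - snd (snd p) x = 1)"
    using normalised_eigenpair_exists by simp
  then obtain p where p: "\<forall>s. eigenpair s (?l s) (fst (p s)) (fst (snd (p s))) \<and>
    (\<forall>x. (snd (snd (p s)) has_real_derivative exp (2 * s * m x) * (fst (p s) x)\<^sup>2) (at x)) \<and>
    (\<forall>x. snd (snd (p s)) (x + 1) - snd (snd (p s)) x = 1)"
    unfolding choice_iff by (elim exE)
  define \<phi> \<phi>' M where "\<phi> s = fst (p s)" and "\<phi>' s = fst (snd (p s))" and "M s = snd (snd (p s))" for s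
  have e: "eigenpair s (?l s) (\<phi> s) (\<phi>' s)"
    and M: "(M s has_real_derivative exp (2 * s * m x) * (\<phi> s x)\<^sup>2) (at x)" "M s (x + 1) - M s x = 1" for s x
    using p by (simp_all add: \<phi>_def \<phi>'_def M_def)
  define E where "E s = antideriv (\<lambda>x. exp (2 * s * m x) * (\<phi>' s x)\<^sup>2)" for s
  define G where "G s = antideriv (\<lambda>x. c x * (exp (2 * s * m x) * (\<phi> s x)\<^sup>2))" for s
  have E: "(E s has_real_derivative exp (2 * s * m x) * (\<phi>' s x)\<^sup>2) (at x)" for s x
    unfolding E_def
    by (intro DERIV_antideriv continuous_intros continuous_at_imp_continuous_on ballI isCont_m eigenpairD(7)[OF e])
  have G: "(G s has_real_derivative c x * (exp (2 * s * m x) * (\<phi> s x)\<^sup>2)) (at x)" for s x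
    unfolding G_def
    by (intro DERIV_antideriv continuous_on_mult cont_c continuous_intros continuous_at_imp_continuous_on ballI isCont_m eigenpairD(6)[OF e])
  have energy: "E s (x + 1) - E s x + (G s (x + 1) - G s x) = ?l s" for s x
  proof -
    \<comment> \<open>Integration by parts of the equation against the weighted eigenfunction,
      written as a function with zero derivative; its boundary term is periodic and drops out over a
      period.\<close>
    have "\<forall>x. ((\<lambda>x. E s x + G s x - ?l s * M s x - exp (2 * s * m x) * (\<phi> s x * \<phi>' s x)) has_real_derivative 0) (at x)"
      by (rule allI, rule DERIV_cong[OF DERIV_diff[OF DERIV_diff[OF DERIV_add[OF E G] DERIV_cmult[OF M(1)]]
          DERIV_mult[OF DERIV_weight DERIV_mult[OF eigenpairD(1,2)[OF e]]]]])
         (simp add: algebra_simps power2_eq_square)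
    from DERIV_isconst_all[OF this, of "x + 1" x]
    have "E s (x + 1) - E s x + (G s (x + 1) - G s x) = ?l s * (M s (x + 1) - M s x)"
      using eigenpairD(4,5)[OF e, of s x] by (simp add: m_periodic right_diff_distrib)
    then show ?thesis by (simp add: M(2))
  qed
  \<comment> \<open>One \<open>K\<close> bounds the eigenvalue, the other the negative potential
    energy of unit mass.\<close>
  have "E s (x + 1) - E s x \<le> 2 * K" for s x
  proof -
    have "(- K) * M s (x + 1) - (- K) * M s x \<le> G s (x + 1) - G s x"
    proof (rule deriv_le_imp_diff_le[OF _ DERIV_cmult[OF M(1)] G])
      fix t show "- K * (exp (2 * s * m t) * (\<phi> s t)\<^sup>2) \<le> c t * (exp (2 * s * m t) * (\<phi> s t)\<^sup>2)"
        using K[of t] by (intro mult_right_mono) auto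
    qed simp
    moreover have "(- K) * M s (x + 1) - (- K) * M s x = - K"
      using M(2)[of s x] by (simp add: algebra_simps)
    moreover have "?l s \<le> K" using eigenvalue_bounded[OF e K, of s] by linarith
    ultimately show ?thesis using energy[of s x] by linarith
  qed
  moreover have "E s 1 - E s 0 + (G s 1 - G s 0) = ?l s" "E s 0 - E s (- 1) + (G s 0 - G s (- 1)) = ?l s" for s
    using energy[of s 0] energy[of s "- 1"] by simp_all
  ultimately have "drift_eigenfamily c K m (deriv m) \<phi> \<phi>' M E G (2 * K) ?l"
    by unfold_locales (rule cont_c K DERIV_m eigenpairD[OF e] E G M eigenvalue_bounded[OF e K] | assumption)+
  then show ?thesis by blast
qed

end

subsection \<open>Points and segments of local maximum\<close>

text \<open>\<open>X\<close> collects the end points of the covering intervals. A member of the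
  cover that contains the midpoint of (p,q) has no end point inside (p,q), so it contains all of
  [p,q].\<close>

lemma sign_partition:
  assumes "finitely_many_sign_changes g"
  shows "\<exists>X. finite X \<and> (\<forall>p q. 0 \<le> p \<and> p < q \<and> q \<le> 1 \<and> {p<..<q} \<inter> X = {} \<longrightarrow>
    (\<forall>x\<in>{p..q}. g x \<ge> 0) \<or> (\<forall>x\<in>{p..q}. g x \<le> 0))"
proof -
  obtain \<I> where fin: "finite \<I>" and un: "\<Union>\<I> = {0..1}"
    and I: "\<And>I. I \<in> \<I> \<Longrightarrow> \<exists>u v. u \<le> v \<and> I = {u..v}"
      "\<And>I. I \<in> \<I> \<Longrightarrow> (\<forall>x\<in>I. g x \<ge> 0) \<or> (\<forall>x\<in>I. g x \<le> 0)"
    using assms unfolding finitely_many_sign_changes_def by (elim exE conjE) (rule that, assumption+, blast+)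
  define X where "X = Inf ` \<I> \<union> Sup ` \<I>"
  have "(\<forall>x\<in>{p..q}. g x \<ge> 0) \<or> (\<forall>x\<in>{p..q}. g x \<le> 0)"
    if pq: "0 \<le> p" "p < q" "q \<le> 1" "{p<..<q} \<inter> X = {}" for p q
  proof -
    have "(p + q) / 2 \<in> \<Union>\<I>" using pq by (simp add: un)
    then obtain J where J: "J \<in> \<I>" "(p + q) / 2 \<in> J" by blast
    obtain u v where uv: "u \<le> v" "J = {u..v}" using I(1)[OF J(1)] by blast
    have "u \<in> X" "v \<in> X" using J(1) uv by (auto simp: X_def intro!: rev_image_eqI[of J])
    then have "u \<notin> {p<..<q}" "v \<notin> {p<..<q}" using pq(4) by auto
    moreover have "u \<le> (p + q) / 2" "(p + q) / 2 \<le> v" using J(2) uv by auto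
    ultimately have "{p..q} \<subseteq> J" using pq(2) by (auto simp: uv)
    then show ?thesis using I(2)[OF J(1)] by blast
  qed
  then show ?thesis using fin by (intro exI[of _ X]) (auto simp: X_def)
qed

text \<open>Applied with \<open>a = b\<close> around a point and with \<open>a < b\<close> around a
  segment.\<close>

lemma finite_gap:
  fixes X :: "real set"
  assumes "finite X"
  shows "\<exists>d>0. \<forall>x\<in>X. (x < a \<longrightarrow> x \<le> a - d) \<and> (x > b \<longrightarrow> x \<ge> b + d)"
  using assms
proof induction
  case empty
  then show ?case by (intro exI[of _ 1]) simp
next
  case (insert y X)
  then obtain d where d: "d > 0" "\<forall>x\<in>X. (x < a \<longrightarrow> x \<le> a - d) \<and> (x > b \<longrightarrow> x \<ge> b + d)" by blast
  define e where "e = min d (min (if y < a then a - y else 1) (if y > b then y - b else 1))"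
  have e: "e > 0" "e \<le> d" "y < a \<Longrightarrow> e \<le> a - y" "y > b \<Longrightarrow> e \<le> y - b" using d(1) by (auto simp: e_def)
  show ?case
  proof (intro exI[of _ e] conjI ballI)
    fix x assume "x \<in> insert y X"
    then show "x < a \<longrightarrow> x \<le> a - e" "x > b \<longrightarrow> x \<ge> b + e" using d(2) e by fastforce+
  qed fact
qed

text \<open>The end points are included, since a two-sided derivative is determined by the
  increments to either side. This is what rules out segments that touch 0 or 1.\<close>

lemma deriv_zero_of_flat:
  fixes f :: "real \<Rightarrow> real"
  assumes f: "\<And>x. (f has_real_derivative f' x) (at x)" and pq: "p < q" and flat: "\<And>x. x \<in> {p..q} \<Longrightarrow> f x = k"
    and x: "x \<in> {p..q}"
  shows "f' x = 0"
proof -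
  define y where "y = (p + q) / 2"
  have zero: "f' z = 0" if "z \<in> {p<..<q}" for z
  proof (rule DERIV_local_const[OF f])
    show "0 < min (z - p) (q - z)" using that by simp
    show "\<forall>y. \<bar>z - y\<bar> < min (z - p) (q - z) \<longrightarrow> f z = f y"
      using flat that by (auto simp: abs_if split: if_splits)
  qed
  show ?thesis
  proof (cases "x < q")
    case True
    show ?thesis
    proof (rule ccontr)
      assume "f' x \<noteq> 0"
      then consider "f' x > 0" | "f' x < 0" by linarith
      then obtain d where d: "d > 0" "\<And>h. 0 < h \<Longrightarrow> h < d \<Longrightarrow> f (x + h) \<noteq> f x"
        using DERIV_pos_inc_right[OF f, of x] DERIV_neg_dec_right[OF f, of x] by cases (metis less_irrefl)+
      define h where "h = min d (q - x) / 2"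
      have "0 < h" "h < d" "x + h \<le> q" using d(1) True by (auto simp: h_def min_def field_simps)
      then show False using d(2)[of h] flat[of x] flat[of "x + h"] x by auto
    qed
  next
    case False
    then have xq: "x = q" using x by simp
    show ?thesis
    proof (rule ccontr)
      assume "f' x \<noteq> 0"
      then consider "f' x > 0" | "f' x < 0" by linarith
      then obtain d where d: "d > 0" "\<And>h. 0 < h \<Longrightarrow> h < d \<Longrightarrow> f (x - h) \<noteq> f x"
        using DERIV_pos_inc_left[OF f, of x] DERIV_neg_dec_left[OF f, of x] by cases (metis less_irrefl)+
      define h where "h = min d (q - p) / 2"
      have "0 < h" "h < d" "p \<le> x - h" using d(1) xq pq by (auto simp: h_def min_def field_simps)
      then show False using d(2)[of h] flat[of x] flat[of "x - h"] xq pq by auto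
    qed
  qed
qed

lemma flat_of_monotone:
  fixes f :: "real \<Rightarrow> real"
  assumes "mono_on {p..q} f \<or> antimono_on {p..q} f" "f p = f q" "x \<in> {p..q}"
  shows "f x = f p"
proof -
  have pq: "p \<le> q" using assms(3) by simp
  show ?thesis using assms(1)
  proof
    assume "mono_on {p..q} f"
    from monotone_onD[OF this, of p x] monotone_onD[OF this, of x q] assms(2,3) pq show ?thesis by simp
  next
    assume "antimono_on {p..q} f"
    from monotone_onD[OF this, of p x] monotone_onD[OF this, of x q] assms(2,3) pq show ?thesis by simp
  qed
qed

text \<open>\<open>a\<close> is the supremum of the points of [p,T] where \<open>f\<close> differs
  from \<open>f T\<close>. The nonzero derivative at \<open>p\<close> makes this set nonempty and
  keeps \<open>a\<close> away from \<open>p\<close>; a derivative vanishing throughout just left of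
  \<open>a\<close> would make the supremum smaller.\<close>

lemma left_end_of_flat:
  fixes f :: "real \<Rightarrow> real"
  assumes f: "\<And>x. (f has_real_derivative f' x) (at x)" and p: "p < T" "f' p \<noteq> 0"
  shows "\<exists>a. p < a \<and> a \<le> T \<and> (\<forall>x\<in>{a..T}. f x = f T) \<and> (\<forall>d>0. \<exists>x\<in>{a - d<..<a}. f' x \<noteq> 0)"
proof -
  have cont: "isCont f x" for x using f DERIV_isCont by blast
  define N where "N = {y \<in> {p..T}. f y \<noteq> f T}"
  have N: "N \<noteq> {}" using deriv_zero_of_flat[OF f p(1), of "f T" p] p by (auto simp: N_def)
  have bdd: "bdd_above N" by (rule bdd_aboveI[of _ T]) (simp add: N_def)
  define a where "a = Sup N"
  have aT: "a \<le> T" unfolding a_def by (rule cSup_least[OF N]) (simp add: N_def)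
  obtain n where "n \<in> N" using N by blast
  then have pa: "p \<le> a" using cSup_upper[OF _ bdd, of n] by (simp add: a_def N_def)
  have after: "f y = f T" if "a < y" "y \<le> T" for y
  proof (rule ccontr)
    assume "f y \<noteq> f T"
    then have "y \<in> N" using that pa by (simp add: N_def)
    then have "y \<le> a" unfolding a_def by (rule cSup_upper[OF _ bdd])
    then show False using that by simp
  qed
  have fa: "f a = f T"
  proof (cases "a = T")
    case False
    then have "a < T" using aT by simp
    have "f a - f T \<ge> 0"
    proof (rule nonneg_at_left_end[where f = "\<lambda>x. f x - f T" and a = a and p = T])
      show "isCont (\<lambda>x. f x - f T) a" by (intro continuous_diff cont continuous_const)
      show "f x - f T \<ge> 0" if "x \<in> {a<..<T}" for x using after[of x] that by simp
    qed fact
    moreover have "f T - f a \<ge> 0"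
    proof (rule nonneg_at_left_end[where f = "\<lambda>x. f T - f x" and a = a and p = T])
      show "isCont (\<lambda>x. f T - f x) a" by (intro continuous_diff cont continuous_const)
      show "f T - f x \<ge> 0" if "x \<in> {a<..<T}" for x using after[of x] that by simp
    qed fact
    ultimately show ?thesis by simp
  qed simp
  have flat: "f x = f T" if "x \<in> {a..T}" for x using after[of x] fa that by (cases "x = a") auto
  have "p < a"
  proof (rule ccontr)
    assume "\<not> p < a"
    then have "p = a" using pa by simp
    have "f' p = 0" by (rule deriv_zero_of_flat[OF f p(1) flat]) (use p \<open>p = a\<close> in simp_all)
    then show False using p by simp
  qed
  moreover have "\<exists>x\<in>{a - d<..<a}. f' x \<noteq> 0" if "d > 0" for d
  proof (rule ccontr)
    assume n: "\<not> (\<exists>x\<in>{a - d<..<a}. f' x \<noteq> 0)"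
    define z where "z = a - d / 2"
    have z: "z < a" "z > a - d" using \<open>d > 0\<close> by (auto simp: z_def)
    have near: "f y = f T" if y: "z \<le> y" "y \<le> a" for y
    proof (cases "y = a")
      case False
      then have "y < a" using y by simp
      then obtain t where t: "y < t" "t < a" "f a - f y = (a - y) * f' t" using MVT2[of y a f f'] f by blast
      then have "f' t = 0" using n y z by auto
      then show ?thesis using t(3) fa by simp
    qed (use fa in simp)
    have "y \<le> z" if "y \<in> N" for y using after[of y] near[of y] that by (cases "y \<le> z"; cases "y \<le> a") (auto simp: N_def)
    then have "a \<le> z" unfolding a_def by (rule cSup_least[OF N])
    then show False using z by simp
  qed
  ultimately show ?thesis using aT flat by blast
qed

lemma right_end_of_flat:
  fixes f :: "real \<Rightarrow> real"
  assumes f: "\<And>x. (f has_real_derivative f' x) (at x)" and p: "T < p" "f' p \<noteq> 0"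
  shows "\<exists>b. T \<le> b \<and> b < p \<and> (\<forall>x\<in>{T..b}. f x = f T) \<and> (\<forall>d>0. \<exists>x\<in>{b<..<b + d}. f' x \<noteq> 0)"
proof -
  have "(uminus has_real_derivative -1) (at x)" for x :: real by (auto intro!: derivative_eq_intros)
  from DERIV_chain2[OF f this] have "((\<lambda>x. f (- x)) has_real_derivative - f' (- x)) (at x)" for x by simp
  note d = this
  have "- p < - T" "- f' (- (- p)) \<noteq> 0" using p by simp_all
  from left_end_of_flat[OF d this]
  obtain a where a: "- p < a" "a \<le> - T" "\<forall>x\<in>{a..- T}. f (- x) = f (- (- T))" "\<forall>d>0. \<exists>x\<in>{a - d<..<a}. - f' (- x) \<noteq> 0"
    by blast
  have flat: "f x = f T" if "x \<in> {T..- a}" for x using bspec[OF a(3), of "- x"] that by simp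
  have nf: "\<exists>x\<in>{- a<..<- a + d}. f' x \<noteq> 0" if d: "d > 0" for d
  proof -
    obtain x where "x \<in> {a - d<..<a}" "f' (- x) \<noteq> 0" using a(4)[rule_format, OF d] by auto
    then show ?thesis by (intro bexI[of _ "- x"]) auto
  qed
  have "T \<le> - a" "- a < p" using a(1,2) by simp_all
  then show ?thesis using flat nf by blast
qed

section \<open>One-sided behaviour of a function with finitely many changes of monotonicity\<close>

locale sign_changing_drift = periodic_drift +
  assumes sign_changes: "finitely_many_sign_changes (deriv m)" and m'_0: "deriv m 0 > 0"
begin

lemma m'_1: "deriv m 1 > 0" using m'_periodic[of 0] m'_0 by simp

lemma ends_differ:
  assumes mo: "mono_on {p..q} m \<or> antimono_on {p..q} m" and x: "x \<in> {p<..<q}" "deriv m x \<noteq> 0"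
  shows "m p \<noteq> m q"
proof
  assume eq: "m p = m q"
  have "deriv m x = 0"
  proof (rule deriv_zero_of_flat[OF DERIV_m])
    show "p < q" "x \<in> {p..q}" using x by auto
    show "m z = m p" if "z \<in> {p..q}" for z by (rule flat_of_monotone[OF mo eq that])
  qed
  then show False using x by simp
qed

text \<open>A monotone function with equal values at two points is constant between them, which a
  nonzero derivative there excludes; so weak monotonicity becomes strict against
  \<open>t\<close>.\<close>

lemma rises_rightI:
  assumes "e > 0" "mono_on {t..t + e} m" and nf: "\<And>d. d > 0 \<Longrightarrow> \<exists>x\<in>{t<..<t + d}. deriv m x \<noteq> 0"
  shows "rises_right m t"
  unfolding rises_right_def
proof (intro exI[of _ e] conjI ballI assms(1,2))
  fix y assume y: "y \<in> {t<..t + e}"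
  have mo: "mono_on {t..y} m" by (rule monotone_on_subset[OF assms(2)]) (use y in auto)
  have "\<exists>x\<in>{t<..<y}. deriv m x \<noteq> 0" using nf[of "y - t"] y by simp
  then have "m t \<noteq> m y" using ends_differ[OF disjI1[OF mo]] by blast
  then show "m t < m y" using monotone_onD[OF mo, of t y] y by simp
qed

lemma falls_rightI:
  assumes "e > 0" "antimono_on {t..t + e} m" and nf: "\<And>d. d > 0 \<Longrightarrow> \<exists>x\<in>{t<..<t + d}. deriv m x \<noteq> 0"
  shows "falls_right m t"
  unfolding falls_right_def
proof (intro exI[of _ e] conjI ballI assms(1,2))
  fix y assume y: "y \<in> {t<..t + e}"
  have mo: "antimono_on {t..y} m" by (rule monotone_on_subset[OF assms(2)]) (use y in auto)
  have "\<exists>x\<in>{t<..<y}. deriv m x \<noteq> 0" using nf[of "y - t"] y by simp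
  then have "m t \<noteq> m y" using ends_differ[OF disjI2[OF mo]] by blast
  then show "m y < m t" using monotone_onD[OF mo, of t y] y by simp
qed

lemma rises_leftI:
  assumes "e > 0" "mono_on {t - e..t} m" and nf: "\<And>d. d > 0 \<Longrightarrow> \<exists>x\<in>{t - d<..<t}. deriv m x \<noteq> 0"
  shows "rises_left m t"
  unfolding rises_left_def
proof (intro exI[of _ e] conjI ballI assms(1,2))
  fix y assume y: "y \<in> {t - e..<t}"
  have mo: "mono_on {y..t} m" by (rule monotone_on_subset[OF assms(2)]) (use y in auto)
  have "\<exists>x\<in>{y<..<t}. deriv m x \<noteq> 0" using nf[of "t - y"] y by simp
  then have "m y \<noteq> m t" using ends_differ[OF disjI1[OF mo]] by blast
  then show "m y < m t" using monotone_onD[OF mo, of y t] y by simp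
qed

lemma falls_leftI:
  assumes "e > 0" "antimono_on {t - e..t} m" and nf: "\<And>d. d > 0 \<Longrightarrow> \<exists>x\<in>{t - d<..<t}. deriv m x \<noteq> 0"
  shows "falls_left m t"
  unfolding falls_left_def
proof (intro exI[of _ e] conjI ballI assms(1,2))
  fix y assume y: "y \<in> {t - e..<t}"
  have mo: "antimono_on {y..t} m" by (rule monotone_on_subset[OF assms(2)]) (use y in auto)
  have "\<exists>x\<in>{y<..<t}. deriv m x \<noteq> 0" using nf[of "t - y"] y by simp
  then have "m y \<noteq> m t" using ends_differ[OF disjI2[OF mo]] by blast
  then show "m t < m y" using monotone_onD[OF mo, of y t] y by simp
qed

lemma mono_onI_deriv: "(\<And>x. x \<in> {p..q} \<Longrightarrow> deriv m x \<ge> 0) \<Longrightarrow> mono_on {p..q} m"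
  by (intro mono_onI DERIV_nonneg_imp_nondecreasing[of _ _ m]) (use DERIV_m in force)+

lemma antimono_onI_deriv: "(\<And>x. x \<in> {p..q} \<Longrightarrow> deriv m x \<le> 0) \<Longrightarrow> antimono_on {p..q} m"
  by (intro monotone_onI DERIV_nonpos_imp_nonincreasing[of _ _ m]) (use DERIV_m in force)+

lemma monotone_partition: "\<exists>X. finite X \<and> (\<forall>p q. 0 \<le> p \<and> p < q \<and> q \<le> 1 \<and> {p<..<q} \<inter> X = {} \<longrightarrow>
    mono_on {p..q} m \<or> antimono_on {p..q} m)"
proof -
  obtain X where X: "finite X" "\<And>p q. 0 \<le> p \<and> p < q \<and> q \<le> 1 \<and> {p<..<q} \<inter> X = {} \<Longrightarrow>
    (\<forall>x\<in>{p..q}. deriv m x \<ge> 0) \<or> (\<forall>x\<in>{p..q}. deriv m x \<le> 0)"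
    using sign_partition[OF sign_changes] by blast
  show ?thesis
  proof (intro exI[of _ X] conjI X(1) allI impI)
    fix p q :: real assume "0 \<le> p \<and> p < q \<and> q \<le> 1 \<and> {p<..<q} \<inter> X = {}"
    from X(2)[OF this] show "mono_on {p..q} m \<or> antimono_on {p..q} m"
      using mono_onI_deriv antimono_onI_deriv by blast
  qed
qed

lemma one_sided_monotone:
  assumes "0 < t" "t < 1"
  shows "\<exists>e>0. (mono_on {t..t + e} m \<or> antimono_on {t..t + e} m) \<and> (mono_on {t - e..t} m \<or> antimono_on {t - e..t} m)"
proof -
  obtain X where X: "finite X" "\<And>p q. 0 \<le> p \<Longrightarrow> p < q \<Longrightarrow> q \<le> 1 \<Longrightarrow> {p<..<q} \<inter> X = {} \<Longrightarrow>
    mono_on {p..q} m \<or> antimono_on {p..q} m" using monotone_partition by blast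
  obtain d where d: "d > 0" "\<forall>x\<in>X. (x < t \<longrightarrow> x \<le> t - d) \<and> (x > t \<longrightarrow> x \<ge> t + d)"
    using finite_gap[OF X(1), of t t] by blast
  define e where "e = min d (min t (1 - t))"
  have e: "e > 0" "e \<le> d" "e \<le> t" "e \<le> 1 - t" using d assms by (auto simp: e_def)
  have "{t<..<t + e} \<inter> X = {}" "{t - e<..<t} \<inter> X = {}" using d(2) e by fastforce+
  then show ?thesis using X(2)[of t "t + e"] X(2)[of "t - e" t] e assms by (intro exI[of _ e]) auto
qed

end

text \<open>Strict counterparts of \<open>left_type\<close> and \<open>right_type\<close>. At the
  ends of a segment the notions agree, because \<open>m'\<close> is not identically zero just
  outside.\<close>

fun left_shape :: "endpoint_type \<Rightarrow> (real \<Rightarrow> real) \<Rightarrow> real \<Rightarrow> bool" where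
  "left_shape I m a \<longleftrightarrow> rises_left m a"
| "left_shape D m a \<longleftrightarrow> falls_left m a"

fun right_shape :: "endpoint_type \<Rightarrow> (real \<Rightarrow> real) \<Rightarrow> real \<Rightarrow> bool" where
  "right_shape I m b \<longleftrightarrow> rises_right m b"
| "right_shape D m b \<longleftrightarrow> falls_right m b"

lemma left_shape_cases: "rises_left m a \<or> falls_left m a \<longleftrightarrow> (\<exists>l. left_shape l m a)"
  by (metis endpoint_type.exhaust left_shape.simps)

lemma right_shape_cases: "rises_right m b \<or> falls_right m b \<longleftrightarrow> (\<exists>r. right_shape r m b)"
  by (metis endpoint_type.exhaust right_shape.simps)

lemma left_type_of_shape: "left_shape l m a \<Longrightarrow> left_type m a l"
  by (cases l) (auto simp: rises_left_def falls_left_def)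

lemma right_type_of_shape: "right_shape r m b \<Longrightarrow> right_type m b r"
  by (cases r) (auto simp: rises_right_def falls_right_def)

section \<open>Structure and finiteness of the segments\<close>

context sign_changing_drift begin

text \<open>\<open>m'\<close> vanishes on a segment including its ends but is positive at 0 and 1,
  so segments lie strictly inside [0,1]; then the nonvanishing conditions apply at both ends and
  turn weak types into strict shapes. Conversely, a strict shape yields nonzero derivatives outside
  by the mean value theorem.\<close>

lemma mem_segments_iff:
  "(a, b) \<in> segments m l r \<longleftrightarrow> 0 < a \<and> a < b \<and> b < 1 \<and> (\<forall>x\<in>{a..b}. m x = m a) \<and> left_shape l m a \<and> right_shape r m b"
proof
  assume "(a, b) \<in> segments m l r"
  then have seg: "segment_of_local_maximum m a b" and l: "left_type m a l" and r: "right_type m b r"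
    by (auto simp: segments_def)
  have ab: "0 \<le> a" "a < b" "b \<le> 1" using seg by (auto simp: segment_of_local_maximum_def)
  have "m constant_on {a..b}" using seg by (simp add: segment_of_local_maximum_def)
  then have const: "m x = m a" if "x \<in> {a..b}" for x using that ab unfolding constant_on_def by force
  have zero: "deriv m x = 0" if "x \<in> {a..b}" for x
    by (rule deriv_zero_of_flat[OF DERIV_m ab(2) const that])
  have "a \<noteq> 0" "b \<noteq> 1" using zero[of a] zero[of b] ab m'_0 m'_1 by auto
  then have ab': "0 < a" "b < 1" using ab by auto
  obtain \<delta> where del: "\<delta> > 0" "\<And>\<epsilon>. 0 < \<epsilon> \<Longrightarrow> \<epsilon> < \<delta> \<Longrightarrow> (\<exists>x\<in>{a - \<epsilon><..<a}. deriv m x \<noteq> 0) \<and> (\<exists>x\<in>{b<..<b + \<epsilon>}. deriv m x \<noteq> 0)"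
    using seg ab' unfolding segment_of_local_maximum_def by blast
  have nfl: "\<exists>x\<in>{a - d<..<a}. deriv m x \<noteq> 0" and nfr: "\<exists>x\<in>{b<..<b + d}. deriv m x \<noteq> 0" if "d > 0" for d
  proof -
    define e where "e = min d \<delta> / 2"
    have e: "0 < e" "e < \<delta>" "e < d" using that del(1) by (auto simp: e_def)
    obtain x y where "x \<in> {a - e<..<a}" "deriv m x \<noteq> 0" "y \<in> {b<..<b + e}" "deriv m y \<noteq> 0"
      using del(2)[OF e(1,2)] by blast
    then have "x \<in> {a - d<..<a}" "y \<in> {b<..<b + d}" using e(3) by auto
    then show "\<exists>x\<in>{a - d<..<a}. deriv m x \<noteq> 0" "\<exists>x\<in>{b<..<b + d}. deriv m x \<noteq> 0"
      using \<open>deriv m x \<noteq> 0\<close> \<open>deriv m y \<noteq> 0\<close> by blast+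
  qed
  have "left_shape l m a"
  proof (cases l)
    case I
    then obtain e where "e > 0" "mono_on {a - e..a} m" using l by auto
    then show ?thesis using rises_leftI[OF _ _ nfl] I by simp
  next
    case D
    then obtain e where "e > 0" "antimono_on {a - e..a} m" using l by auto
    then show ?thesis using falls_leftI[OF _ _ nfl] D by simp
  qed
  moreover have "right_shape r m b"
  proof (cases r)
    case I
    then obtain e where "e > 0" "mono_on {b..b + e} m" using r by auto
    then show ?thesis using rises_rightI[OF _ _ nfr] I by simp
  next
    case D
    then obtain e where "e > 0" "antimono_on {b..b + e} m" using r by auto
    then show ?thesis using falls_rightI[OF _ _ nfr] D by simp
  qed
  ultimately show "0 < a \<and> a < b \<and> b < 1 \<and> (\<forall>x\<in>{a..b}. m x = m a) \<and> left_shape l m a \<and> right_shape r m b"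
    using ab ab' const by blast
next
  assume h: "0 < a \<and> a < b \<and> b < 1 \<and> (\<forall>x\<in>{a..b}. m x = m a) \<and> left_shape l m a \<and> right_shape r m b"
  then have ab: "0 < a" "a < b" "b < 1" and shapes: "left_shape l m a" "right_shape r m b" by blast+
  have lr: "rises_left m a \<or> falls_left m a" "rises_right m b \<or> falls_right m b"
    using shapes left_shape_cases right_shape_cases by blast+
  obtain d where d: "d > 0" "mono_on {a - d..a} m \<or> antimono_on {a - d..a} m"
    using lr(1) unfolding rises_left_def falls_left_def by blast
  obtain e where e: "e > 0" "mono_on {b..b + e} m \<or> antimono_on {b..b + e} m"
    using lr(2) unfolding rises_right_def falls_right_def by blast
  define \<epsilon> where "\<epsilon> = min d e"
  have "{a - \<epsilon>..a} \<inter> {0..1} \<subseteq> {a - d..a}" "{b..b + \<epsilon>} \<inter> {0..1} \<subseteq> {b..b + e}" by (auto simp: \<epsilon>_def)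
  then have "mono_on ({a - \<epsilon>..a} \<inter> {0..1}) m \<or> antimono_on ({a - \<epsilon>..a} \<inter> {0..1}) m"
    "mono_on ({b..b + \<epsilon>} \<inter> {0..1}) m \<or> antimono_on ({b..b + \<epsilon>} \<inter> {0..1}) m"
    using d(2) e(2) monotone_on_subset by blast+
  moreover have "\<epsilon> > 0" using d e by (simp add: \<epsilon>_def)
  moreover have "m constant_on {a..b}" using h unfolding constant_on_def by blast
  moreover have "\<forall>\<epsilon>. 0 < \<epsilon> \<and> \<epsilon> < 1 \<longrightarrow> (a > 0 \<longrightarrow> (\<exists>x\<in>{a - \<epsilon><..<a}. deriv m x \<noteq> 0)) \<and>
        (b < 1 \<longrightarrow> (\<exists>x\<in>{b<..<b + \<epsilon>}. deriv m x \<noteq> 0))"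
    using nonflat_left[OF DERIV_m lr(1)] nonflat_right[OF DERIV_m lr(2)] by blast
  ultimately have "segment_of_local_maximum m a b"
    using ab unfolding segment_of_local_maximum_def by (intro conjI exI[of _ \<epsilon>] exI[of _ "1::real"]) simp_all
  then show "(a, b) \<in> segments m l r"
    using shapes left_type_of_shape right_type_of_shape by (simp add: segments_def)
qed

lemma segmentsD:
  assumes "(a, b) \<in> segments m l r"
  shows "0 < a" "a < b" "b < 1" "left_shape l m a" "right_shape r m b"
  using assms mem_segments_iff by blast+

lemma segment_deriv_zero:
  assumes "(a, b) \<in> segments m l r" "x \<in> {a..b}"
  shows "deriv m x = 0"
proof (rule deriv_zero_of_flat[OF DERIV_m segmentsD(2)[OF assms(1)] _ assms(2)])
  show "m y = m a" if "y \<in> {a..b}" for y using assms(1) that mem_segments_iff by blast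
qed

text \<open>Segments are maximal: \<open>m'\<close> vanishes on each of them but has nonzero values
  arbitrarily close outside its ends, so overlapping ones coincide.\<close>

lemma segments_disjoint:
  assumes s: "(a, b) \<in> segments m l r" and t: "(a', b') \<in> segments m l' r'" and "a \<le> a'" "a' \<le> b"
  shows "a = a' \<and> b = b'"
proof -
  have nf: "\<exists>x\<in>{p - d<..<p}. deriv m x \<noteq> 0" "\<exists>x\<in>{q<..<q + d}. deriv m x \<noteq> 0"
    if "(p, q) \<in> segments m k k'" "d > 0" for p q k k' d
  proof -
    have "rises_left m p \<or> falls_left m p" "rises_right m q \<or> falls_right m q"
      using segmentsD(4,5)[OF that(1)] left_shape_cases right_shape_cases by blast+
    then show "\<exists>x\<in>{p - d<..<p}. deriv m x \<noteq> 0" "\<exists>x\<in>{q<..<q + d}. deriv m x \<noteq> 0"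
      using nonflat_left[OF DERIV_m] nonflat_right[OF DERIV_m] that(2) by blast+
  qed
  have "a = a'"
  proof (rule ccontr)
    assume "a \<noteq> a'"
    then obtain x where "x \<in> {a' - (a' - a)<..<a'}" "deriv m x \<noteq> 0" using nf(1)[OF t, of "a' - a"] assms(3) by auto
    then show False using segment_deriv_zero[OF s, of x] assms(4) by auto
  qed
  moreover have "\<not> b < b'"
  proof
    assume "b < b'"
    then obtain x where "x \<in> {b<..<b + (b' - b)}" "deriv m x \<noteq> 0" using nf(2)[OF s, of "b' - b"] by auto
    then show False using segment_deriv_zero[OF t, of x] assms(4) by auto
  qed
  moreover have "\<not> b' < b"
  proof
    assume "b' < b"
    then obtain x where "x \<in> {b'<..<b' + (b - b')}" "deriv m x \<noteq> 0" using nf(2)[OF t, of "b - b'"] by auto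
    moreover have "a' < b'" by (rule segmentsD(2)[OF t])
    ultimately show False using segment_deriv_zero[OF s, of x] assms(3) by auto
  qed
  ultimately show ?thesis by simp
qed

text \<open>Two segments of length at least \<open>h\<close> whose left ends lie in the same cell of
  a grid of mesh \<open>h\<close> overlap, hence coincide. So the cell number is injective, and it
  takes finitely many values.\<close>

lemma finite_long_segments:
  assumes h: "h > 0"
  shows "finite {p \<in> segments m l r. snd p - fst p \<ge> h}"
proof -
  let ?S = "{p \<in> segments m l r. snd p - fst p \<ge> h}"
  define f where "f p = \<lfloor>fst p / h\<rfloor>" for p :: "real \<times> real"
  have le: "p = q" if "p \<in> ?S" "q \<in> ?S" "f p = f q" "fst p \<le> fst q" for p q
  proof -
    obtain a b a' b' where pq: "p = (a, b)" "q = (a', b')" by (cases p; cases q)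
    have "a' / h < a / h + 1" using that(3) pq unfolding f_def by simp linarith
    then have "a' < a + h" using h by (simp add: field_simps)
    then have "a' \<le> b" using that(1) pq by simp
    then show ?thesis using segments_disjoint[of a b l r a' b' l r] that pq by simp
  qed
  have "inj_on f ?S"
  proof (rule inj_onI)
    fix p q assume "p \<in> ?S" "q \<in> ?S" "f p = f q"
    then show "p = q" using le[of p q] le[of q p] by (cases "fst p \<le> fst q") auto
  qed
  moreover have "f ` ?S \<subseteq> {0..\<lfloor>1 / h\<rfloor>}"
  proof (rule image_subsetI)
    fix p assume p: "p \<in> ?S"
    obtain a b where ab: "p = (a, b)" by (cases p)
    have "0 < a" "a < 1" using p ab segmentsD(1-3)[of a b l r] by auto
    then show "f p \<in> {0..\<lfloor>1 / h\<rfloor>}" using ab h by (auto simp: f_def intro!: floor_mono divide_right_mono)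
  qed
  ultimately show ?thesis by (metis (no_types, lifting) finite_atLeastAtMost_int inj_on_finite)
qed

text \<open>Rising before and falling after forces a break point of the monotone partition into each
  such segment, and disjoint segments have distinct break points. Length cannot replace this
  argument, since Neumann-Neumann eigenvalues need not grow on short intervals.\<close>

lemma finite_peaks: "finite (segments m I D)"
proof -
  obtain X where X: "finite X" "\<And>p q. 0 \<le> p \<Longrightarrow> p < q \<Longrightarrow> q \<le> 1 \<Longrightarrow> {p<..<q} \<inter> X = {} \<Longrightarrow>
    mono_on {p..q} m \<or> antimono_on {p..q} m" using monotone_partition by blast
  have ex: "\<exists>x\<in>X. fst p \<le> x \<and> x \<le> snd p" if p: "p \<in> segments m I D" for p
  proof (rule ccontr)
    obtain a b where ab: "p = (a, b)" by (cases p)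
    have s: "0 < a" "a < b" "b < 1" "rises_left m a" "falls_right m b"
      using p ab segmentsD[of a b I D] by auto
    assume "\<not> (\<exists>x\<in>X. fst p \<le> x \<and> x \<le> snd p)"
    then have n: "x < a \<or> b < x" if "x \<in> X" for x using that ab by force
    obtain d where d: "d > 0" "\<forall>x\<in>X. (x < a \<longrightarrow> x \<le> a - d) \<and> (x > b \<longrightarrow> x \<ge> b + d)"
      using finite_gap[OF X(1), of a b] by blast
    obtain d1 where d1: "d1 > 0" "\<forall>y\<in>{a - d1..<a}. m y < m a" using s(4) unfolding rises_left_def by blast
    obtain d2 where d2: "d2 > 0" "\<forall>y\<in>{b<..b + d2}. m y < m b" using s(5) unfolding falls_right_def by blast
    define e where "e = min (min d (min d1 d2)) (min a (1 - b))"
    have e: "e > 0" "e \<le> d" "e \<le> d1" "e \<le> d2" "e \<le> a" "e \<le> 1 - b" using d d1 d2 s by (auto simp: e_def)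
    have "{a - e<..<b + e} \<inter> X = {}"
    proof -
      have "x \<notin> {a - e<..<b + e}" if "x \<in> X" for x using d(2) n[OF that] that e(2) by fastforce
      then show ?thesis by blast
    qed
    then have "mono_on {a - e..b + e} m \<or> antimono_on {a - e..b + e} m" using X(2)[of "a - e" "b + e"] e s by simp
    moreover have "m (a - e) < m a" "m (b + e) < m b" using d1(2) d2(2) e by simp_all
    ultimately show False
      using monotone_onD[of "{a - e..b + e}" "(\<le>)" "(\<ge>)" m "a - e" a] monotone_onD[of "{a - e..b + e}" "(\<le>)" "(\<le>)" m b "b + e"] e s by auto
  qed
  define f where "f p = (SOME x. x \<in> X \<and> fst p \<le> x \<and> x \<le> snd p)" for p :: "real \<times> real"
  have f: "f p \<in> X" "fst p \<le> f p" "f p \<le> snd p" if "p \<in> segments m I D" for p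
    using someI_ex[of "\<lambda>x. x \<in> X \<and> fst p \<le> x \<and> x \<le> snd p"] ex[OF that] unfolding f_def by blast+
  have le: "p = q" if "p \<in> segments m I D" "q \<in> segments m I D" "f p = f q" "fst p \<le> fst q" for p q
    using segments_disjoint[of "fst p" "snd p" I D "fst q" "snd q" I D] that f[OF that(1)] f[OF that(2)]
    by (simp add: prod_eq_iff)
  have "inj_on f (segments m I D)"
  proof (rule inj_onI)
    fix p q assume "p \<in> segments m I D" "q \<in> segments m I D" "f p = f q"
    then show "p = q" using le[of p q] le[of q p] by (cases "fst p \<le> fst q") auto
  qed
  moreover have "f ` segments m I D \<subseteq> X" using f(1) by blast
  ultimately show ?thesis using X(1) by (rule inj_on_finite)
qed

text \<open>A strict maximum away from the break points would lie inside an interval of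
  monotonicity. The points 0 and 1 are set apart because the partition describes \<open>m\<close>
  inside [0,1].\<close>

lemma finite_isolated_local_maxima: "finite (isolated_local_maxima m)"
proof -
  obtain X where X: "finite X" "\<And>p q. 0 \<le> p \<Longrightarrow> p < q \<Longrightarrow> q \<le> 1 \<Longrightarrow> {p<..<q} \<inter> X = {} \<Longrightarrow>
    mono_on {p..q} m \<or> antimono_on {p..q} m" using monotone_partition by blast
  have "isolated_local_maxima m \<subseteq> X \<union> {0, 1}"
  proof
    fix t assume "t \<in> isolated_local_maxima m"
    then obtain e where t: "0 \<le> t" "t \<le> 1" and e: "e > 0" "\<And>x. x \<in> {t - e<..<t + e} - {t} \<Longrightarrow> m x < m t"
      unfolding isolated_local_maxima_def by auto
    show "t \<in> X \<union> {0, 1}"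
    proof (rule ccontr)
      assume n: "t \<notin> X \<union> {0, 1}"
      obtain d where d: "d > 0" "\<forall>x\<in>X. (x < t \<longrightarrow> x \<le> t - d) \<and> (x > t \<longrightarrow> x \<ge> t + d)"
        using finite_gap[OF X(1), of t t] by blast
      define k where "k = min (min d (e / 2)) (min t (1 - t))"
      have k: "k > 0" "k \<le> d" "k < e" "k \<le> t" "k \<le> 1 - t" using d e t n by (auto simp: k_def)
      have "{t - k<..<t + k} \<inter> X = {}"
      proof -
        have "x \<notin> {t - k<..<t + k}" if "x \<in> X" for x using d(2) n that k(2) by (cases x t rule: linorder_cases) fastforce+
        then show ?thesis by blast
      qed
      then have "mono_on {t - k..t + k} m \<or> antimono_on {t - k..t + k} m" using X(2)[of "t - k" "t + k"] k by simp
      moreover have "m (t - k) < m t" "m (t + k) < m t" using e(2) k by simp_all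
      ultimately show False
        using monotone_onD[of "{t - k..t + k}" "(\<le>)" "(\<ge>)" m "t - k" t] monotone_onD[of "{t - k..t + k}" "(\<le>)" "(\<le>)" m t "t + k"] k by auto
    qed
  qed
  then show ?thesis using X(1) finite_subset by blast
qed

text \<open>If \<open>m'\<close> is nonzero at \<open>T\<close>, its sign is constant nearby.
  Otherwise the maximal interval of constancy around \<open>T\<close> is either \<open>T\<close>
  alone or a segment; finitely many sign changes make \<open>m\<close> monotone next to its
  ends.\<close>

lemma point_or_segment:
  assumes T: "T \<in> {0..1}"
  shows "((rises_right m T \<or> falls_right m T) \<and> (rises_left m T \<or> falls_left m T)) \<or>
    (\<exists>a b l r. (a, b) \<in> segments m l r \<and> a \<le> T \<and> T \<le> b)"
proof (cases "deriv m T = 0")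
  case False
  have "(deriv m \<longlongrightarrow> deriv m T) (nhds T)" using isCont_m'[of T] by (simp add: continuous_at tendsto_at_iff_tendsto_nhds)
  then have "eventually (\<lambda>x. dist (deriv m x) (deriv m T) < \<bar>deriv m T\<bar>) (nhds T)"
    by (rule tendstoD) (use False in simp)
  then obtain e where e: "e > 0" "\<And>x. dist x T < e \<Longrightarrow> dist (deriv m x) (deriv m T) < \<bar>deriv m T\<bar>"
    unfolding eventually_nhds_metric by blast
  have near: "\<bar>deriv m x - deriv m T\<bar> < \<bar>deriv m T\<bar>" if "x \<in> {T - e / 2..T + e / 2}" for x
    using e(2)[of x] that e(1) by (auto simp: dist_real_def)
  have nfr: "\<exists>x\<in>{T<..<T + d}. deriv m x \<noteq> 0" and nfl: "\<exists>x\<in>{T - d<..<T}. deriv m x \<noteq> 0" if "d > 0" for d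
  proof -
    define h where "h = min d e / 2"
    have h: "h > 0" "h < d" "h \<le> e / 2" using that e(1) by (auto simp: h_def)
    have "deriv m (T + h) \<noteq> 0" "deriv m (T - h) \<noteq> 0" using near[of "T + h"] near[of "T - h"] h by auto
    then show "\<exists>x\<in>{T<..<T + d}. deriv m x \<noteq> 0" "\<exists>x\<in>{T - d<..<T}. deriv m x \<noteq> 0"
      using h by (auto intro: bexI[of _ "T + h"] bexI[of _ "T - h"])
  qed
  have e2: "e / 2 > 0" using e(1) by simp
  consider "deriv m T > 0" | "deriv m T < 0" using False by linarith
  then show ?thesis
  proof cases
    case 1
    have pos: "deriv m x \<ge> 0" if "x \<in> {T - e / 2..T + e / 2}" for x using near[OF that] 1 by linarith
    have "rises_right m T" by (rule rises_rightI[OF e2 mono_onI_deriv nfr]) (use pos e2 in auto)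
    moreover have "rises_left m T" by (rule rises_leftI[OF e2 mono_onI_deriv nfl]) (use pos e2 in auto)
    ultimately show ?thesis by blast
  next
    case 2
    have neg: "deriv m x \<le> 0" if "x \<in> {T - e / 2..T + e / 2}" for x using near[OF that] 2 by linarith
    have "falls_right m T" by (rule falls_rightI[OF e2 antimono_onI_deriv nfr]) (use neg e2 in auto)
    moreover have "falls_left m T" by (rule falls_leftI[OF e2 antimono_onI_deriv nfl]) (use neg e2 in auto)
    ultimately show ?thesis by blast
  qed
next
  case True
  then have T01: "0 < T" "T < 1" using T m'_0 m'_1 by (auto simp: order_less_le)
  obtain a where a: "0 < a" "a \<le> T" "\<forall>x\<in>{a..T}. m x = m T" "\<And>d. d > 0 \<Longrightarrow> \<exists>x\<in>{a - d<..<a}. deriv m x \<noteq> 0"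
    using left_end_of_flat[OF DERIV_m T01(1) less_imp_neq[OF m'_0, symmetric]] by blast
  obtain b where b: "T \<le> b" "b < 1" "\<forall>x\<in>{T..b}. m x = m T" "\<And>d. d > 0 \<Longrightarrow> \<exists>x\<in>{b<..<b + d}. deriv m x \<noteq> 0"
    using right_end_of_flat[OF DERIV_m T01(2) less_imp_neq[OF m'_1, symmetric]] by blast
  have "0 < b" "a < 1" using a(2) b(1) T01 by auto
  obtain e where e: "e > 0" "mono_on {a - e..a} m \<or> antimono_on {a - e..a} m"
    using one_sided_monotone[OF a(1) \<open>a < 1\<close>] by blast
  obtain e' where e': "e' > 0" "mono_on {b..b + e'} m \<or> antimono_on {b..b + e'} m"
    using one_sided_monotone[OF \<open>0 < b\<close> b(2)] by blast
  have la: "rises_left m a \<or> falls_left m a" using e(2) rises_leftI[OF e(1) _ a(4)] falls_leftI[OF e(1) _ a(4)] by blast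
  have rb: "rises_right m b \<or> falls_right m b" using e'(2) rises_rightI[OF e'(1) _ b(4)] falls_rightI[OF e'(1) _ b(4)] by blast
  show ?thesis
  proof (cases "a = b")
    case True
    then have "a = T" "b = T" using a(2) b(1) by auto
    then show ?thesis using la rb by blast
  next
    case False
    then have ab: "a < b" using a(2) b(1) by auto
    have flat: "m x = m a" if "x \<in> {a..b}" for x
    proof -
      have "m x = m T" using bspec[OF a(3), of x] bspec[OF b(3), of x] that by (cases "x \<le> T") auto
      moreover have "m a = m T" using bspec[OF a(3), of a] a(2) by simp
      ultimately show ?thesis by simp
    qed
    obtain l r where "left_shape l m a" "right_shape r m b"
      using la rb unfolding left_shape_cases right_shape_cases by blast
    then have "(a, b) \<in> segments m l r" using ab a(1) b(2) flat mem_segments_iff by blast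
    then show ?thesis using a(2) b(1) by blast
  qed
qed

end

subsection \<open>The limit of the principal eigenvalue\<close>

text \<open>Neumann where \<open>m\<close> decreases on leaving the segment, Dirichlet where it
  increases. Leaving at the left end means moving left, so the same letter gives opposite conditions
  at the two ends.\<close>

fun left_condition :: "endpoint_type \<Rightarrow> boundary_condition" where
  "left_condition I = Neumann" | "left_condition D = Dirichlet"

fun right_condition :: "endpoint_type \<Rightarrow> boundary_condition" where
  "right_condition I = Dirichlet" | "right_condition D = Neumann"

section \<open>Minima of possibly infinite sets\<close>

definition is_minimum :: "real set \<Rightarrow> real \<Rightarrow> bool" where
  "is_minimum S v \<longleftrightarrow> v \<in> S \<and> (\<forall>w\<in>S. v \<le> w)"

lemma has_minimum_iff: "has_minimum S \<longleftrightarrow> (\<exists>v. is_minimum S v)"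
  by (auto simp: has_minimum_def is_minimum_def)

lemma minimum_eq: "is_minimum S v \<Longrightarrow> minimum S = v"
  unfolding minimum_def is_minimum_def by (rule Least_equality) auto

lemma is_minimum_minimum: "has_minimum S \<Longrightarrow> is_minimum S (minimum S)"
  using minimum_eq by (auto simp: has_minimum_iff)

text \<open>One finite nonempty sublevel set is enough, so \<open>S\<close> itself may be
  infinite.\<close>

lemma has_minimum_finite:
  assumes "finite {v \<in> S. v \<le> k}" "k \<in> S"
  shows "has_minimum S"
proof -
  let ?T = "{v \<in> S. v \<le> k}"
  have "k \<in> ?T" using assms(2) by simp
  then have "Min ?T \<in> ?T" "Min ?T \<le> k" using assms(1) Min_in[of ?T] Min_le[of ?T k] by blast+
  moreover have "Min ?T \<le> v" if "v \<in> S" for v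
    using Min_le[OF assms(1), of v] that \<open>Min ?T \<le> k\<close> by (cases "v \<le> k") auto
  ultimately show ?thesis unfolding has_minimum_def by blast
qed

lemma has_minimum_Un:
  assumes "A = {} \<or> has_minimum A" "B = {} \<or> has_minimum B" "A \<union> B \<noteq> {}"
  shows "has_minimum (A \<union> B)"
proof (cases "A = {} \<or> B = {}")
  case True
  then show ?thesis using assms by auto
next
  case False
  then obtain a b where "is_minimum A a" "is_minimum B b" using assms by (auto simp: has_minimum_iff)
  then have "is_minimum (A \<union> B) (min a b)" unfolding is_minimum_def min_def by fastforce
  then show ?thesis by (auto simp: has_minimum_iff)
qed

lemma is_minimum_minima:
  assumes v: "is_minimum (\<Union>\<F>) v" and \<F>: "\<And>A. A \<in> \<F> \<Longrightarrow> A \<noteq> {} \<Longrightarrow> has_minimum A"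
  shows "is_minimum (minima \<F>) v"
  unfolding is_minimum_def
proof
  obtain A where A: "A \<in> \<F>" "v \<in> A" using v by (auto simp: is_minimum_def)
  then have "is_minimum A v" using v by (auto simp: is_minimum_def)
  then show "v \<in> minima \<F>" using A minimum_eq[of A v] by (auto simp: minima_def)
  show "\<forall>w\<in>minima \<F>. v \<le> w"
  proof
    fix w assume "w \<in> minima \<F>"
    then obtain B where B: "B \<in> \<F>" "B \<noteq> {}" "w = minimum B" by (auto simp: minima_def)
    then have "w \<in> B" using is_minimum_minimum[OF \<F>[OF B(1,2)]] by (simp add: is_minimum_def)
    then show "v \<le> w" using v B(1) by (auto simp: is_minimum_def)
  qed
qed

section \<open>Matching upper and lower bounds\<close>

context sign_changing_drift begin

abbreviation lam :: "real \<Rightarrow> real" where "lam \<equiv> periodic_principal_eigenvalue m c"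

definition segment_values :: "endpoint_type \<Rightarrow> endpoint_type \<Rightarrow> real set" where
  "segment_values l r = segment_eigenvalues c (left_condition l) (right_condition r) (segments m l r)"

definition limit_candidates :: "real set" where
  "limit_candidates = c ` isolated_local_maxima m \<union> (\<Union>l r. segment_values l r)"

text \<open>Finitely many segments have an eigenvalue at most \<open>k\<close>: in the family of
  peaks by \<open>finite_peaks\<close>, in the others because one end is Dirichlet and a bounded
  eigenvalue forces a minimal length.\<close>

lemma segment_values_has_minimum:
  assumes ne: "segment_values l r \<noteq> {}"
  shows "has_minimum (segment_values l r)"
proof -
  obtain K where K: "\<And>x. \<bar>c x\<bar> \<le> K" using periodic_bounded[OF cont_c c_periodic] by blast
  interpret bounded_potential c K by unfold_locales (rule cont_c K)+
  let ?e = "\<lambda>(a, b). principal_eigenvalue c (left_condition l) (right_condition r) a b"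
  have img: "segment_values l r = ?e ` segments m l r" by (simp add: segment_values_def segment_eigenvalues_def)
  obtain k where k: "k \<in> segment_values l r" using ne by blast
  have "finite {p \<in> segments m l r. ?e p \<le> k}"
  proof (cases "l = I \<and> r = D")
    case True
    then show ?thesis using finite_peaks by simp
  next
    case False
    then have dir: "left_condition l = Dirichlet \<or> right_condition r = Dirichlet" by (cases l; cases r) auto
    \<comment> \<open>Since \<open>k + K \<le> R\<close>, the lower bound for the eigenvalue becomes
      \<open>(1 / (b - a))\<^sup>2 \<le> R\<close>; the summand 1 keeps \<open>R\<close>
      positive.\<close>
    define R where "R = \<bar>k\<bar> + K + 1"
    have R: "R > 0" using K_nonneg by (simp add: R_def)
    have "{p \<in> segments m l r. ?e p \<le> k} \<subseteq> {p \<in> segments m l r. snd p - fst p \<ge> 1 / sqrt R}"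
    proof
      fix p assume p: "p \<in> {p \<in> segments m l r. ?e p \<le> k}"
      obtain a b where ab: "p = (a, b)" by (cases p)
      have less: "a < b" using p ab segmentsD(2)[of a b l r] by simp
      obtain u u' where e: "eigenfunction (left_condition l) (right_condition r) a b (?e p) u u'"
        using principal_eigenfunction_exists[OF less, of "left_condition l" "right_condition r"] ab by auto
      have "(1 / (b - a))\<^sup>2 - K \<le> ?e p" by (rule dirichlet_eigenvalue_lower[OF e less dir])
      also have "\<dots> \<le> k" using p by simp
      finally have "(1 / (b - a))\<^sup>2 \<le> (sqrt R)\<^sup>2" using R by (simp add: R_def)
      then have "1 / (b - a) \<le> sqrt R" by (rule power2_le_imp_le) (use R in simp)
      then have "1 / sqrt R \<le> b - a" using less R by (simp add: field_simps)
      then show "p \<in> {p \<in> segments m l r. snd p - fst p \<ge> 1 / sqrt R}" using p ab by simp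
    qed
    then show ?thesis using finite_long_segments[of "1 / sqrt R" l r] R by (simp add: finite_subset)
  qed
  then have "finite (?e ` {p \<in> segments m l r. ?e p \<le> k})" by (rule finite_imageI)
  moreover have "{v \<in> segment_values l r. v \<le> k} \<subseteq> ?e ` {p \<in> segments m l r. ?e p \<le> k}" unfolding img by blast
  ultimately have "finite {v \<in> segment_values l r. v \<le> k}" by (rule finite_subset[rotated])
  then show ?thesis using k by (rule has_minimum_finite)
qed

lemma eventually_le_candidate:
  assumes v: "v \<in> limit_candidates" and \<epsilon>: "\<epsilon> > 0"
  shows "eventually (\<lambda>s. lam s \<le> v + \<epsilon>) at_top"
proof -
  obtain K \<phi> \<phi>' M E G C where "drift_eigenfamily c K m (deriv m) \<phi> \<phi>' M E G C lam"
    using drift_eigenfamily_exists by blast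
  then interpret f: drift_eigenfamily c K m "deriv m" \<phi> \<phi>' M E G C lam .
  consider x where "x \<in> isolated_local_maxima m" "v = c x"
    | l r a b where "(a, b) \<in> segments m l r" "v = principal_eigenvalue c (left_condition l) (right_condition r) a b"
    using v unfolding limit_candidates_def segment_values_def segment_eigenvalues_def by auto
  then show ?thesis
  proof cases
    case 1
    then obtain d where "d > 0" "\<And>y. y \<in> {x - d<..<x + d} - {x} \<Longrightarrow> m y < m x"
      unfolding isolated_local_maxima_def by blast
    then show ?thesis unfolding 1(2) by (rule f.eigenvalue_upper_point[OF _ _ \<epsilon>])
  next
    case 2
    note s = segmentsD[OF 2(1)]
    obtain u u' where e: "f.eigenfunction (left_condition l) (right_condition r) a b v u u'"
      using f.principal_eigenfunction_exists[OF s(2), of "left_condition l" "right_condition r"] 2(2) by blast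
    show ?thesis
    proof (rule f.eigenvalue_upper_plateau[OF s(2) segment_deriv_zero[OF 2(1)] e _ _ \<epsilon>])
      show "rises_left m a" if "left_condition l = Neumann" using that s(4) by (cases l) auto
      show "falls_right m b" if "right_condition r = Neumann" using that s(5) by (cases r) auto
    qed
  qed
qed

text \<open>Strictness is the point: \<open>\<mu>\<close> below the eigenvalue of a segment yields a
  positive solution with strict slopes at its Neumann ends, and \<open>\<mu>\<close> below
  \<open>c\<close> at every isolated maximum yields the condition at peaks.\<close>

lemma point_or_supersolution:
  assumes \<mu>: "\<And>v. v \<in> limit_candidates \<Longrightarrow> \<mu> < v" and T: "T \<in> {0..1}"
  shows "((rises_right m T \<or> falls_right m T) \<and> (rises_left m T \<or> falls_left m T) \<and>
        (rises_left m T \<and> falls_right m T \<longrightarrow> \<mu> < c T)) \<or>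
      (\<exists>a b g g'. a < b \<and> a \<le> T \<and> T \<le> b \<and> b \<le> 1 \<and> (\<forall>x\<in>{a..b}. deriv m x = 0) \<and>
        solves_ode (\<lambda>x. c x - \<mu>) g g' \<and> (\<forall>x\<in>{a..b}. g x > 0) \<and>
        (falls_left m a \<or> rises_left m a \<and> g' a < 0) \<and> (rises_right m b \<or> falls_right m b \<and> g' b > 0))"
  using point_or_segment[OF T]
proof (rule disjE)
  assume pt: "(rises_right m T \<or> falls_right m T) \<and> (rises_left m T \<or> falls_left m T)"
  have "\<mu> < c T" if peak: "rises_left m T" "falls_right m T"
  proof -
    obtain d where d: "d > 0" "\<forall>y\<in>{T - d..<T}. m y < m T" using peak(1) unfolding rises_left_def by blast
    obtain e where e: "e > 0" "\<forall>y\<in>{T<..T + e}. m y < m T" using peak(2) unfolding falls_right_def by blast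
    have "\<forall>x\<in>{T - min d e<..<T + min d e} - {T}. m x < m T"
    proof
      fix x assume "x \<in> {T - min d e<..<T + min d e} - {T}"
      then have "x \<in> {T - d..<T} \<or> x \<in> {T<..T + e}" by auto
      then show "m x < m T" using d(2) e(2) by blast
    qed
    then have "T \<in> isolated_local_maxima m"
      using T d(1) e(1) unfolding isolated_local_maxima_def by (intro CollectI conjI exI[of _ "min d e"]) auto
    then show ?thesis by (intro \<mu>) (simp add: limit_candidates_def)
  qed
  then show ?thesis using pt by (intro disjI1) simp
next
  assume "\<exists>a b l r. (a, b) \<in> segments m l r \<and> a \<le> T \<and> T \<le> b"
  then obtain a b l r where seg: "(a, b) \<in> segments m l r" and Tab: "a \<le> T" "T \<le> b" by blast
  note s = segmentsD[OF seg]
  obtain K where K: "\<And>x. \<bar>c x\<bar> \<le> K" using periodic_bounded[OF cont_c c_periodic] by blast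
  interpret p: bounded_potential c K by unfold_locales (rule cont_c K)+
  define k where "k = principal_eigenvalue c (left_condition l) (right_condition r) a b"
  have "k \<in> segment_values l r"
    unfolding segment_values_def segment_eigenvalues_def k_def by (rule rev_image_eqI[OF seg]) simp
  then have "k \<in> limit_candidates" by (auto simp: limit_candidates_def)
  then have less: "\<mu> < k" by (rule \<mu>)
  obtain u u' where e: "p.eigenfunction (left_condition l) (right_condition r) a b k u u'"
    using p.principal_eigenfunction_exists[OF s(2), of "left_condition l" "right_condition r"]
    unfolding k_def[symmetric] by (elim exE) (rule that)
  obtain g g' where g: "solves_ode (\<lambda>x. c x - \<mu>) g g'" "\<forall>x\<in>{a..b}. g x > 0"
    "left_condition l = Neumann \<longrightarrow> g' a < 0" "right_condition r = Neumann \<longrightarrow> g' b > 0"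
    using p.supersolution_exists[OF e s(2) less] by (elim exE conjE) (rule that)
  have "falls_left m a \<or> rises_left m a \<and> g' a < 0" using s(4) g(3) by (cases l) auto
  moreover have "rises_right m b \<or> falls_right m b \<and> g' b > 0" using s(5) g(4) by (cases r) auto
  moreover have "\<forall>x\<in>{a..b}. deriv m x = 0" using segment_deriv_zero[OF seg] by blast
  ultimately show ?thesis using s(2) Tab less_imp_le[OF s(3)] g(1,2)
    by - (rule disjI2, rule exI[of _ a], rule exI[of _ b], rule exI[of _ g], rule exI[of _ g'], intro conjI; assumption)
qed

lemma eventually_ge_below_candidates:
  assumes \<mu>: "\<And>v. v \<in> limit_candidates \<Longrightarrow> \<mu> < v" and \<epsilon>: "\<epsilon> > 0"
  shows "eventually (\<lambda>s. lam s \<ge> \<mu> - \<epsilon>) at_top"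
proof -
  obtain K \<phi> \<phi>' M E G C where "drift_eigenfamily c K m (deriv m) \<phi> \<phi>' M E G C lam"
    using drift_eigenfamily_exists by blast
  then interpret f: drift_eigenfamily c K m "deriv m" \<phi> \<phi>' M E G C lam .
  have "eventually (\<lambda>s. f.F \<mu> s 1 - f.F \<mu> s 0 \<ge> - \<epsilon>) at_top"
    by (rule f.energy_lower_bound[where \<mu> = \<mu>, OF less_imp_neq[OF m'_0, symmetric] \<epsilon> point_or_supersolution[OF \<mu>]])
  then show ?thesis by (rule eventually_mono) (simp add: f.F_period)
qed

lemma lam_bounded: "\<exists>K. \<forall>s. \<bar>lam s\<bar> \<le> K"
proof -
  obtain K \<phi> \<phi>' M E G C where "drift_eigenfamily c K m (deriv m) \<phi> \<phi>' M E G C lam"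
    using drift_eigenfamily_exists by blast
  then interpret f: drift_eigenfamily c K m "deriv m" \<phi> \<phi>' M E G C lam .
  show ?thesis using f.lam_bound by blast
qed

text \<open>Without candidates the lower bound would hold for every \<open>\<mu>\<close>, in
  particular for one beyond the uniform bound on the eigenvalue.\<close>

lemma limit_candidates_nonempty: "limit_candidates \<noteq> {}"
proof
  assume empty: "limit_candidates = {}"
  obtain K where K: "\<forall>s. \<bar>lam s\<bar> \<le> K" using lam_bounded by blast
  have "eventually (\<lambda>s. lam s \<ge> (K + 2) - 1) at_top"
    by (rule eventually_ge_below_candidates) (simp_all add: empty)
  then have "\<exists>s. lam s \<ge> (K + 2) - 1" by (rule eventually_happens'[rotated]) simp
  then obtain s where "lam s \<ge> (K + 2) - 1" by (rule exE)
  then show False using K[rule_format, of s] by linarith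
qed

lemma lam_tendsto:
  assumes v: "is_minimum limit_candidates v"
  shows "(lam \<longlongrightarrow> v) at_top"
proof (rule order_tendstoI)
  fix a assume "a < v"
  \<comment> \<open>With \<open>\<mu>\<close> the midpoint of \<open>a\<close> and \<open>v\<close>,
    an error of \<open>(v - a) / 4\<close> still leaves the lower bound above
    \<open>a\<close>.\<close>
  then have "(a + v) / 2 < w" if "w \<in> limit_candidates" for w
    using v that unfolding is_minimum_def by force
  from eventually_ge_below_candidates[OF this, of "(v - a) / 4"]
  have "eventually (\<lambda>s. lam s \<ge> (a + v) / 2 - (v - a) / 4) at_top" using \<open>a < v\<close> by simp
  then show "eventually (\<lambda>s. a < lam s) at_top"
    by (rule eventually_mono) (use \<open>a < v\<close> in \<open>simp add: field_simps\<close>)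
next
  fix a assume "v < a"
  have "eventually (\<lambda>s. lam s \<le> v + (a - v) / 2) at_top"
    by (rule eventually_le_candidate) (use v \<open>v < a\<close> in \<open>simp_all add: is_minimum_def\<close>)
  then show "eventually (\<lambda>s. lam s < a) at_top"
    by (rule eventually_mono) (use \<open>v < a\<close> in \<open>simp add: field_simps\<close>)
qed

end

theorem theorem1p3:
  fixes m c :: "real \<Rightarrow> real"
  assumes "C2_with UNIV m (deriv m) (deriv (deriv m))"
    and "continuous_on UNIV c"
    and "\<forall>x. m (x + 1) = m x"
    and "\<forall>x. c (x + 1) = c x"
    and "\<not> m constant_on UNIV"
    and "finitely_many_sign_changes (deriv m)"
    and "deriv m 0 > 0"
  shows "let V1 = c ` isolated_local_maxima m;
             V2 = segment_eigenvalues c Neumann Dirichlet (segments m I I);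
             V3 = segment_eigenvalues c Neumann Neumann (segments m I D);
             V4 = segment_eigenvalues c Dirichlet Dirichlet (segments m D I);
             V5 = segment_eigenvalues c Dirichlet Neumann (segments m D D);
             LL = minima {V2, V3, V4, V5}
         in (\<forall>V\<in>{V1, V2, V3, V4, V5}. V \<noteq> {} \<longrightarrow> has_minimum V) \<and>
            has_minimum (minima {LL, V1}) \<and>
            ((\<lambda>s. periodic_principal_eigenvalue m c s) \<longlongrightarrow> minimum (minima {LL, V1})) at_top"
proof -
  interpret sign_changing_drift m c by unfold_locales (use assms in simp_all)
  define V1 V2 V3 V4 V5 LL where "V1 = c ` isolated_local_maxima m"
    and "V2 = segment_eigenvalues c Neumann Dirichlet (segments m I I)"
    and "V3 = segment_eigenvalues c Neumann Neumann (segments m I D)"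
    and "V4 = segment_eigenvalues c Dirichlet Dirichlet (segments m D I)"
    and "V5 = segment_eigenvalues c Dirichlet Neumann (segments m D D)"
    and LL: "LL = minima {V2, V3, V4, V5}"
  note V = V1_def V2_def V3_def V4_def V5_def
  have seg: "V2 = segment_values I I" "V3 = segment_values I D" "V4 = segment_values D I" "V5 = segment_values D D"
    by (simp_all add: V segment_values_def)
  have "(\<Union>l r. segment_values l r) = V2 \<union> V3 \<union> V4 \<union> V5"
    unfolding seg by (auto; metis endpoint_type.exhaust)
  \<comment> \<open>The limit is known for the flat set of all candidates; the rest of the proof
    identifies its minimum with the nested one.\<close>
  then have cand: "limit_candidates = V1 \<union> \<Union>{V2, V3, V4, V5}" by (auto simp: limit_candidates_def V(1))
  have min1: "has_minimum V1" if ne: "V1 \<noteq> {}"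
  proof -
    obtain k where "k \<in> V1" using ne by blast
    moreover have "finite {v \<in> V1. v \<le> k}" using finite_isolated_local_maxima by (simp add: V)
    ultimately show ?thesis by (rule has_minimum_finite[rotated])
  qed
  have minV: "has_minimum A" if "A \<in> {V2, V3, V4, V5}" "A \<noteq> {}" for A
    using that segment_values_has_minimum unfolding seg by blast
  have un: "has_minimum (\<Union>{V2, V3, V4, V5})" if "\<Union>{V2, V3, V4, V5} \<noteq> {}"
  proof -
    have "V2 \<union> V3 = {} \<or> has_minimum (V2 \<union> V3)" "V4 \<union> V5 = {} \<or> has_minimum (V4 \<union> V5)"
      using has_minimum_Un[of V2 V3] has_minimum_Un[of V4 V5] minV by blast+
    then have "has_minimum ((V2 \<union> V3) \<union> (V4 \<union> V5))" by (rule has_minimum_Un) (use that in auto)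
    then show ?thesis by (simp add: Un_assoc)
  qed
  have LL_min: "is_minimum LL v" if "is_minimum (\<Union>{V2, V3, V4, V5}) v" for v
    unfolding LL by (rule is_minimum_minima[OF that minV])
  have LL_sub: "LL \<subseteq> \<Union>{V2, V3, V4, V5}"
  proof
    fix w assume "w \<in> LL"
    then obtain A where A: "A \<in> {V2, V3, V4, V5}" "A \<noteq> {}" "w = minimum A" unfolding LL minima_def by blast
    then have "w \<in> A" using is_minimum_minimum[OF minV[OF A(1,2)]] by (simp add: is_minimum_def)
    then show "w \<in> \<Union>{V2, V3, V4, V5}" using A(1) by blast
  qed
  have LL_has: "has_minimum LL" if "LL \<noteq> {}"
  proof -
    have "\<Union>{V2, V3, V4, V5} \<noteq> {}" using that LL_sub by blast
    from un[OF this] obtain v where "is_minimum (\<Union>{V2, V3, V4, V5}) v" unfolding has_minimum_iff by (rule exE)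
    from LL_min[OF this] show ?thesis unfolding has_minimum_iff by (rule exI)
  qed
  have "has_minimum (V1 \<union> \<Union>{V2, V3, V4, V5})"
  proof (rule has_minimum_Un)
    show "V1 = {} \<or> has_minimum V1" using min1 by (cases "V1 = {}") simp_all
    show "\<Union>{V2, V3, V4, V5} = {} \<or> has_minimum (\<Union>{V2, V3, V4, V5})" using un by (cases "\<Union>{V2, V3, V4, V5} = {}") simp_all
    show "V1 \<union> \<Union>{V2, V3, V4, V5} \<noteq> {}" using limit_candidates_nonempty unfolding cand .
  qed
  then obtain v where v: "is_minimum limit_candidates v" unfolding cand has_minimum_iff by (rule exE)
  have "is_minimum (\<Union>{LL, V1}) v"
    unfolding is_minimum_def
  proof
    \<comment> \<open>A minimal candidate outside \<open>V1\<close> is minimal among all segment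
      eigenvalues, hence also the minimum of its own family.\<close>
    have "v \<in> V1 \<or> v \<in> LL"
    proof (cases "v \<in> V1")
      case False
      then have "is_minimum (\<Union>{V2, V3, V4, V5}) v" using v unfolding cand is_minimum_def by blast
      then show ?thesis using LL_min by (auto simp: is_minimum_def)
    qed simp
    then show "v \<in> \<Union>{LL, V1}" by blast
    show "\<forall>w\<in>\<Union>{LL, V1}. v \<le> w" using v LL_sub unfolding cand is_minimum_def by blast
  qed
  then have min: "is_minimum (minima {LL, V1}) v"
    by (rule is_minimum_minima) (use min1 LL_has in blast)
  have "(\<forall>V\<in>{V1, V2, V3, V4, V5}. V \<noteq> {} \<longrightarrow> has_minimum V) \<and> has_minimum (minima {LL, V1}) \<and>
      ((\<lambda>s. periodic_principal_eigenvalue m c s) \<longlongrightarrow> minimum (minima {LL, V1})) at_top"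
  proof (intro conjI ballI impI)
    show "has_minimum A" if "A \<in> {V1, V2, V3, V4, V5}" "A \<noteq> {}" for A using that min1 minV[of A] by blast
    show "has_minimum (minima {LL, V1})" using min has_minimum_iff by blast
    show "((\<lambda>s. periodic_principal_eigenvalue m c s) \<longlongrightarrow> minimum (minima {LL, V1})) at_top"
      unfolding minimum_eq[OF min] by (rule lam_tendsto[OF v])
  qed
  then show ?thesis unfolding V LL Let_def .
qed

end
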